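(* Let $S=(-\frac{\pi}{2},\frac{\pi}{2})^2\subset\mathbb{R}^2$. There exists $h_9^*<0$ such that the ninth eigenvalue $\lambda_{9,h}(S)$ of the Robin Laplacian on $S$ with parameter $h$ is Courant-sharp for $h_9^*\le h\le 0$ and is not Courant-sharp for $h<h_9^*$. Numerically, $h_9^*\approx-1.6293$.
   Context: For $h\in\mathbb{R}$, the eigenvalues of the Robin Laplacian on $S$ with parameter $h$ are the numbers $\lambda_{1,h}(S)\le\lambda_{2,h}(S)\le\dots$ (listed in nondecreasing order, repeated according to multiplicity, indexed from $1$) for which there is a nonzero $u\in H^1(S)$ with $-\Delta u=\lambda_{k,h}(S)u$ in $S$ and $\frac{\partial u}{\partial\nu}+hu=0$ on $\partial S$, where $\nu$ is the outward-pointing unit normal. (The associated quadratic form is $u\mapsto\int_S|\nabla u|^2+h\int_{\partial S}|u|^2\,d\sigma$ on $H^1(S)$.) A nodal domain of an eigenfunction $u$ is a connected component of $S\setminus u^{-1}(0)$. The eigenvalue $\lambda_{k,h}(S)$ is called Courant-sharp if it has a corresponding eigenfunction with exactly $k$ nodal domains. *)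

theory Defs
  imports "HOL-Analysis.Analysis"
begin

text \<open>Functions on the square and on its boundary are represented by functions on the
  whole plane; only their values on the respective set matter, up to null sets.\<close>

definition square :: "(real \<times> real) set" where
  "square = {- (pi/2)<..<pi/2} \<times> {- (pi/2)<..<pi/2}"

abbreviation area :: "(real \<times> real) measure" where
  "area \<equiv> restrict_space lborel square"

text \<open>Parametrisation by arc length of the four closed sides \<open>x = \<plusminus>pi/2\<close> and \<open>y = \<plusminus>pi/2\<close>.\<close>

definition side :: "bool \<times> bool \<Rightarrow> real \<Rightarrow> real \<times> real" where
  "side i t = (let c = (if snd i then pi/2 else - (pi/2)) in if fst i then (c, t) else (t, c))"

text \<open>Surface measure on the boundary, as a Borel measure on the plane. Each corner lies on two
  sides, but corners are null sets.\<close>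

definition bdry :: "(real \<times> real) measure" where
  "bdry = distr (count_space UNIV \<Otimes>\<^sub>M restrict_space lborel {- (pi/2)..pi/2}) borel
            (\<lambda>(i, t). side i t)"

definition L2 :: "'a measure \<Rightarrow> ('a \<Rightarrow> 'b::euclidean_space) \<Rightarrow> bool" where
  "L2 M f \<longleftrightarrow> f \<in> borel_measurable M \<and> integrable M (\<lambda>x. (norm (f x))\<^sup>2)"

text \<open>\<open>\<phi>\<close> is of class \<open>C\<^sup>1\<close> on the plane, with gradient \<open>\<Phi>\<close>.\<close>

definition C1_grad :: "(real \<times> real \<Rightarrow> real) \<Rightarrow> (real \<times> real \<Rightarrow> real \<times> real) \<Rightarrow> bool" where
  "C1_grad \<phi> \<Phi> \<longleftrightarrow>
     (\<forall>x. (\<phi> has_derivative (\<lambda>v. \<Phi> x \<bullet> v)) (at x)) \<and> continuous_on UNIV \<Phi>"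

definition test_grad :: "(real \<times> real \<Rightarrow> real) \<Rightarrow> (real \<times> real \<Rightarrow> real \<times> real) \<Rightarrow> bool" where
  "test_grad \<phi> \<Phi> \<longleftrightarrow>
     C1_grad \<phi> \<Phi> \<and> (\<exists>K. compact K \<and> K \<subseteq> square \<and> (\<forall>x. x \<notin> K \<longrightarrow> \<phi> x = 0))"

text \<open>\<open>u\<close> belongs to the Sobolev space \<open>H\<^sup>1\<close> of the square and \<open>G\<close> is its weak gradient.\<close>

definition H1_grad :: "(real \<times> real \<Rightarrow> real) \<Rightarrow> (real \<times> real \<Rightarrow> real \<times> real) \<Rightarrow> bool" where
  "H1_grad u G \<longleftrightarrow> L2 area u \<and> L2 area G \<and>
     (\<forall>\<phi> \<Phi>. test_grad \<phi> \<Phi> \<longrightarrow>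
        (LINT x|area. u x *\<^sub>R \<Phi> x) = - (LINT x|area. \<phi> x *\<^sub>R G x))"

text \<open>The trace operator is the continuous extension from \<open>C\<^sup>1\<close> functions up to the boundary,
  which are dense in \<open>H\<^sup>1\<close>, of the restriction to the boundary.\<close>

definition has_trace :: "(real \<times> real \<Rightarrow> real) \<Rightarrow> (real \<times> real \<Rightarrow> real) \<Rightarrow> bool" where
  "has_trace u g \<longleftrightarrow> L2 bdry g \<and>
     (\<exists>G \<phi> \<Phi>. H1_grad u G \<and> (\<forall>n::nat. C1_grad (\<phi> n) (\<Phi> n)) \<and>
        (\<lambda>n. LINT x|area. (\<phi> n x - u x)\<^sup>2) \<longlonglongrightarrow> 0 \<and>
        (\<lambda>n. LINT x|area. (norm (\<Phi> n x - G x))\<^sup>2) \<longlonglongrightarrow> 0 \<and>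
        (\<lambda>n. LINT x|bdry. (\<phi> n x - g x)\<^sup>2) \<longlonglongrightarrow> 0)"

text \<open>\<open>\<Delta>u = f\<close> in the sense of distributions, for \<open>u\<close> in \<open>H\<^sup>1\<close> and \<open>f\<close> in \<open>L\<^sup>2\<close>.\<close>

definition has_laplacian :: "(real \<times> real \<Rightarrow> real) \<Rightarrow> (real \<times> real \<Rightarrow> real) \<Rightarrow> bool" where
  "has_laplacian u f \<longleftrightarrow> L2 area f \<and>
     (\<exists>G. H1_grad u G \<and>
        (\<forall>\<phi> \<Phi>. test_grad \<phi> \<Phi> \<longrightarrow> (LINT x|area. G x \<bullet> \<Phi> x) = - (LINT x|area. f x * \<phi> x)))"

text \<open>\<open>q\<close> is the outward normal derivative of \<open>u\<close>, in the sense of Green's formula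
  \<open>\<integral>\<nabla>u\<cdot>\<nabla>v + \<integral>(\<Delta>u)v = \<integral>qv d\<sigma>\<close> for all \<open>v\<close> in \<open>H\<^sup>1\<close>.\<close>

definition has_normal_derivative :: "(real \<times> real \<Rightarrow> real) \<Rightarrow> (real \<times> real \<Rightarrow> real) \<Rightarrow> bool" where
  "has_normal_derivative u q \<longleftrightarrow> L2 bdry q \<and>
     (\<exists>G f. H1_grad u G \<and> has_laplacian u f \<and>
        (\<forall>v V w. H1_grad v V \<and> has_trace v w \<longrightarrow>
           (LINT x|area. G x \<bullet> V x) + (LINT x|area. f x * v x) = (LINT x|bdry. q x * w x)))"

text \<open>\<open>u\<close> is in \<open>H\<^sup>1\<close> with \<open>-\<Delta>u = \<mu>u\<close> in the square and \<open>\<partial>u/\<partial>\<nu> + hu = 0\<close> on its boundary;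
  \<open>u = 0\<close> is allowed.\<close>

definition robin_solution :: "real \<Rightarrow> real \<Rightarrow> (real \<times> real \<Rightarrow> real) \<Rightarrow> bool" where
  "robin_solution h \<mu> u \<longleftrightarrow>
     (\<exists>f g q. has_laplacian u f \<and> has_trace u g \<and> has_normal_derivative u q \<and>
        (AE x in area. - f x = \<mu> * u x) \<and>
        (AE x in bdry. q x + h * g x = 0))"

definition robin_eigenfunction :: "real \<Rightarrow> real \<Rightarrow> (real \<times> real \<Rightarrow> real) \<Rightarrow> bool" where
  "robin_eigenfunction h \<mu> u \<longleftrightarrow> robin_solution h \<mu> u \<and> \<not> (AE x in area. u x = 0)"

text \<open>The space of solutions, modulo equality almost everywhere, has dimension \<open>n\<close>.\<close>

definition robin_multiplicity :: "real \<Rightarrow> real \<Rightarrow> nat \<Rightarrow> bool" where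
  "robin_multiplicity h \<mu> n \<longleftrightarrow>
     (\<exists>e. (\<forall>i<n. robin_solution h \<mu> (e i)) \<and>
        (\<forall>c::nat \<Rightarrow> real. (AE x in area. (\<Sum>i<n. c i * e i x) = 0) \<longrightarrow> (\<forall>i<n. c i = 0)) \<and>
        (\<forall>u. robin_solution h \<mu> u \<longrightarrow>
           (\<exists>c::nat \<Rightarrow> real. AE x in area. u x = (\<Sum>i<n. c i * e i x))))"

text \<open>The values \<open>l 1 \<le> l 2 \<le> \<dots>\<close> list all eigenvalues, repeated according to multiplicity
  (\<open>l 0\<close> is irrelevant). Real numbers that are not eigenvalues have multiplicity \<open>0\<close>, hence do
  not occur in the list.\<close>

definition robin_eigenvalue_list :: "real \<Rightarrow> (nat \<Rightarrow> real) \<Rightarrow> bool" where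
  "robin_eigenvalue_list h l \<longleftrightarrow> mono_on {1..} l \<and>
     (\<forall>\<mu>. finite {k. 1 \<le> k \<and> l k = \<mu>} \<and> robin_multiplicity h \<mu> (card {k. 1 \<le> k \<and> l k = \<mu>}))"

definition robin_eigenvalue :: "nat \<Rightarrow> real \<Rightarrow> real" where
  "robin_eigenvalue k h = (THE \<mu>. \<exists>l. robin_eigenvalue_list h l \<and> l k = \<mu>)"

definition nodal_domains :: "(real \<times> real \<Rightarrow> real) \<Rightarrow> (real \<times> real) set set" where
  "nodal_domains u = components (square - u -` {0})"

text \<open>Nodal domains are those of the continuous representative of the eigenfunction.\<close>

definition courant_sharp :: "nat \<Rightarrow> real \<Rightarrow> bool" where
  "courant_sharp k h \<longleftrightarrow>
     (\<exists>u. robin_eigenfunction h (robin_eigenvalue k h) u \<and> continuous_on square u \<and>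
        finite (nodal_domains u) \<and> card (nodal_domains u) = k)"

end

theory Submission
  imports Defs "HOL-Complex_Analysis.Complex_Analysis" "HOL-Real_Asymp.Real_Asymp"
begin

text \<open>The one-dimensional Robin modes are complete: if \<open>f\<close> is orthogonal to all of them, then its cosine
  and sine transforms, divided by the characteristic functions, whose zeros are real and simple, are entire and tend
  to zero on large squares. So they vanish, and with them all moments of \<open>f\<close>. Hence the
  eigenfunctions on the square are the combinations of products of modes.

  Let \<open>t = -h \<ge> 0\<close> and let \<open>-p\<^sup>2 < m < a\<^sup>2 < b\<^sup>2\<close> be the first four eigenvalues in dimension one,
  which alternate between even and odd modes. The ninth eigenvalue of the square is the minimum of
  \<open>2a\<^sup>2\<close> and \<open>b\<^sup>2 - p\<^sup>2\<close>. If it is \<open>2a\<^sup>2\<close>, then \<open>cos (ax) cos (ay)\<close> has nine nodal domains. If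
  \<open>b\<^sup>2 - p\<^sup>2 < 2a\<^sup>2\<close>, then every eigenfunction is odd under the central reflection, so it has
  an even number of nodal domains. Finally, \<open>b\<^sup>2 - p\<^sup>2 - 2a\<^sup>2\<close> is nonnegative for small \<open>t\<close> and then strictly
  decreasing and Lipschitz continuous, and rational bounds locate its change of sign.\<close>

section \<open>Integration over the square and its boundary\<close>

text \<open>\<open>robin_eigenvalue\<close> reads off the k-th entry of a list in which every real
  number occurs as often as the dimension of its solution space. Exhibiting eigenfunctions is
  therefore not enough: all weak solutions for all real values must be known, which is why
  completeness is proved. With z = w^2 as variable the transforms are entire in z, and imaginary,
  zero and real w, that is negative, zero and positive eigenvalues, are treated at once. The ninth
  value is the stated minimum because eight products of the first three modes always lie below both
  candidates; this rests on m + a^2 < b^2 - p^2, which in turn follows from b^2 \<ge> a^2 + 3 and m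
  + p^2 < 3. The derivative of b^2 - p^2 - 2a^2 in t is not controlled uniformly: 2a^2 falls too
  fast while a is close to 2. Monotonicity is shown only from t = 1.38 on, where a \<le> 1.54. Below
  that the difference is so far from negative that crude bounds on three ranges suffice.\<close>

lemma set_integral_zero_of_boxes:
  fixes f :: "'a::euclidean_space \<Rightarrow> real"
  assumes f: "integrable lborel f"
    and supp: "\<And>x. x \<notin> box p q \<Longrightarrow> f x = 0"
    and boxes: "\<And>a b. set_lebesgue_integral lborel (box a b) f = 0"
  shows "AE x in lborel. f x = 0"
proof -
  \<comment> \<open>The support condition lets the whole space count as one box; complements in the
    induction below depend on this.\<close>
  have total: "integral\<^sup>L lborel f = 0"
  proof -
    have "integral\<^sup>L lborel f = set_lebesgue_integral lborel (box p q) f"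
      unfolding set_lebesgue_integral_def
      by (rule Bochner_Integration.integral_cong) (auto simp: indicator_def supp)
    then show ?thesis using boxes by simp
  qed
  have si: "set_integrable lborel A f" if "A \<in> sets borel" for A
    unfolding set_integrable_def real_scaleR_def mult.commute[of "indicator _ _"]
    using integrable_real_mult_indicator[of A lborel f] that f by simp
  \<comment> \<open>Dynkin's pi-lambda argument: open boxes are stable under intersection and
    generate the Borel sets.\<close>
  have "set_lebesgue_integral lborel A f = 0" if "A \<in> sets borel" for A
  proof -
    have eq: "sets (borel :: 'a measure) = sigma_sets UNIV (range (\<lambda>(a, b). box a b))"
      unfolding borel_eq_box by (rule sets_measure_of) auto
    have "Int_stable (range (\<lambda>(a, b). box a b :: 'a set))"
    proof (rule Int_stableI)
      fix A B :: "'a set"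
      assume "A \<in> range (\<lambda>(a, b). box a b)" "B \<in> range (\<lambda>(a, b). box a b)"
      then obtain a b c d where "A = box a b" "B = box c d" by auto
      then have "A \<inter> B = (\<lambda>(a, b). box a b)
          (\<Sum>i\<in>Basis. max (a \<bullet> i) (c \<bullet> i) *\<^sub>R i, \<Sum>i\<in>Basis. min (b \<bullet> i) (d \<bullet> i) *\<^sub>R i)"
        by (simp add: box_Int_box)
      then show "A \<inter> B \<in> range (\<lambda>(a, b). box a b)" by blast
    qed
    moreover have "range (\<lambda>(a, b). box a b :: 'a set) \<subseteq> Pow UNIV" by auto
    moreover have "A \<in> sigma_sets UNIV (range (\<lambda>(a, b). box a b))"
      using that eq by simp
    ultimately show ?thesis
    proof (induction rule: sigma_sets_induct_disjoint)
      case (basic A)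
      then show ?case using boxes by auto
    next
      case empty
      then show ?case by (simp add: set_lebesgue_integral_def)
    next
      case (compl A)
      then have A: "A \<in> sets borel" using eq by simp
      have "integral\<^sup>L lborel f = set_lebesgue_integral lborel (A \<union> (UNIV - A)) f"
        by (simp add: set_lebesgue_integral_def)
      also have "\<dots> = set_lebesgue_integral lborel A f + set_lebesgue_integral lborel (UNIV - A) f"
        by (rule set_integral_Un) (use A in \<open>auto intro!: si\<close>)
      finally show ?case using total compl by simp
    next
      case (union A)
      then have A: "A i \<in> sets borel" for i using eq by auto
      have "set_lebesgue_integral lborel (\<Union>i. A i) f = (\<Sum>i. set_lebesgue_integral lborel (A i) f)"
        by (rule lebesgue_integral_countable_add)
           (use union A in \<open>auto intro!: si simp: disjoint_family_on_def\<close>)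
      then show ?case using union by simp
    qed
  qed
  then have "AE x in lborel. f x = (\<lambda>_. 0) x"
    by (intro density_unique_real f) (auto simp: set_lebesgue_integral_def)
  then show ?thesis by simp
qed

section \<open>Lebesgue measure on the square as a product measure\<close>

abbreviation side_measure :: "real measure" where
  "side_measure \<equiv> restrict_space lborel {- (pi/2)<..<pi/2}"

lemma square_borel [measurable]: "square \<in> sets borel"
  unfolding square_def by (rule borel_open) (auto intro: open_Times)

lemma open_square: "open square"
  unfolding square_def by (auto intro: open_Times)

lemma emeasure_side_measure: "emeasure side_measure (space side_measure) = ennreal pi"
  by (simp add: emeasure_restrict_space space_restrict_space sets_restrict_space_iff)

lemma finite_measure_side_measure: "finite_measure side_measure"
  by (rule finite_measureI) (simp only: emeasure_side_measure ennreal_neq_top infinity_ennreal_def not_False_eq_True)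

interpretation J: finite_measure side_measure
  by (rule finite_measure_side_measure)

interpretation JJ: pair_sigma_finite side_measure side_measure ..

text \<open>Gives access to Fubini's theorem. Measurable sets agree because the identity map is
  measurable in both directions; the values then have to be compared on rectangles only.\<close>

lemma area_eq_pair: "area = side_measure \<Otimes>\<^sub>M side_measure"
proof (rule sym, rule pair_measure_eqI)
  show "sigma_finite_measure side_measure" "sigma_finite_measure side_measure" by unfold_locales
  have 1: "sets (side_measure \<Otimes>\<^sub>M side_measure) =
     sets (restrict_space borel {- (pi/2)<..<pi/2} \<Otimes>\<^sub>M restrict_space borel {- (pi/2)<..<pi/2})"
    by (intro sets_pair_measure_cong sets_restrict_space_cong) auto
  show "sets (side_measure \<Otimes>\<^sub>M side_measure) = sets area"
  proof -
    have "sets area = sets (restrict_space (borel \<Otimes>\<^sub>M borel :: (real\<times>real) measure) square)"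
      by (intro sets_restrict_space_cong) (simp only: borel_prod sets_lborel)
    also have "\<dots> = sets (side_measure \<Otimes>\<^sub>M side_measure)"
    proof (rule set_eqI, rule iffI)
      fix A assume "A \<in> sets (restrict_space (borel \<Otimes>\<^sub>M borel :: (real\<times>real) measure) square)"
      then obtain B where B: "B \<in> sets (borel \<Otimes>\<^sub>M borel :: (real\<times>real) measure)" "A = square \<inter> B"
        by (auto simp: sets_restrict_space)
      have "(\<lambda>x. x) \<in> measurable (side_measure \<Otimes>\<^sub>M side_measure) (borel \<Otimes>\<^sub>M borel)"
        by (rule measurable_pair)
           (auto simp: comp_def intro!: measurable_compose[OF measurable_fst measurable_restrict_space1]
             measurable_compose[OF measurable_snd measurable_restrict_space1])
      from measurable_sets[OF this B(1)] show "A \<in> sets (side_measure \<Otimes>\<^sub>M side_measure)"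
        by (simp add: B(2) space_pair_measure space_restrict_space square_def Int_commute)
    next
      have "(\<lambda>x. x) \<in> measurable (restrict_space (borel \<Otimes>\<^sub>M borel :: (real\<times>real) measure) square)
              (side_measure \<Otimes>\<^sub>M side_measure)"
        by (rule measurable_pair)
           (auto simp: comp_def square_def space_restrict_space space_pair_measure
             intro!: measurable_restrict_space2[OF _ measurable_restrict_space1])
      fix A assume A: "A \<in> sets (side_measure \<Otimes>\<^sub>M side_measure)"
      then have "A \<subseteq> square" using sets.sets_into_space[OF A]
        by (auto simp: space_pair_measure space_restrict_space square_def)
      with measurable_sets[OF \<open>(\<lambda>x. x) \<in> _\<close> A]
      show "A \<in> sets (restrict_space (borel \<Otimes>\<^sub>M borel :: (real\<times>real) measure) square)"
        by (simp add: space_restrict_space space_pair_measure Int_absorb1 Int_absorb2)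
    qed
    finally show ?thesis ..
  qed
  fix A B :: "real set" assume AB: "A \<in> sets side_measure" "B \<in> sets side_measure"
  then have AB': "A \<in> sets borel" "B \<in> sets borel" "A \<subseteq> {- (pi/2)<..<pi/2}" "B \<subseteq> {- (pi/2)<..<pi/2}"
    by (auto simp: sets_restrict_space_iff)
  then have "A \<times> B \<subseteq> square" by (auto simp: square_def)
  then have "emeasure area (A \<times> B) = emeasure (lborel \<Otimes>\<^sub>M lborel) (A \<times> B)"
    by (subst emeasure_restrict_space) (auto simp: lborel_prod)
  also have "\<dots> = emeasure lborel A * emeasure lborel B"
    by (subst lborel.emeasure_pair_measure_Times) (use AB' in auto)
  also have "\<dots> = emeasure side_measure A * emeasure side_measure B"
    using AB' by (simp add: emeasure_restrict_space)
  finally show "emeasure side_measure A * emeasure side_measure B = emeasure area (A \<times> B)" ..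
qed

lemma finite_measure_area: "finite_measure area"
  unfolding area_eq_pair by (rule finite_measure_pair_measure) unfold_locales

interpretation Q: finite_measure area
  by (rule finite_measure_area)

lemma integral_area_fst:
  fixes f :: "real \<times> real \<Rightarrow> real"
  assumes "integrable area f"
  shows "(LINT x|area. f x) = (LINT x|side_measure. LINT y|side_measure. f (x, y))"
  using JJ.integral_fst'[of f] assms unfolding area_eq_pair by simp

lemma integral_area_snd:
  fixes f :: "real \<times> real \<Rightarrow> real"
  assumes "integrable area f"
  shows "(LINT x|area. f x) = (LINT y|side_measure. LINT x|side_measure. f (x, y))"
  using JJ.integral_snd[of "\<lambda>x y. f (x, y)"] assms unfolding area_eq_pair by simp

text \<open>The closed square is taken because it carries both \<open>area\<close> and
  \<open>bdry\<close>, so that one bound serves both measures.\<close>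

lemma closed_square_bound:
  fixes f :: "real \<times> real \<Rightarrow> 'b::real_normed_vector"
  assumes "continuous_on UNIV f"
  obtains B where "B > 0" "\<And>x. x \<in> {- (pi/2)..pi/2} \<times> {- (pi/2)..pi/2} \<Longrightarrow> norm (f x) \<le> B"
proof -
  have "compact (f ` ({- (pi/2)..pi/2} \<times> {- (pi/2)..pi/2}))"
    by (intro compact_continuous_image compact_Times continuous_on_subset[OF assms]) auto
  then have "bounded (f ` ({- (pi/2)..pi/2} \<times> {- (pi/2)..pi/2}))" by (rule compact_imp_bounded)
  then show ?thesis using that unfolding bounded_pos by auto
qed

lemma measurable_area_continuous:
  fixes f :: "real \<times> real \<Rightarrow> 'b::euclidean_space"
  assumes "continuous_on UNIV f"
  shows "f \<in> borel_measurable area"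
  by (rule measurable_restrict_space1)
     (use borel_measurable_continuous_onI[OF assms] in simp)

lemma integrable_area_continuous:
  fixes f :: "real \<times> real \<Rightarrow> 'b::euclidean_space"
  assumes "continuous_on UNIV f"
  shows "integrable area f"
proof -
  obtain B where "B > 0" "\<And>x. x \<in> {- (pi/2)..pi/2} \<times> {- (pi/2)..pi/2} \<Longrightarrow> norm (f x) \<le> B"
    using closed_square_bound[OF assms] by blast
  then show ?thesis
    by (intro Q.integrable_const_bound[of _ B] measurable_area_continuous assms AE_I2)
       (auto simp: space_restrict_space square_def)
qed

lemma integrable_side_continuous:
  fixes f :: "real \<Rightarrow> 'b::euclidean_space"
  assumes "continuous_on {- (pi/2)..pi/2} f"
  shows "integrable side_measure f"
proof -
  have "set_integrable lborel {- (pi/2)..pi/2} f"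
    using borel_integrable_compact[OF compact_Icc assms]
    by (simp add: set_integrable_def indicator_scaleR_eq_if)
  then have "set_integrable lborel {- (pi/2)<..<pi/2} f"
    by (rule set_integrable_subset) auto
  then show ?thesis
    by (subst integrable_restrict_space) (auto simp: set_integrable_def)
qed

lemma L2_area_continuous:
  fixes f :: "real \<times> real \<Rightarrow> 'b::euclidean_space"
  assumes "continuous_on UNIV f"
  shows "L2 area f"
  unfolding L2_def
  by (intro conjI measurable_area_continuous assms integrable_area_continuous continuous_intros)

lemma integral_side_FTC:
  fixes f F :: "real \<Rightarrow> real"
  assumes "continuous_on UNIV f" "\<And>x. (F has_real_derivative f x) (at x)"
  shows "(LINT x|side_measure. f x) = F (pi/2) - F (- (pi/2))"
proof -
  have "(LINT x|side_measure. f x) = (LBINT x=-(pi/2)..pi/2. f x)"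
    by (subst integral_restrict_space)
       (auto simp: interval_lebesgue_integral_def set_lebesgue_integral_def)
  also have "\<dots> = F (pi/2) - F (- (pi/2))"
    by (rule interval_integral_FTC_finite)
       (auto intro: continuous_on_subset[OF assms(1)]
          has_vector_derivative_at_within assms(2)[unfolded has_real_derivative_iff_has_vector_derivative])
  finally show ?thesis .
qed

section \<open>Gradients of C1 functions and the divergence theorem\<close>

lemma C1_grad_continuous: "C1_grad \<phi> \<Phi> \<Longrightarrow> continuous_on UNIV \<phi>"
  unfolding C1_grad_def
  by (meson continuous_at_imp_continuous_on has_derivative_continuous)

lemma C1_gradD:
  assumes "C1_grad \<phi> \<Phi>"
  shows "(\<phi> has_derivative (\<lambda>v. \<Phi> x \<bullet> v)) (at x)" "continuous_on UNIV \<Phi>"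
  using assms unfolding C1_grad_def by blast+

lemma C1_gradI:
  assumes "\<And>x. (\<phi> has_derivative (\<lambda>v. \<Phi> x \<bullet> v)) (at x)" "continuous_on UNIV \<Phi>"
  shows "C1_grad \<phi> \<Phi>"
  using assms unfolding C1_grad_def by blast

lemma C1_grad_mult:
  assumes "C1_grad \<phi> \<Phi>" "C1_grad \<psi> \<Psi>"
  shows "C1_grad (\<lambda>x. \<phi> x * \<psi> x) (\<lambda>x. \<phi> x *\<^sub>R \<Psi> x + \<psi> x *\<^sub>R \<Phi> x)"
proof -
  have "((\<lambda>x. \<phi> x * \<psi> x) has_derivative (\<lambda>v. (\<phi> x *\<^sub>R \<Psi> x + \<psi> x *\<^sub>R \<Phi> x) \<bullet> v)) (at x)" for x
  proof -
    have "((\<lambda>x. \<phi> x * \<psi> x) has_derivative (\<lambda>v. \<phi> x * (\<Psi> x \<bullet> v) + (\<Phi> x \<bullet> v) * \<psi> x)) (at x)"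
      by (intro has_derivative_mult C1_gradD assms)
    then show ?thesis by (simp add: inner_add_left mult.commute)
  qed
  moreover have "continuous_on UNIV (\<lambda>x. \<phi> x *\<^sub>R \<Psi> x + \<psi> x *\<^sub>R \<Phi> x)"
    using assms by (intro continuous_intros C1_grad_continuous[OF assms(1)]
      C1_grad_continuous[OF assms(2)] C1_gradD)
  ultimately show ?thesis by (rule C1_gradI)
qed

lemma C1_grad_tensor:
  assumes "\<And>x. (X has_real_derivative X' x) (at x)" "continuous_on UNIV X'"
    and "\<And>x. (Y has_real_derivative Y' x) (at x)" "continuous_on UNIV Y'"
  shows "C1_grad (\<lambda>p. X (fst p) * Y (snd p)) (\<lambda>p. (X' (fst p) * Y (snd p), X (fst p) * Y' (snd p)))"
proof -
  have cX: "continuous_on UNIV X" "continuous_on UNIV Y"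
    using assms(1,3) by (meson DERIV_continuous continuous_at_imp_continuous_on)+
  have "((\<lambda>p. X (fst p)) has_derivative (\<lambda>v. X' (fst p) * fst v)) (at p)" for p :: "real \<times> real"
    by (rule has_derivative_compose[OF _ has_field_derivative_imp_has_derivative[OF assms(1)], unfolded])
       (rule has_derivative_fst[OF has_derivative_ident])
  moreover have "((\<lambda>p. Y (snd p)) has_derivative (\<lambda>v. Y' (snd p) * snd v)) (at p)" for p :: "real \<times> real"
    by (rule has_derivative_compose[OF _ has_field_derivative_imp_has_derivative[OF assms(3)], unfolded])
       (rule has_derivative_snd[OF has_derivative_ident])
  ultimately have "((\<lambda>p. X (fst p) * Y (snd p)) has_derivative
      (\<lambda>v. X (fst p) * (Y' (snd p) * snd v) + (X' (fst p) * fst v) * Y (snd p))) (at p)" for p :: "real \<times> real"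
    by (rule has_derivative_mult)
  moreover have "continuous_on UNIV (\<lambda>p. X (fst p))" "continuous_on UNIV (\<lambda>p. X' (fst p))"
     "continuous_on UNIV (\<lambda>p. Y (snd p))" "continuous_on UNIV (\<lambda>p. Y' (snd p))"
     for p :: "real \<times> real"
    by (rule continuous_on_compose2[OF cX(1)] continuous_on_compose2[OF cX(2)]
         continuous_on_compose2[OF assms(2)] continuous_on_compose2[OF assms(4)];
       auto intro: continuous_intros)+
  ultimately show ?thesis
    by (intro C1_gradI) (auto simp: inner_prod_def algebra_simps intro!: continuous_intros)
qed

lemma C1_grad_partial_derivatives:
  assumes "C1_grad \<psi> \<Psi>"
  shows "((\<lambda>x. \<psi> (x, y)) has_real_derivative fst (\<Psi> (x, y))) (at x)"
    and "((\<lambda>y. \<psi> (x, y)) has_real_derivative snd (\<Psi> (x, y))) (at y)"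
proof -
  have D: "(\<psi> has_derivative (\<lambda>v. \<Psi> p \<bullet> v)) (at p)" for p
    by (rule C1_gradD[OF assms])
  have "((\<lambda>x. \<psi> (x, y)) has_derivative (\<lambda>v. \<Psi> (x, y) \<bullet> (v, 0))) (at x)"
    by (rule has_derivative_compose[OF _ D]) (auto intro!: derivative_eq_intros)
  then show "((\<lambda>x. \<psi> (x, y)) has_real_derivative fst (\<Psi> (x, y))) (at x)"
    by (simp add: has_field_derivative_def inner_prod_def)
  have "((\<lambda>y. \<psi> (x, y)) has_derivative (\<lambda>v. \<Psi> (x, y) \<bullet> (0, v))) (at y)"
    by (rule has_derivative_compose[OF _ D]) (auto intro!: derivative_eq_intros)
  then show "((\<lambda>y. \<psi> (x, y)) has_real_derivative snd (\<Psi> (x, y))) (at y)"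
    by (simp add: has_field_derivative_def inner_prod_def)
qed

text \<open>Fubini in the order that integrates the differentiated variable first, then the
  fundamental theorem of calculus on each line.\<close>

lemma divergence_C1:
  assumes "C1_grad \<psi> \<Psi>"
  shows "(LINT x|area. fst (\<Psi> x)) = (LINT y|side_measure. \<psi> (pi/2, y) - \<psi> (- (pi/2), y))"
    and "(LINT x|area. snd (\<Psi> x)) = (LINT x|side_measure. \<psi> (x, pi/2) - \<psi> (x, - (pi/2)))"
proof -
  have c: "continuous_on UNIV (\<lambda>x. fst (\<Psi> x))" "continuous_on UNIV (\<lambda>x. snd (\<Psi> x))"
    using assms by (auto simp: C1_grad_def intro!: continuous_intros)
  have c': "continuous_on UNIV (\<lambda>x. fst (\<Psi> (x, y)))" "continuous_on UNIV (\<lambda>y. snd (\<Psi> (x, y)))" for x y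
    by (rule continuous_on_compose2[OF c(1)] continuous_on_compose2[OF c(2)];
        auto intro!: continuous_intros)+
  have "(LINT x|area. fst (\<Psi> x)) = (LINT y|side_measure. LINT x|side_measure. fst (\<Psi> (x, y)))"
    by (rule integral_area_snd) (rule integrable_area_continuous[OF c(1)])
  also have "\<dots> = (LINT y|side_measure. \<psi> (pi/2, y) - \<psi> (- (pi/2), y))"
    by (rule Bochner_Integration.integral_cong[OF refl], rule integral_side_FTC)
       (rule c' C1_grad_partial_derivatives[OF assms])+
  finally show "(LINT x|area. fst (\<Psi> x)) = (LINT y|side_measure. \<psi> (pi/2, y) - \<psi> (- (pi/2), y))" .
  have "(LINT x|area. snd (\<Psi> x)) = (LINT x|side_measure. LINT y|side_measure. snd (\<Psi> (x, y)))"
    by (rule integral_area_fst) (rule integrable_area_continuous[OF c(2)])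
  also have "\<dots> = (LINT x|side_measure. \<psi> (x, pi/2) - \<psi> (x, - (pi/2)))"
    by (rule Bochner_Integration.integral_cong[OF refl], rule integral_side_FTC)
       (rule c' C1_grad_partial_derivatives[OF assms])+
  finally show "(LINT x|area. snd (\<Psi> x)) = (LINT x|side_measure. \<psi> (x, pi/2) - \<psi> (x, - (pi/2)))" .
qed

lemma integral_area_pair:
  fixes F :: "real \<times> real \<Rightarrow> real \<times> real"
  assumes "integrable area F"
  shows "(LINT x|area. F x) = (LINT x|area. fst (F x), LINT x|area. snd (F x))"
  using integral_bounded_linear[OF bounded_linear_fst assms]
    integral_bounded_linear[OF bounded_linear_snd assms] by (simp add: prod_eq_iff)

lemma integral_gradient_zero:
  assumes "C1_grad \<psi> \<Psi>" "\<And>x. x \<notin> square \<Longrightarrow> \<psi> x = 0"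
  shows "(LINT x|area. fst (\<Psi> x)) = 0" "(LINT x|area. snd (\<Psi> x)) = 0"
proof -
  have "\<psi> (pi/2, y) = 0" "\<psi> (- (pi/2), y) = 0" "\<psi> (x, pi/2) = 0" "\<psi> (x, - (pi/2)) = 0" for x y
    by (rule assms(2), simp add: square_def)+
  then show "(LINT x|area. fst (\<Psi> x)) = 0" "(LINT x|area. snd (\<Psi> x)) = 0"
    by (simp_all add: divergence_C1[OF assms(1)])
qed

lemma test_grad_zero: "test_grad \<phi> \<Phi> \<Longrightarrow> x \<notin> square \<Longrightarrow> \<phi> x = 0"
  unfolding test_grad_def by blast

text \<open>The product of \<open>\<psi>\<close> and \<open>\<phi>\<close> vanishes off the square,
  so its gradient has integral zero; the product rule splits this into the two terms.\<close>

lemma C1_test_integral: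
  assumes \<psi>: "C1_grad \<psi> \<Psi>" and \<phi>: "test_grad \<phi> \<Phi>"
  shows "(LINT x|area. \<psi> x * fst (\<Phi> x)) = - (LINT x|area. \<phi> x * fst (\<Psi> x))"
    and "(LINT x|area. \<psi> x * snd (\<Phi> x)) = - (LINT x|area. \<phi> x * snd (\<Psi> x))"
proof -
  have \<phi>': "C1_grad \<phi> \<Phi>" using \<phi> by (simp add: test_grad_def)
  note P = C1_grad_mult[OF \<psi> \<phi>']
  note [continuous_intros] = C1_grad_continuous[OF \<psi>] C1_grad_continuous[OF \<phi>']
  have [continuous_intros]: "continuous_on UNIV \<Psi>" "continuous_on UNIV \<Phi>"
    using \<psi> \<phi>' by (auto simp: C1_grad_def)
  have z: "\<psi> x * \<phi> x = 0" if "x \<notin> square" for x using test_grad_zero[OF \<phi> that] by simp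
  have "(LINT x|area. \<psi> x * fst (\<Phi> x)) + (LINT x|area. \<phi> x * fst (\<Psi> x)) = 0"
    using integral_gradient_zero(1)[OF P z]
    by (subst Bochner_Integration.integral_add[symmetric]) (auto intro!: integrable_area_continuous continuous_intros)
  then show "(LINT x|area. \<psi> x * fst (\<Phi> x)) = - (LINT x|area. \<phi> x * fst (\<Psi> x))" by simp
  have "(LINT x|area. \<psi> x * snd (\<Phi> x)) + (LINT x|area. \<phi> x * snd (\<Psi> x)) = 0"
    using integral_gradient_zero(2)[OF P z]
    by (subst Bochner_Integration.integral_add[symmetric]) (auto intro!: integrable_area_continuous continuous_intros)
  then show "(LINT x|area. \<psi> x * snd (\<Phi> x)) = - (LINT x|area. \<phi> x * snd (\<Psi> x))" by simp
qed

lemma H1_grad_C1: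
  assumes \<psi>: "C1_grad \<psi> \<Psi>"
  shows "H1_grad \<psi> \<Psi>"
proof -
  note [continuous_intros] = C1_grad_continuous[OF \<psi>]
  have c[continuous_intros]: "continuous_on UNIV \<Psi>"
    using \<psi> by (auto simp: C1_grad_def)
  have "(LINT x|area. \<psi> x *\<^sub>R \<Phi> x) = - (LINT x|area. \<phi> x *\<^sub>R \<Psi> x)" if \<phi>: "test_grad \<phi> \<Phi>" for \<phi> \<Phi>
  proof -
    have \<phi>': "C1_grad \<phi> \<Phi>" using \<phi> by (simp add: test_grad_def)
    note [continuous_intros] = C1_grad_continuous[OF \<phi>']
    have [continuous_intros]: "continuous_on UNIV \<Phi>"
      using \<phi>' by (auto simp: C1_grad_def)
    have "integrable area (\<lambda>x. \<psi> x *\<^sub>R \<Phi> x)" "integrable area (\<lambda>x. \<phi> x *\<^sub>R \<Psi> x)"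
      by (auto intro!: integrable_area_continuous continuous_intros)
    then show ?thesis
      using C1_test_integral[OF \<psi> \<phi>] by (subst (1 2) integral_area_pair) auto
  qed
  then show ?thesis
    unfolding H1_grad_def by (auto intro!: L2_area_continuous continuous_intros)
qed

section \<open>The boundary measure\<close>

lemma finite_measure_side_closed: "finite_measure (restrict_space lborel {- (pi/2)..pi/2})"
  by (rule finite_measureI) (simp add: emeasure_restrict_space space_restrict_space sets_restrict_space_iff)

lemma finite_measure_bool2: "finite_measure (count_space (UNIV :: (bool \<times> bool) set))"
  by (rule finite_measureI) simp

lemma side_measurable:
  "(\<lambda>(i, t). side i t) \<in> measurable (count_space UNIV \<Otimes>\<^sub>M restrict_space lborel {- (pi/2)..pi/2}) borel"
proof -
  have "(\<lambda>z. side (fst z) (snd z)) \<in>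
      measurable (count_space UNIV \<Otimes>\<^sub>M restrict_space lborel {- (pi/2)..pi/2}) borel"
    by (rule measurable_pair_measure_countable1)
       (auto simp: side_def Let_def borel_prod[symmetric] intro!: measurable_restrict_space1)
  then show ?thesis by (simp add: case_prod_beta)
qed

lemma finite_measure_bdry: "finite_measure bdry"
proof -
  interpret A: finite_measure "count_space (UNIV :: (bool \<times> bool) set)" by (rule finite_measure_bool2)
  interpret B: finite_measure "restrict_space lborel {- (pi/2)..pi/2}" by (rule finite_measure_side_closed)
  show ?thesis unfolding bdry_def
    by (intro finite_measure.finite_measure_distr side_measurable finite_measure_pair_measure) unfold_locales
qed

interpretation B: finite_measure bdry
  by (rule finite_measure_bdry)

lemma AE_bdry: "AE x in bdry. x \<in> {- (pi/2)..pi/2} \<times> {- (pi/2)..pi/2}"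
  unfolding bdry_def
  by (subst AE_distr_iff[OF side_measurable])
     (auto simp: space_pair_measure space_restrict_space side_def Let_def intro!: AE_I2
       intro: borel_closed closed_Times)

lemma integrable_bdry_continuous:
  fixes f :: "real \<times> real \<Rightarrow> 'b::euclidean_space"
  assumes "continuous_on UNIV f"
  shows "integrable bdry f"
proof -
  obtain B where "B > 0" "\<And>x. x \<in> {- (pi/2)..pi/2} \<times> {- (pi/2)..pi/2} \<Longrightarrow> norm (f x) \<le> B"
    using closed_square_bound[OF assms] by blast
  with AE_bdry show ?thesis
    by (intro B.integrable_const_bound[of _ B])
       (auto simp: bdry_def intro: borel_measurable_continuous_onI[OF assms] elim!: eventually_mono)
qed

lemma L2_bdry_continuous:
  fixes f :: "real \<times> real \<Rightarrow> 'b::euclidean_space"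
  assumes "continuous_on UNIV f"
  shows "L2 bdry f"
  unfolding L2_def
  by (intro conjI integrable_bdry_continuous continuous_intros assms)
     (simp add: bdry_def borel_measurable_continuous_onI[OF assms])

text \<open>Brings boundary integrals into the shape in which \<open>divergence_C1\<close> delivers
  them. The closed sides used by \<open>bdry\<close> differ from the open ones by end points, which
  are null.\<close>

lemma integral_bdry_continuous:
  fixes f :: "real \<times> real \<Rightarrow> real"
  assumes "continuous_on UNIV f"
  shows "(LINT x|bdry. f x) =
    (LINT y|side_measure. f (pi/2, y)) + (LINT y|side_measure. f (- (pi/2), y)) +
    (LINT x|side_measure. f (x, pi/2)) + (LINT x|side_measure. f (x, - (pi/2)))"
proof -
  let ?C = "restrict_space lborel {- (pi/2)..pi/2} :: real measure"
  interpret A: finite_measure "count_space (UNIV :: (bool \<times> bool) set)" by (rule finite_measure_bool2)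
  interpret C: finite_measure ?C by (rule finite_measure_side_closed)
  interpret AC: pair_sigma_finite "count_space (UNIV :: (bool \<times> bool) set)" ?C ..
  have open_closed: "(LINT x|?C. g x) = (LINT x|side_measure. g x)" if g: "continuous_on UNIV g" for g :: "real \<Rightarrow> real"
  proof -
    have "AE x in lborel. x \<noteq> -(pi/2) \<and> x \<noteq> (pi/2::real)"
      using AE_lborel_singleton[of "-(pi/2)"] AE_lborel_singleton[of "pi/2"] by eventually_elim simp
    then have *: "AE x in lborel. indicator {- (pi/2)..pi/2} x *\<^sub>R g x = indicator {- (pi/2)<..<pi/2} x *\<^sub>R g x"
      by eventually_elim (auto simp: indicator_def)
    show ?thesis
      using * borel_measurable_continuous_onI[OF g]
      by (subst (1 2) integral_restrict_space)
         (auto intro!: integral_cong_AE borel_measurable_scaleR borel_measurable_indicator simp del: real_scaleR_def)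
  qed
  have i: "integrable (count_space UNIV \<Otimes>\<^sub>M ?C) (\<lambda>z. f (side (fst z) (snd z)))"
    using integrable_bdry_continuous[OF assms] unfolding bdry_def
    by (subst (asm) integrable_distr_eq[OF side_measurable])
       (auto simp: case_prod_beta intro: borel_measurable_continuous_onI[OF assms])
  have "(LINT x|bdry. f x) = (LINT z|(count_space UNIV \<Otimes>\<^sub>M ?C). f (side (fst z) (snd z)))"
    unfolding bdry_def
    by (subst integral_distr[OF side_measurable])
       (auto simp: case_prod_beta intro: borel_measurable_continuous_onI[OF assms])
  also have "\<dots> = (LINT i|count_space UNIV. LINT t|?C. f (side i t))"
    using AC.integral_fst'[OF i] by simp
  also have "\<dots> = (\<Sum>i\<in>UNIV. LINT t|?C. f (side i t))"
    by (subst lebesgue_integral_count_space_finite) auto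
  also have "\<dots> = (LINT y|side_measure. f (pi/2, y)) + (LINT y|side_measure. f (- (pi/2), y)) +
    (LINT x|side_measure. f (x, pi/2)) + (LINT x|side_measure. f (x, - (pi/2)))"
  proof -
    have "continuous_on UNIV (\<lambda>t. f (side i t))" for i
    proof (rule continuous_on_compose2[OF assms])
      show "continuous_on UNIV (side i)"
        by (cases "fst i") (auto simp: side_def[abs_def] Let_def intro!: continuous_intros)
    qed simp
    from open_closed[OF this] show ?thesis
      by (simp add: UNIV_bool UNIV_Times_UNIV[symmetric] sum.cartesian_product[symmetric]
        del: UNIV_Times_UNIV) (simp add: side_def)
  qed
  finally show ?thesis .
qed

section \<open>Cutoff functions and the fundamental lemma of the calculus of variations\<close>

lemma DERIV_max_0_square: "((\<lambda>s::real. (max 0 s)\<^sup>2) has_real_derivative 2 * max 0 s) (at s)"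
proof (cases "s = 0")
  case True
  \<comment> \<open>Caratheodory's criterion at the origin: the difference quotient there is
    \<open>max 0\<close> itself, which is continuous.\<close>
  have "continuous_on UNIV (max (0::real))" by (intro continuous_intros)
  then have "isCont (max (0::real)) 0" by (simp add: continuous_on_eq_continuous_at)
  then show ?thesis
    by (subst DERIV_caratheodory_within)
       (auto simp: True power2_eq_square max_def intro!: exI[of _ "max 0"])
next
  case False
  show ?thesis
  proof (cases "s > 0")
    case True
    have "((\<lambda>s::real. s\<^sup>2) has_real_derivative 2 * s) (at s)"
      by (auto intro!: derivative_eq_intros)
    then have "((\<lambda>s::real. (max 0 s)\<^sup>2) has_real_derivative 2 * s) (at s)"
      by (rule has_field_derivative_transform_within_open[of _ _ _ "{0<..}"]) (use True in auto)
    then show ?thesis using True by simp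
  next
    case False
    with \<open>s \<noteq> 0\<close> have "s < 0" by simp
    have "((\<lambda>s::real. 0) has_real_derivative 0) (at s)"
      by (auto intro!: derivative_eq_intros)
    then have "((\<lambda>s::real. (max 0 s)\<^sup>2) has_real_derivative 0) (at s)"
      by (rule has_field_derivative_transform_within_open[of _ _ _ "{..<0}"]) (use \<open>s < 0\<close> in auto)
    then show ?thesis using \<open>s < 0\<close> by simp
  qed
qed

text \<open>These converge pointwise to the indicator function of the interval \<open>{a<..<b}\<close>.\<close>

definition cutoff :: "real \<Rightarrow> real \<Rightarrow> nat \<Rightarrow> real \<Rightarrow> real" where
  "cutoff a b n x = 1 - 1 / (1 + (max 0 (real n * ((x - a) * (b - x)) - 1))\<^sup>2)"

definition cutoff' :: "real \<Rightarrow> real \<Rightarrow> nat \<Rightarrow> real \<Rightarrow> real" where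
  "cutoff' a b n x = 2 * max 0 (real n * ((x - a) * (b - x)) - 1) * (real n * ((b - x) - (x - a)))
     / (1 + (max 0 (real n * ((x - a) * (b - x)) - 1))\<^sup>2)\<^sup>2"

lemma cutoff_deriv: "(cutoff a b n has_real_derivative cutoff' a b n x) (at x)"
proof -
  let ?s = "\<lambda>x. real n * ((x - a) * (b - x)) - 1"
  have s: "(?s has_real_derivative (real n * ((b - x) - (x - a)))) (at x)"
    by (auto intro!: derivative_eq_intros simp: algebra_simps)
  have P: "((\<lambda>x. (max 0 (?s x))\<^sup>2) has_real_derivative 2 * max 0 (?s x) * (real n * ((b - x) - (x - a)))) (at x)"
    by (rule DERIV_chain2[OF DERIV_max_0_square s])
  have nz: "1 + (max 0 (?s x))\<^sup>2 \<noteq> 0" by (metis add_pos_nonneg less_irrefl zero_le_power2 zero_less_one)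
  show ?thesis
    unfolding cutoff_def[abs_def] cutoff'_def
    using DERIV_diff[OF DERIV_const DERIV_divide[OF DERIV_const DERIV_add[OF DERIV_const P] nz], of 1 1]
    by (simp add: power2_eq_square)
qed

lemma cutoff'_continuous: "continuous_on UNIV (cutoff' a b n)"
proof -
  have "1 + (max 0 (real n * ((x - a) * (b - x)) - 1))\<^sup>2 \<noteq> 0" for x
    by (metis add_pos_nonneg less_irrefl zero_le_power2 zero_less_one)
  then show ?thesis
    unfolding cutoff'_def[abs_def] by (intro continuous_intros) auto
qed

lemma cutoff_range: "0 \<le> cutoff a b n x" "cutoff a b n x \<le> 1"
proof -
  have "1 / (1 + (max 0 (real n * ((x - a) * (b - x)) - 1))\<^sup>2) \<le> 1"
    by (subst divide_le_eq_1) (simp add: add_pos_nonneg)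
  moreover have "0 \<le> 1 / (1 + (max 0 (real n * ((x - a) * (b - x)) - 1))\<^sup>2)" by simp
  ultimately show "0 \<le> cutoff a b n x" "cutoff a b n x \<le> 1"
    unfolding cutoff_def by linarith+
qed

lemma cutoff_eq_0: "real n * ((x - a) * (b - x)) < 1 \<Longrightarrow> cutoff a b n x = 0"
  unfolding cutoff_def by simp

lemma cutoff_tendsto:
  assumes "a < b"
  shows "(\<lambda>n. cutoff a b n x) \<longlonglongrightarrow> indicator {a<..<b} x"
proof (cases "x \<in> {a<..<b}")
  case True
  then have "(x - a) * (b - x) > 0" by simp
  then have "filterlim (\<lambda>n. real n * ((x - a) * (b - x)) - 1) at_top sequentially"
    by real_asymp
  then have m: "filterlim (\<lambda>n. max 0 (real n * ((x - a) * (b - x)) - 1)) at_top sequentially"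
    by (rule filterlim_at_top_mono) auto
  have "((\<lambda>s::real. 1 - 1 / (1 + s\<^sup>2)) \<longlongrightarrow> 1) at_top" by real_asymp
  from filterlim_compose[OF this m] show ?thesis using True by (simp add: cutoff_def)
next
  case False
  then have "(x - a) * (b - x) \<le> 0" using assms
    by (auto simp: mult_le_0_iff)
  then have "real n * ((x - a) * (b - x)) < 1" for n
    by (meson le_less_trans mult_nonneg_nonpos of_nat_0_le_iff zero_less_one)
  then show ?thesis using False by (simp add: cutoff_eq_0)
qed

lemma cutoff_test_grad:
  assumes "a < b" "c < d" "{a<..<b} \<times> {c<..<d} \<subseteq> square"
  shows "\<exists>\<Phi>. test_grad (\<lambda>p. cutoff a b n (fst p) * cutoff c d n (snd p)) \<Phi>"
proof -
  \<comment> \<open>The shift by 1 inside \<open>cutoff\<close> keeps its support in this closed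
    subset of the open interval; without it the support would reach the end points.\<close>
  define K where "K = (\<lambda>a b. {x. 1 \<le> real n * ((x - a) * (b - x))})"
  have sub: "K a b \<subseteq> {a<..<b}" if "a < b" for a b
  proof
    fix x assume "x \<in> K a b"
    then have "0 < real n * ((x - a) * (b - x))" by (simp add: K_def)
    then have "0 < (x - a) * (b - x)" by (simp add: zero_less_mult_iff)
    then show "x \<in> {a<..<b}" using that by (auto simp: zero_less_mult_iff)
  qed
  have "compact (K a b)" if "a < b" for a b
  proof -
    have "closed (K a b)" unfolding K_def by (intro closed_Collect_le continuous_intros)
    moreover have "bounded (K a b)" using bounded_subset[OF _ sub[OF that]] by simp
    ultimately show ?thesis by (simp add: compact_eq_bounded_closed)
  qed
  then have "compact (K a b \<times> K c d)" using assms by (intro compact_Times)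
  moreover have "K a b \<times> K c d \<subseteq> square" using sub[OF assms(1)] sub[OF assms(2)] assms(3) by blast
  moreover have "cutoff a b n (fst p) * cutoff c d n (snd p) = 0" if "p \<notin> K a b \<times> K c d" for p
    using that cutoff_eq_0 by (cases p) (force simp: K_def)
  moreover note C1_grad_tensor[OF cutoff_deriv cutoff'_continuous cutoff_deriv cutoff'_continuous,
      of a b n c d n]
  ultimately show ?thesis unfolding test_grad_def by blast
qed

lemma L2_integrable:
  assumes "finite_measure M" "L2 M f"
  shows "integrable M f"
proof -
  interpret finite_measure M by fact
  have *: "norm (f x) \<le> 1 + (norm (f x))\<^sup>2" for x
    using sum_squares_bound[of 1 "norm (f x)"] norm_ge_zero[of "f x"]
    by (simp only: one_power2 mult_1_right)
  have "integrable M (\<lambda>x. 1 + (norm (f x))\<^sup>2)" "f \<in> borel_measurable M"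
    using assms(2) by (simp_all add: L2_def)
  then show ?thesis
    by (rule Bochner_Integration.integrable_bound) (intro AE_I2, rule order_trans[OF *], simp)
qed

lemma L2_diff:
  assumes "L2 M f" "L2 M g"
  shows "L2 M (\<lambda>x. f x - g x)"
proof -
  have *: "(norm (f x - g x))\<^sup>2 \<le> 2 * (norm (f x))\<^sup>2 + 2 * (norm (g x))\<^sup>2" for x
  proof -
    have "(norm (f x - g x))\<^sup>2 \<le> (norm (f x) + norm (g x))\<^sup>2"
      by (intro power_mono norm_triangle_ineq4) simp
    also have "\<dots> \<le> 2 * (norm (f x))\<^sup>2 + 2 * (norm (g x))\<^sup>2"
      using sum_squares_bound[of "norm (f x)" "norm (g x)"] by (simp add: power2_sum)
    finally show ?thesis .
  qed
  have meas: "f \<in> borel_measurable M" "g \<in> borel_measurable M"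
    using assms by (auto simp: L2_def)
  have "integrable M (\<lambda>x. 2 * (norm (f x))\<^sup>2 + 2 * (norm (g x))\<^sup>2)"
    using assms by (auto simp: L2_def)
  then have "integrable M (\<lambda>x. (norm (f x - g x))\<^sup>2)"
    by (rule Bochner_Integration.integrable_bound) (use meas * in \<open>auto intro!: AE_I2\<close>)
  with meas show ?thesis by (auto simp: L2_def)
qed

lemma box_Pair_eq:
  fixes a b c d :: real
  shows "box (a, c) (b, d) = {a<..<b} \<times> {c<..<d}"
  by (auto simp: mem_box Basis_prod_def)

text \<open>Products of two cutoffs are test functions and converge boundedly to indicators of
  rectangles. By dominated convergence \<open>d\<close> has integral zero over every rectangle in
  the square, hence over every box.\<close>

lemma integral_area_0_imp_AE_0:
  fixes d :: "real \<times> real \<Rightarrow> real"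
  assumes d: "integrable area d"
    and test: "\<And>\<phi> \<Phi>. test_grad \<phi> \<Phi> \<Longrightarrow> (LINT x|area. \<phi> x * d x) = 0"
  shows "AE x in area. d x = 0"
proof -
  define D where "D = (\<lambda>x. indicator square x * d x)"
  have D: "integrable lborel D"
    using d by (subst (asm) integrable_restrict_space) (auto simp: D_def)
  have "AE x in lborel. D x = 0"
  proof (rule set_integral_zero_of_boxes[OF D, of "(-(pi/2), -(pi/2))" "(pi/2, pi/2)"])
    show "D x = 0" if "x \<notin> box (-(pi/2), -(pi/2)) (pi/2, pi/2)" for x
      using that by (cases x) (auto simp: D_def box_Pair_eq square_def indicator_def)
    fix p q :: "real \<times> real"
    define a b c e where "a = max (fst p) (-(pi/2))" "b = min (fst q) (pi/2)"
      "c = max (snd p) (-(pi/2))" "e = min (snd q) (pi/2)"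
    define R where "R = {a<..<b} \<times> {c<..<e}"
    have R: "box p q \<inter> square = R"
      by (cases p; cases q) (auto simp: box_Pair_eq square_def R_def a_b_c_e_def)
    then have Rs: "R \<subseteq> square" by blast
    have "set_lebesgue_integral lborel (box p q) D = (LINT x|area. indicator R x * d x)"
      unfolding set_lebesgue_integral_def
      by (subst integral_restrict_space)
         (auto simp: D_def R[symmetric] indicator_def intro!: Bochner_Integration.integral_cong)
    also have "\<dots> = 0"
    proof (cases "a < b \<and> c < e")
      case False
      then have "R = {}" by (auto simp: R_def)
      then show ?thesis by simp
    next
      case True
      define \<phi> where "\<phi> = (\<lambda>n p. cutoff a b n (fst p) * cutoff c e n (snd p))"
      have meas: "cutoff a b n \<in> borel_measurable borel" for a b n
        by (rule borel_measurable_continuous_onI)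
           (meson DERIV_continuous cutoff_deriv continuous_at_imp_continuous_on)
      have "(\<lambda>n. LINT x|area. \<phi> n x * d x) \<longlonglongrightarrow> (LINT x|area. indicator R x * d x)"
      proof (rule integral_dominated_convergence[where w = "\<lambda>x. norm (d x)"])
        show "(\<lambda>x. indicator R x * d x) \<in> borel_measurable area"
        proof -
          have "R \<in> sets borel" unfolding R_def by (rule borel_open) (auto intro: open_Times)
          then show ?thesis
            using d Rs by (intro borel_measurable_times borel_measurable_indicator)
             (auto simp: sets_restrict_space_iff)
        qed
        show "(\<lambda>x. \<phi> n x * d x) \<in> borel_measurable area" for n
        proof -
          have "(\<lambda>p. cutoff a b n (fst p) * cutoff c e n (snd p)) \<in> borel_measurable (borel \<Otimes>\<^sub>M borel)"
            by (intro borel_measurable_times measurable_compose[OF measurable_fst meas]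
                measurable_compose[OF measurable_snd meas])
          then have "\<phi> n \<in> borel_measurable borel" unfolding \<phi>_def by (simp add: borel_prod)
          then have "\<phi> n \<in> borel_measurable area" by (intro measurable_restrict_space1) simp
          then show ?thesis using d by (intro borel_measurable_times) auto
        qed
        show "integrable area (\<lambda>x. norm (d x))" using d by simp
        show "AE x in area. (\<lambda>n. \<phi> n x * d x) \<longlonglongrightarrow> indicator R x * d x"
        proof (rule AE_I2)
          fix x
          have "(\<lambda>n. \<phi> n x) \<longlonglongrightarrow> indicator {a<..<b} (fst x) * indicator {c<..<e} (snd x)"
            unfolding \<phi>_def by (intro tendsto_mult cutoff_tendsto) (use True in auto)
          moreover have "indicator {a<..<b} (fst x) * indicator {c<..<e} (snd x) = (indicator R x :: real)"
            by (cases x) (auto simp: R_def indicator_def)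
          ultimately show "(\<lambda>n. \<phi> n x * d x) \<longlonglongrightarrow> indicator R x * d x"
            by (intro tendsto_mult tendsto_const) simp
        qed
        show "AE x in area. norm (\<phi> n x * d x) \<le> norm (d x)" for n
        proof (rule AE_I2)
          fix x
          have "\<bar>\<phi> n x\<bar> \<le> 1" unfolding \<phi>_def
            by (simp add: abs_mult cutoff_range mult_le_one)
          then show "norm (\<phi> n x * d x) \<le> norm (d x)" by (simp add: abs_mult mult_left_le_one_le)
        qed
      qed
      moreover have "(LINT x|area. \<phi> n x * d x) = 0" for n
        using cutoff_test_grad[of a b c e n] True Rs test unfolding R_def \<phi>_def by blast
      ultimately show ?thesis by (simp add: LIMSEQ_const_iff)
    qed
    finally show "set_lebesgue_integral lborel (box p q) D = 0" .
  qed
  then show ?thesis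
    by (subst AE_restrict_space_iff) (auto simp: D_def elim!: eventually_mono)
qed

section \<open>Uniqueness of weak gradients and Laplacians\<close>

lemma integrable_test_scale:
  assumes "test_grad \<phi> \<Phi>" "integrable area G"
  shows "integrable area (\<lambda>x. \<phi> x *\<^sub>R (G x :: 'b::euclidean_space))"
proof -
  have c: "continuous_on UNIV \<phi>" using assms(1) C1_grad_continuous unfolding test_grad_def by blast
  obtain B where B: "B > 0" "\<And>x. x \<in> {- (pi/2)..pi/2} \<times> {- (pi/2)..pi/2} \<Longrightarrow> norm (\<phi> x) \<le> B"
    using closed_square_bound[OF c] by blast
  have *: "AE x in area. norm (\<phi> x *\<^sub>R G x) \<le> norm (B *\<^sub>R norm (G x))"
    by (rule AE_I2) (use B in \<open>auto simp: space_restrict_space square_def intro!: mult_right_mono\<close>)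
  have m: "(\<lambda>x. \<phi> x *\<^sub>R G x) \<in> borel_measurable area"
    by (intro borel_measurable_scaleR measurable_area_continuous[OF c] borel_measurable_integrable assms(2))
  have "integrable area (\<lambda>x. B *\<^sub>R norm (G x))"
    by (intro integrable_scaleR_right integrable_norm assms(2))
  from Bochner_Integration.integrable_bound[OF this m *] show ?thesis .
qed

lemma H1_gradD:
  assumes "H1_grad u G"
  shows "L2 area u" "L2 area G" "integrable area u" "integrable area G"
    and "test_grad \<phi> \<Phi> \<Longrightarrow> (LINT x|area. u x *\<^sub>R \<Phi> x) = - (LINT x|area. \<phi> x *\<^sub>R G x)"
proof -
  show *: "L2 area u" "L2 area G" using assms unfolding H1_grad_def by auto
  show "integrable area u" "integrable area G" by (rule L2_integrable[OF finite_measure_area], rule *)+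
  show "test_grad \<phi> \<Phi> \<Longrightarrow> (LINT x|area. u x *\<^sub>R \<Phi> x) = - (LINT x|area. \<phi> x *\<^sub>R G x)"
    using assms unfolding H1_grad_def by auto
qed

text \<open>\<open>has_trace\<close>, \<open>has_laplacian\<close> and
  \<open>has_normal_derivative\<close> each assert the existence of a weak gradient of their own;
  this identifies them.\<close>

lemma weak_gradient_unique:
  assumes "H1_grad u G" "H1_grad u G'"
  shows "AE x in area. G x = G' x"
proof -
  have i: "integrable area G" "integrable area G'"
    by (rule H1_gradD[OF assms(1)] H1_gradD[OF assms(2)])+
  have "(LINT x|area. \<phi> x *\<^sub>R (G x - G' x)) = 0" if "test_grad \<phi> \<Phi>" for \<phi> \<Phi>
  proof -
    have "(LINT x|area. \<phi> x *\<^sub>R G x) = (LINT x|area. \<phi> x *\<^sub>R G' x)"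
      using H1_gradD(5)[OF assms(1) that] H1_gradD(5)[OF assms(2) that] by simp
    then show ?thesis
      by (simp add: scaleR_diff_right Bochner_Integration.integral_diff integrable_test_scale[OF that] i)
  qed
  note * = this integrable_test_scale[OF _ Bochner_Integration.integrable_diff[OF i]]
  have "AE x in area. fst (G x - G' x) = 0"
  proof (rule integral_area_0_imp_AE_0)
    show "integrable area (\<lambda>x. fst (G x - G' x))"
      using i by (intro integrable_bounded_linear[OF bounded_linear_fst]) auto
    show "(LINT x|area. \<phi> x * fst (G x - G' x)) = 0" if "test_grad \<phi> \<Phi>" for \<phi> \<Phi>
      using integral_bounded_linear[OF bounded_linear_fst *(2)[OF that]] *(1)[OF that] by simp
  qed
  moreover have "AE x in area. snd (G x - G' x) = 0"
  proof (rule integral_area_0_imp_AE_0)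
    show "integrable area (\<lambda>x. snd (G x - G' x))"
      using i by (intro integrable_bounded_linear[OF bounded_linear_snd]) auto
    show "(LINT x|area. \<phi> x * snd (G x - G' x)) = 0" if "test_grad \<phi> \<Phi>" for \<phi> \<Phi>
      using integral_bounded_linear[OF bounded_linear_snd *(2)[OF that]] *(1)[OF that] by simp
  qed
  ultimately show ?thesis by eventually_elim (simp add: prod_eq_iff)
qed

lemma laplacian_unique:
  assumes "has_laplacian u f" "has_laplacian u f'"
  shows "AE x in area. f x = f' x"
proof -
  obtain G where G: "H1_grad u G"
    "\<And>\<phi> \<Phi>. test_grad \<phi> \<Phi> \<Longrightarrow> (LINT x|area. G x \<bullet> \<Phi> x) = - (LINT x|area. f x * \<phi> x)"
    using assms(1) unfolding has_laplacian_def by blast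
  obtain G' where G': "H1_grad u G'"
    "\<And>\<phi> \<Phi>. test_grad \<phi> \<Phi> \<Longrightarrow> (LINT x|area. G' x \<bullet> \<Phi> x) = - (LINT x|area. f' x * \<phi> x)"
    using assms(2) unfolding has_laplacian_def by blast
  have i: "integrable area f" "integrable area f'"
    using assms by (auto intro!: L2_integrable[OF finite_measure_area] simp: has_laplacian_def)
  have "AE x in area. f x - f' x = 0"
  proof (rule integral_area_0_imp_AE_0)
    fix \<phi> \<Phi> assume t: "test_grad \<phi> \<Phi>"
    have c: "continuous_on UNIV \<Phi>" using t C1_gradD(2) unfolding test_grad_def by blast
    have "(LINT x|area. G x \<bullet> \<Phi> x) = (LINT x|area. G' x \<bullet> \<Phi> x)"
      using weak_gradient_unique[OF G(1) G'(1)] H1_gradD(2)[OF G(1)] H1_gradD(2)[OF G'(1)] unfolding L2_def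
      by (intro integral_cong_AE borel_measurable_inner measurable_area_continuous[OF c]) auto
    then have "(LINT x|area. f x * \<phi> x) = (LINT x|area. f' x * \<phi> x)"
      using G(2)[OF t] G'(2)[OF t] by simp
    then show "(LINT x|area. \<phi> x * (f x - f' x)) = 0"
      using integrable_test_scale[OF t i(1)] integrable_test_scale[OF t i(2)]
      by (simp add: right_diff_distrib Bochner_Integration.integral_diff mult.commute)
  qed (use i in auto)
  then show ?thesis by simp
qed

text \<open>A crude Cauchy-Schwarz inequality: the integrand is at most
  \<open>e + C\<^sup>2 / e * (norm (d x))\<^sup>2\<close> for every \<open>e > 0\<close>, and
  \<open>e\<close> is taken as the norm of \<open>d\<close>, or arbitrarily small if that norm is
  zero. What matters later is that the bound tends to zero with the norm of
  \<open>d\<close>.\<close>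

lemma (in finite_measure) inner_integral_bound:
  fixes b d :: "'a \<Rightarrow> 'b::euclidean_space"
  assumes b: "b \<in> borel_measurable M" "AE x in M. norm (b x) \<le> C" and d: "L2 M d"
  shows "integrable M (\<lambda>x. b x \<bullet> d x)"
    and "\<bar>LINT x|M. b x \<bullet> d x\<bar> \<le> sqrt (LINT x|M. (norm (d x))\<^sup>2) * (measure M (space M) + C\<^sup>2)"
proof -
  define I where "I = (LINT x|M. (norm (d x))\<^sup>2)"
  have I: "I \<ge> 0" unfolding I_def by simp
  have dm: "d \<in> borel_measurable M" "integrable M (\<lambda>x. (norm (d x))\<^sup>2)" using d by (auto simp: L2_def)
  have bd: "AE x in M. norm (b x \<bullet> d x) \<le> e + C\<^sup>2 / e * (norm (d x))\<^sup>2" if "e > 0" for e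
    using b(2)
  proof eventually_elim
    case (elim x)
    have "norm (b x \<bullet> d x) \<le> C * norm (d x)"
      using Cauchy_Schwarz_ineq2[of "b x" "d x"] elim
      by (smt (verit) mult_right_mono norm_ge_zero real_norm_def)
    also have "\<dots> \<le> e + C\<^sup>2 / e * (norm (d x))\<^sup>2"
    proof -
      have "2 * e * (C * norm (d x)) \<le> e\<^sup>2 + (C * norm (d x))\<^sup>2"
        using sum_squares_bound[of e "C * norm (d x)"] by simp
      moreover have "0 \<le> e\<^sup>2 + (C * norm (d x))\<^sup>2" by simp
      ultimately have "e * (C * norm (d x)) \<le> e\<^sup>2 + (C * norm (d x))\<^sup>2" by linarith
      then have "C * norm (d x) \<le> (e\<^sup>2 + (C * norm (d x))\<^sup>2) / e"
        using that by (simp add: pos_le_divide_eq mult.commute)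
      then show ?thesis using that by (simp add: add_divide_distrib power2_eq_square mult_ac)
    qed
    finally show ?case .
  qed
  have int: "integrable M (\<lambda>x. e + C\<^sup>2 / e * (norm (d x))\<^sup>2)" for e using dm by simp
  show i: "integrable M (\<lambda>x. b x \<bullet> d x)"
    by (rule Bochner_Integration.integrable_bound[OF int[of 1]])
       (use bd[of 1] b dm in \<open>auto elim!: eventually_mono\<close>)
  have B: "\<bar>LINT x|M. b x \<bullet> d x\<bar> \<le> e * measure M (space M) + C\<^sup>2 / e * I" if "e > 0" for e
  proof -
    have "\<bar>LINT x|M. b x \<bullet> d x\<bar> \<le> (LINT x|M. norm (b x \<bullet> d x))"
      using integral_norm_bound[of M "\<lambda>x. b x \<bullet> d x"] by simp
    also have "\<dots> \<le> (LINT x|M. e + C\<^sup>2 / e * (norm (d x))\<^sup>2)"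
      by (intro integral_mono_AE int bd that integrable_norm i)
    also have "\<dots> = e * measure M (space M) + C\<^sup>2 / e * I"
      using dm by (simp add: I_def mult.commute)
    finally show ?thesis .
  qed
  show "\<bar>LINT x|M. b x \<bullet> d x\<bar> \<le> sqrt (LINT x|M. (norm (d x))\<^sup>2) * (measure M (space M) + C\<^sup>2)"
  proof (cases "I = 0")
    case False
    then have "sqrt I > 0" using I by simp
    have "I / sqrt I = sqrt I" using real_div_sqrt[OF I] .
    have "C\<^sup>2 / sqrt I * I = sqrt I * C\<^sup>2"
      using \<open>I / sqrt I = sqrt I\<close> by (metis mult.commute times_divide_eq_left times_divide_eq_right)
    with B[OF \<open>sqrt I > 0\<close>] show ?thesis unfolding I_def[symmetric]
      by (simp only: distrib_left)
  next
    case True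
    have "\<bar>LINT x|M. b x \<bullet> d x\<bar> \<le> 0 + e" if "e > 0" for e
    proof -
      have "\<bar>LINT x|M. b x \<bullet> d x\<bar> \<le> e / (measure M (space M) + 1) * measure M (space M)"
        using B[of "e / (measure M (space M) + 1)"] True that by (simp add: add_nonneg_pos)
      also have "\<dots> = e * (measure M (space M) / (measure M (space M) + 1))" by simp
      also have "\<dots> \<le> e" using that by (intro mult_left_le) (auto simp: divide_le_eq_1 add_nonneg_pos)
      finally show ?thesis by simp
    qed
    then have "\<bar>LINT x|M. b x \<bullet> d x\<bar> \<le> 0" by (rule field_le_epsilon)
    then show ?thesis unfolding I_def[symmetric] using True by simp
  qed
qed

lemma (in finite_measure) inner_integral_tendsto:
  fixes b d :: "'a \<Rightarrow> 'b::euclidean_space"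
  assumes b: "b \<in> borel_measurable M" "AE x in M. norm (b x) \<le> C"
    and d: "L2 M d" "\<And>n. L2 M (e n)"
    and lim: "(\<lambda>n. LINT x|M. (norm (e n x - d x))\<^sup>2) \<longlonglongrightarrow> 0"
  shows "(\<lambda>n. LINT x|M. b x \<bullet> e n x) \<longlonglongrightarrow> (LINT x|M. b x \<bullet> d x)"
proof -
  have "(\<lambda>n. LINT x|M. b x \<bullet> (e n x - d x)) \<longlonglongrightarrow> 0"
  proof (rule Lim_null_comparison)
    show "\<forall>\<^sub>F n in sequentially. norm (LINT x|M. b x \<bullet> (e n x - d x)) \<le>
        sqrt (LINT x|M. (norm (e n x - d x))\<^sup>2) * (measure M (space M) + C\<^sup>2)"
      using inner_integral_bound(2)[OF b L2_diff[OF d(2) d(1)]] by simp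
    have "(\<lambda>n. sqrt (LINT x|M. (norm (e n x - d x))\<^sup>2) * (measure M (space M) + C\<^sup>2)) \<longlonglongrightarrow>
        sqrt 0 * (measure M (space M) + C\<^sup>2)"
      by (intro tendsto_intros lim)
    then show "(\<lambda>n. sqrt (LINT x|M. (norm (e n x - d x))\<^sup>2) * (measure M (space M) + C\<^sup>2)) \<longlonglongrightarrow> 0"
      by simp
  qed
  moreover have "(LINT x|M. b x \<bullet> (e n x - d x)) = (LINT x|M. b x \<bullet> e n x) - (LINT x|M. b x \<bullet> d x)" for n
    using inner_integral_bound(1)[OF b d(1)] inner_integral_bound(1)[OF b d(2)]
    by (simp add: inner_diff_right Bochner_Integration.integral_diff)
  ultimately show ?thesis by (simp add: LIM_zero_iff)
qed

section \<open>Green's formula for products of modes\<close>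

text \<open>The outward derivative is \<open>X'\<close> at the right end and \<open>- X'\<close> at
  the left end, whence the opposite signs; the Robin parameter is \<open>- t\<close>.\<close>

definition robin_mode :: "real \<Rightarrow> real \<Rightarrow> (real \<Rightarrow> real) \<Rightarrow> (real \<Rightarrow> real) \<Rightarrow> bool" where
  "robin_mode t \<mu> X X' \<longleftrightarrow>
     (\<forall>x. (X has_real_derivative X' x) (at x)) \<and> (\<forall>x. (X' has_real_derivative - \<mu> * X x) (at x)) \<and>
     X' (pi/2) = t * X (pi/2) \<and> X' (- (pi/2)) = - t * X (- (pi/2))"

lemma robin_modeD:
  assumes "robin_mode t \<mu> X X'"
  shows "(X has_real_derivative X' x) (at x)" "(X' has_real_derivative - \<mu> * X x) (at x)"
    "X' (pi/2) = t * X (pi/2)" "X' (- (pi/2)) = - t * X (- (pi/2))"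
    "continuous_on UNIV X" "continuous_on UNIV X'"
proof -
  have *: "(X has_real_derivative X' x) (at x)" "(X' has_real_derivative - \<mu> * X x) (at x)" for x
    using assms unfolding robin_mode_def by blast+
  show "(X has_real_derivative X' x) (at x)" "(X' has_real_derivative - \<mu> * X x) (at x)"
    by (rule *)+
  show "X' (pi/2) = t * X (pi/2)" "X' (- (pi/2)) = - t * X (- (pi/2))"
    using assms unfolding robin_mode_def by blast+
  show "continuous_on UNIV X" "continuous_on UNIV X'"
    using DERIV_continuous[OF *(1)] DERIV_continuous[OF *(2)] by (simp_all add: continuous_at_imp_continuous_on)
qed

definition tensor :: "(real \<Rightarrow> real) \<Rightarrow> (real \<Rightarrow> real) \<Rightarrow> real \<times> real \<Rightarrow> real" where
  "tensor X Y p = X (fst p) * Y (snd p)"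

lemma continuous_on_tensor [continuous_intros]:
  assumes "continuous_on UNIV X" "continuous_on UNIV Y"
  shows "continuous_on A (tensor X Y)"
  unfolding tensor_def[abs_def]
  by (intro continuous_on_mult continuous_on_compose2[OF assms(1)] continuous_on_compose2[OF assms(2)])
     (auto intro!: continuous_intros)

context
  fixes t \<mu> \<nu> X X' Y Y'
  assumes X: "robin_mode t \<mu> X X'" and Y: "robin_mode t \<nu> Y Y'"
begin

private abbreviation "E \<equiv> tensor X Y"
private abbreviation "grad \<equiv> (\<lambda>p. (tensor X' Y p, tensor X Y' p))"

lemma C1_grad_mode: "C1_grad E grad"
  unfolding tensor_def[abs_def]
  by (rule C1_grad_tensor[OF robin_modeD(1,6)[OF X] robin_modeD(1,6)[OF Y]])

private lemma C1_grad_mode_x: "C1_grad (tensor X' Y) (\<lambda>p. (- \<mu> * X (fst p) * Y (snd p), X' (fst p) * Y' (snd p)))"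
  unfolding tensor_def[abs_def]
  by (rule C1_grad_tensor[OF robin_modeD(2)[OF X] _ robin_modeD(1,6)[OF Y]])
     (intro continuous_intros robin_modeD(5)[OF X])

private lemma C1_grad_mode_y: "C1_grad (tensor X Y') (\<lambda>p. (X' (fst p) * Y' (snd p), X (fst p) * (- \<nu> * Y (snd p))))"
  unfolding tensor_def[abs_def]
  by (rule C1_grad_tensor[OF robin_modeD(1,6)[OF X] robin_modeD(2)[OF Y]])
     (intro continuous_intros robin_modeD(5)[OF Y])

private lemma cont: "continuous_on A E" "continuous_on A (tensor X' Y)" "continuous_on A (tensor X Y')"
    "continuous_on A grad"
  by (rule continuous_on_tensor continuous_on_Pair robin_modeD(5,6)[OF X] robin_modeD(5,6)[OF Y])+

text \<open>The divergence theorem for \<open>\<phi>\<close> times each partial derivative of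
  \<open>E\<close>: the differential equations of the two modes produce the factor
  \<open>\<mu> + \<nu>\<close>, and the end conditions turn normal derivatives into \<open>t\<close>
  times \<open>E\<close>.\<close>

lemma Green_mode_C1:
  assumes \<phi>: "C1_grad \<phi> \<Phi>"
  shows "(LINT x|area. grad x \<bullet> \<Phi> x) - (\<mu> + \<nu>) * (LINT x|area. E x * \<phi> x) = t * (LINT x|bdry. E x * \<phi> x)"
proof -
  note c = C1_grad_continuous[OF \<phi>] C1_gradD(2)[OF \<phi>]
  have i: "integrable area (\<lambda>x. tensor X' Y x * fst (\<Phi> x))"
     "integrable area (\<lambda>x. tensor X Y' x * snd (\<Phi> x))" "integrable area (\<lambda>x. E x * \<phi> x)"
    by (intro integrable_area_continuous continuous_on_mult cont c continuous_on_fst continuous_on_snd)+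
  have slice: "continuous_on A (\<lambda>y. f (a, y))" "continuous_on A (\<lambda>x. f (x, a))"
    if "continuous_on UNIV f" for f :: "real \<times> real \<Rightarrow> real" and A a
    by (rule continuous_on_compose2[OF that]; auto intro!: continuous_intros)+
  have s: "integrable side_measure (\<lambda>y. E (a, y) * \<phi> (a, y))"
     "integrable side_measure (\<lambda>x. E (x, a) * \<phi> (x, a))" for a
    by (rule integrable_side_continuous, rule continuous_on_mult, rule slice, rule cont, rule slice, rule c)+
  have "(LINT x|area. tensor X' Y x * fst (\<Phi> x)) - \<mu> * (LINT x|area. E x * \<phi> x) =
      (LINT x|area. fst (tensor X' Y x *\<^sub>R \<Phi> x + \<phi> x *\<^sub>R (- \<mu> * X (fst x) * Y (snd x), X' (fst x) * Y' (snd x))))"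
  proof -
    have "fst (tensor X' Y x *\<^sub>R \<Phi> x + \<phi> x *\<^sub>R (- \<mu> * X (fst x) * Y (snd x), X' (fst x) * Y' (snd x))) = tensor X' Y x * fst (\<Phi> x) - \<mu> * (E x * \<phi> x)" for x
      by (simp add: tensor_def)
    then show ?thesis using i by (simp only: Bochner_Integration.integral_diff integrable_mult_right integral_mult_right_zero)
  qed
  also have "\<dots> = (LINT y|side_measure. t * (E (pi/2, y) * \<phi> (pi/2, y)) + t * (E (- (pi/2), y) * \<phi> (- (pi/2), y)))"
    by (subst divergence_C1(1)[OF C1_grad_mult[OF C1_grad_mode_x \<phi>]])
       (simp add: tensor_def robin_modeD[OF X] mult_ac)
  also have "\<dots> = t * ((LINT y|side_measure. E (pi/2, y) * \<phi> (pi/2, y)) + (LINT y|side_measure. E (- (pi/2), y) * \<phi> (- (pi/2), y)))"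
    using s by (simp add: distrib_left)
  finally have 1: "(LINT x|area. tensor X' Y x * fst (\<Phi> x)) - \<mu> * (LINT x|area. E x * \<phi> x) = \<dots>" .
  have "(LINT x|area. tensor X Y' x * snd (\<Phi> x)) - \<nu> * (LINT x|area. E x * \<phi> x) =
      (LINT x|area. snd (tensor X Y' x *\<^sub>R \<Phi> x + \<phi> x *\<^sub>R (X' (fst x) * Y' (snd x), X (fst x) * (- \<nu> * Y (snd x)))))"
  proof -
    have "snd (tensor X Y' x *\<^sub>R \<Phi> x + \<phi> x *\<^sub>R (X' (fst x) * Y' (snd x), X (fst x) * (- \<nu> * Y (snd x)))) = tensor X Y' x * snd (\<Phi> x) - \<nu> * (E x * \<phi> x)" for x
      by (simp add: tensor_def)
    then show ?thesis using i by (simp only: Bochner_Integration.integral_diff integrable_mult_right integral_mult_right_zero)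
  qed
  also have "\<dots> = (LINT x|side_measure. t * (E (x, pi/2) * \<phi> (x, pi/2)) + t * (E (x, - (pi/2)) * \<phi> (x, - (pi/2))))"
    by (subst divergence_C1(2)[OF C1_grad_mult[OF C1_grad_mode_y \<phi>]])
       (simp add: tensor_def robin_modeD[OF Y] mult_ac)
  also have "\<dots> = t * ((LINT x|side_measure. E (x, pi/2) * \<phi> (x, pi/2)) + (LINT x|side_measure. E (x, - (pi/2)) * \<phi> (x, - (pi/2))))"
    using s by (simp add: distrib_left)
  finally have 2: "(LINT x|area. tensor X Y' x * snd (\<Phi> x)) - \<nu> * (LINT x|area. E x * \<phi> x) = \<dots>" .
  have "(LINT x|area. grad x \<bullet> \<Phi> x) = (LINT x|area. tensor X' Y x * fst (\<Phi> x)) + (LINT x|area. tensor X Y' x * snd (\<Phi> x))"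
    using i by (simp add: inner_prod_def)
  with 1 2 show ?thesis
    by (subst integral_bdry_continuous[OF continuous_on_mult[OF cont(1) c(1)]]) (simp add: algebra_simps)
qed

text \<open>Extension by density: \<open>has_trace\<close> provides C1 functions that converge in
  the square, with their gradients, and on the boundary. The three integrals pass to the limit
  because \<open>E\<close> and its gradient are bounded.\<close>

lemma Green_mode_H1:
  assumes v: "H1_grad v V" and w: "has_trace v w"
  shows "(LINT x|area. grad x \<bullet> V x) - (\<mu> + \<nu>) * (LINT x|area. E x * v x) = t * (LINT x|bdry. E x * w x)"
proof -
  obtain G \<phi> \<Phi> where L2w: "L2 bdry w" and G: "H1_grad v G" and C1: "\<And>n::nat. C1_grad (\<phi> n) (\<Phi> n)"
    and lim: "(\<lambda>n. LINT x|area. (\<phi> n x - v x)\<^sup>2) \<longlonglongrightarrow> 0"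
       "(\<lambda>n. LINT x|area. (norm (\<Phi> n x - G x))\<^sup>2) \<longlonglongrightarrow> 0"
       "(\<lambda>n. LINT x|bdry. (\<phi> n x - w x)\<^sup>2) \<longlonglongrightarrow> 0"
    using w unfolding has_trace_def by blast
  have L2\<phi>: "L2 area (\<phi> n)" "L2 area (\<Phi> n)" "L2 bdry (\<phi> n)" for n
    by (intro L2_area_continuous L2_bdry_continuous C1_grad_continuous[OF C1] C1_gradD(2)[OF C1])+
  have bound: "\<exists>C. AE x in area. norm (f x) \<le> C" "\<exists>C. AE x in bdry. norm (f x) \<le> C"
    if f: "continuous_on UNIV f" for f :: "real \<times> real \<Rightarrow> 'b::real_normed_vector"
  proof -
    obtain B where B: "B > 0" "\<And>x. x \<in> {- (pi/2)..pi/2} \<times> {- (pi/2)..pi/2} \<Longrightarrow> norm (f x) \<le> B"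
      using closed_square_bound[OF f] by blast
    then show "\<exists>C. AE x in area. norm (f x) \<le> C"
      by (intro exI[of _ B] AE_I2) (auto simp: space_restrict_space square_def)
    from AE_bdry B show "\<exists>C. AE x in bdry. norm (f x) \<le> C"
      by (intro exI[of _ B]) (auto elim!: eventually_mono)
  qed
  obtain C1 where C1': "AE x in area. norm (grad x) \<le> C1" using bound(1)[OF cont(4)] by blast
  obtain C2 where C2: "AE x in area. norm (E x) \<le> C2" using bound(1)[OF cont(1)] by blast
  obtain C3 where C3: "AE x in bdry. norm (E x) \<le> C3" using bound(2)[OF cont(1)] by blast
  have 1: "(\<lambda>n. LINT x|area. grad x \<bullet> \<Phi> n x) \<longlonglongrightarrow> (LINT x|area. grad x \<bullet> G x)"
    by (rule Q.inner_integral_tendsto[OF measurable_area_continuous[OF cont(4)] C1' H1_gradD(2)[OF G] L2\<phi>(2) lim(2)])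
  have 2: "(\<lambda>n. LINT x|area. E x * \<phi> n x) \<longlonglongrightarrow> (LINT x|area. E x * v x)"
    using Q.inner_integral_tendsto[OF measurable_area_continuous[OF cont(1)] C2 H1_gradD(1)[OF G] L2\<phi>(1)]
      lim(1) by simp
  have mE: "E \<in> borel_measurable bdry"
    using L2_bdry_continuous[OF cont(1)] by (simp add: L2_def)
  have 3: "(\<lambda>n. LINT x|bdry. E x * \<phi> n x) \<longlonglongrightarrow> (LINT x|bdry. E x * w x)"
    using B.inner_integral_tendsto[OF mE C3 L2w L2\<phi>(3)] lim(3) by simp
  have "(\<lambda>n. (LINT x|area. grad x \<bullet> \<Phi> n x) - (\<mu> + \<nu>) * (LINT x|area. E x * \<phi> n x)) \<longlonglongrightarrow>
     (LINT x|area. grad x \<bullet> G x) - (\<mu> + \<nu>) * (LINT x|area. E x * v x)"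
    by (intro tendsto_intros 1 2)
  moreover have "(\<lambda>n. (LINT x|area. grad x \<bullet> \<Phi> n x) - (\<mu> + \<nu>) * (LINT x|area. E x * \<phi> n x)) \<longlonglongrightarrow>
     t * (LINT x|bdry. E x * w x)"
    unfolding Green_mode_C1[OF C1] by (intro tendsto_intros 3)
  ultimately have "(LINT x|area. grad x \<bullet> G x) - (\<mu> + \<nu>) * (LINT x|area. E x * v x) = t * (LINT x|bdry. E x * w x)"
    by (rule LIMSEQ_unique)
  \<comment> \<open>The limit was computed with the weak gradient \<open>G\<close> that comes with
    the trace; it equals the given \<open>V\<close> almost everywhere.\<close>
  moreover have "(LINT x|area. grad x \<bullet> G x) = (LINT x|area. grad x \<bullet> V x)"
    using weak_gradient_unique[OF G v] H1_gradD(2)[OF G] H1_gradD(2)[OF v] unfolding L2_def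
    by (intro integral_cong_AE borel_measurable_inner measurable_area_continuous[OF cont(4)])
       (auto elim!: eventually_mono)
  ultimately show ?thesis by simp
qed

lemma has_laplacian_mode: "has_laplacian E (\<lambda>x. - (\<mu> + \<nu>) * E x)"
  unfolding has_laplacian_def
proof (intro conjI exI allI impI)
  show "L2 area (\<lambda>x. - (\<mu> + \<nu>) * E x)"
    by (intro L2_area_continuous continuous_intros cont)
  show "H1_grad E grad" by (rule H1_grad_C1[OF C1_grad_mode])
  fix \<phi> \<Phi> assume t: "test_grad \<phi> \<Phi>"
  then have \<phi>: "C1_grad \<phi> \<Phi>" by (simp add: test_grad_def)
  note c = C1_grad_continuous[OF \<phi>] C1_gradD(2)[OF \<phi>]
  have z: "\<phi> (pi/2, y) = 0" "\<phi> (- (pi/2), y) = 0" "\<phi> (y, pi/2) = 0" "\<phi> (y, - (pi/2)) = 0" for y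
    by (rule test_grad_zero[OF t], simp add: square_def)+
  have "(LINT x|bdry. E x * \<phi> x) = 0"
    by (subst integral_bdry_continuous[OF continuous_on_mult[OF cont(1) c(1)]]) (simp add: z)
  with Green_mode_C1[OF \<phi>]
  have "(LINT x|area. grad x \<bullet> \<Phi> x) = (\<mu> + \<nu>) * (LINT x|area. E x * \<phi> x)" by simp
  also have "\<dots> = - (LINT x|area. - (\<mu> + \<nu>) * E x * \<phi> x)"
    by (simp add: mult.assoc) (simp add: algebra_simps)
  finally show "(LINT x|area. grad x \<bullet> \<Phi> x) = - (LINT x|area. - (\<mu> + \<nu>) * E x * \<phi> x)" .
qed

lemma has_trace_mode: "has_trace E E"
  unfolding has_trace_def
proof (intro conjI)
  show "L2 bdry E" by (intro L2_bdry_continuous cont)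
  have "H1_grad E grad" "C1_grad E grad" by (rule H1_grad_C1 C1_grad_mode)+
  then show "\<exists>G \<phi> \<Phi>. H1_grad E G \<and> (\<forall>n::nat. C1_grad (\<phi> n) (\<Phi> n)) \<and>
        (\<lambda>n. LINT x|area. (\<phi> n x - E x)\<^sup>2) \<longlonglongrightarrow> 0 \<and>
        (\<lambda>n. LINT x|area. (norm (\<Phi> n x - G x))\<^sup>2) \<longlonglongrightarrow> 0 \<and>
        (\<lambda>n. LINT x|bdry. (\<phi> n x - E x)\<^sup>2) \<longlonglongrightarrow> 0"
    by (intro exI[where x = grad] exI[where x = "\<lambda>_. E"] exI[where x = "\<lambda>_. grad"]) simp
qed

lemma has_normal_derivative_mode: "has_normal_derivative E (\<lambda>x. t * E x)"
  unfolding has_normal_derivative_def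
proof (intro conjI exI allI impI)
  show "L2 bdry (\<lambda>x. t * E x)" by (intro L2_bdry_continuous continuous_intros cont)
  show "H1_grad E grad" by (rule H1_grad_C1[OF C1_grad_mode])
  show "has_laplacian E (\<lambda>x. - (\<mu> + \<nu>) * E x)" by (rule has_laplacian_mode)
  fix v V w assume "H1_grad v V \<and> has_trace v w"
  then have v: "H1_grad v V" "has_trace v w" by auto
  show "(LINT x|area. grad x \<bullet> V x) + (LINT x|area. - (\<mu> + \<nu>) * E x * v x) = (LINT x|bdry. t * E x * w x)"
    using Green_mode_H1[OF v] by (simp add: mult.assoc) (simp add: algebra_simps)
qed

lemma robin_solution_mode: "robin_solution (- t) (\<mu> + \<nu>) E"
  unfolding robin_solution_def
proof (rule exI, rule exI, rule exI, intro conjI)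
  show "has_laplacian E (\<lambda>x. - (\<mu> + \<nu>) * E x)" by (rule has_laplacian_mode)
  show "has_trace E E" by (rule has_trace_mode)
  show "has_normal_derivative E (\<lambda>x. t * E x)" by (rule has_normal_derivative_mode)
  show "AE x in area. - (- (\<mu> + \<nu>) * E x) = (\<mu> + \<nu>) * E x"
    by (rule AE_I2) (simp add: algebra_simps)
  show "AE x in bdry. t * E x + - t * E x = 0" by simp
qed

text \<open>Symmetry of the Robin Laplacian. Green's formula is applied twice: to \<open>u\<close>
  tested with \<open>E\<close>, as in the definition of the normal derivative, and to
  \<open>E\<close> tested with \<open>u\<close>. The gradient and boundary terms cancel, leaving the
  difference of the eigenvalues times the integral.\<close>

lemma robin_solution_orthogonal_mode:
  assumes u: "robin_solution (- t) \<kappa> u" and ne: "\<kappa> \<noteq> \<mu> + \<nu>"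
  shows "(LINT x|area. u x * E x) = 0"
proof -
  obtain f g q where f: "has_laplacian u f" and g: "has_trace u g" and q: "has_normal_derivative u q"
    and eq: "AE x in area. - f x = \<kappa> * u x" "AE x in bdry. q x + - t * g x = 0"
    using u unfolding robin_solution_def by blast
  obtain G f' where G: "H1_grad u G" "has_laplacian u f'"
    and Gr: "\<And>v V w. H1_grad v V \<and> has_trace v w \<Longrightarrow>
       (LINT x|area. G x \<bullet> V x) + (LINT x|area. f' x * v x) = (LINT x|bdry. q x * w x)"
    using q unfolding has_normal_derivative_def by blast
  have 1: "(LINT x|area. G x \<bullet> grad x) + (LINT x|area. f' x * E x) = (LINT x|bdry. q x * E x)"
    by (rule Gr) (auto intro: H1_grad_C1 C1_grad_mode has_trace_mode)
  have 2: "(LINT x|area. grad x \<bullet> G x) - (\<mu> + \<nu>) * (LINT x|area. E x * u x) = t * (LINT x|bdry. E x * g x)"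
    by (rule Green_mode_H1[OF G(1) g])
  have mE: "E \<in> borel_measurable bdry"
    using L2_bdry_continuous[OF cont(1)] by (simp add: L2_def)
  have mq: "q \<in> borel_measurable bdry" "g \<in> borel_measurable bdry"
    using q g by (auto simp: has_normal_derivative_def has_trace_def L2_def)
  have mf: "f' \<in> borel_measurable area" using G(2) by (auto simp: has_laplacian_def L2_def)
  have mu: "u \<in> borel_measurable area" using H1_gradD(1)[OF G(1)] by (auto simp: L2_def)
  have "AE x in area. f' x * E x = - \<kappa> * (E x * u x)"
    using laplacian_unique[OF G(2) f] eq(1)
  proof eventually_elim
    case (elim x)
    then have "f' x = - (\<kappa> * u x)" by linarith
    then show ?case by simp
  qed
  then have 3: "(LINT x|area. f' x * E x) = (LINT x|area. - \<kappa> * (E x * u x))"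
    by (intro integral_cong_AE borel_measurable_times borel_measurable_const mf mu
        measurable_area_continuous cont)
  have "AE x in bdry. q x * E x = t * (E x * g x)"
    using eq(2)
  proof eventually_elim
    case (elim x)
    then have "q x = t * g x" by linarith
    then show ?case by simp
  qed
  then have 4: "(LINT x|bdry. q x * E x) = (LINT x|bdry. t * (E x * g x))"
    by (intro integral_cong_AE borel_measurable_times borel_measurable_const mq mE)
  have "(\<kappa> - (\<mu> + \<nu>)) * (LINT x|area. E x * u x) = 0"
    using 1 2 3 4 by (simp add: inner_commute algebra_simps)
  then show ?thesis using ne by (simp add: mult.commute)
qed

end

lemma robin_solution_L2:
  assumes "robin_solution h \<kappa> u"
  shows "L2 area u"
proof -
  obtain f where "has_laplacian u f" using assms unfolding robin_solution_def by (elim exE conjE) (rule that)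
  then obtain G where "H1_grad u G" unfolding has_laplacian_def by (elim exE conjE) (rule that)
  then show ?thesis by (rule H1_gradD)
qed

section \<open>Cosine and sine transforms\<close>

text \<open>When \<open>m\<close> consists of the moments of \<open>f\<close>, these are \<open>\<integral>f(x) cos (wx) dx\<close> and \<open>\<integral>f(x) sin (wx)/w dx\<close>
  as functions of \<open>z = w\<^sup>2\<close>.\<close>

definition even_series :: "(nat \<Rightarrow> real) \<Rightarrow> complex \<Rightarrow> complex" where
  "even_series m z = (\<Sum>n. of_real (cos_coeff (2 * n) * m (2 * n)) * z ^ n)"

definition odd_series :: "(nat \<Rightarrow> real) \<Rightarrow> complex \<Rightarrow> complex" where
  "odd_series m z = (\<Sum>n. of_real (sin_coeff (2 * n + 1) * m (2 * n + 1)) * z ^ n)"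

lemma abs_cos_coeff_le: "\<bar>cos_coeff n\<bar> \<le> 1 / fact n"
  by (simp add: cos_coeff_def power_abs)

lemma abs_sin_coeff_le: "\<bar>sin_coeff n\<bar> \<le> 1 / fact n"
  by (simp add: sin_coeff_def power_abs)

context
  fixes m :: "nat \<Rightarrow> real" and A B :: real
  assumes m: "\<And>n. \<bar>m n\<bar> \<le> A * B ^ n" and AB: "A \<ge> 0" "B \<ge> 0"
begin

private lemma summable_moments:
  assumes "\<And>n. \<bar>c n\<bar> \<le> 1 / fact n"
  shows "summable (\<lambda>n. of_real (c n * m n) * (w::complex) ^ n)"
proof (rule summable_comparison_test')
  show "summable (\<lambda>n. A * (inverse (fact n) * (B * cmod w) ^ n))"
    by (intro summable_mult summable_exp)
  show "norm (of_real (c n * m n) * w ^ n) \<le> A * (inverse (fact n) * (B * cmod w) ^ n)" for n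
  proof -
    have "norm (of_real (c n * m n) * w ^ n) = \<bar>c n\<bar> * \<bar>m n\<bar> * cmod w ^ n"
      by (simp add: norm_mult norm_power abs_mult)
    also have "\<dots> \<le> (1 / fact n) * (A * B ^ n) * cmod w ^ n"
      using assms m AB by (intro mult_right_mono mult_mono) auto
    finally show ?thesis by (simp add: field_simps power_mult_distrib)
  qed
qed

text \<open>The odd coefficients of the cosine series vanish, so the full series in \<open>w\<close>
  is a power series in \<open>w\<^sup>2\<close>.\<close>

lemma even_series_sums: "(\<lambda>n. of_real (cos_coeff n * m n) * w ^ n) sums even_series m (w\<^sup>2)"
proof -
  obtain c where c: "(\<lambda>n. of_real (cos_coeff n * m n) * w ^ n) sums c"
    using summable_moments[OF abs_cos_coeff_le] by (auto simp: summable_def)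
  have "(\<lambda>n. of_real (cos_coeff (2 * n) * m (2 * n)) * w ^ (2 * n)) sums c"
  proof (subst sums_mono_reindex[of "\<lambda>n. 2 * n"])
    show "strict_mono (\<lambda>n. 2 * n :: nat)" by (auto simp: strict_mono_def)
    fix n :: nat assume "n \<notin> range (\<lambda>n. 2 * n)"
    then have "odd n" by (auto elim!: evenE)
    then show "of_real (cos_coeff n * m n) * w ^ n = 0" by (simp add: cos_coeff_def)
  qed (rule c)
  then have "even_series m (w\<^sup>2) = c"
    unfolding even_series_def by (simp add: power_mult sums_iff)
  with c show ?thesis by simp
qed

lemma odd_series_sums: "(\<lambda>n. of_real (sin_coeff n * m n) * w ^ n) sums (w * odd_series m (w\<^sup>2))"
proof -
  obtain c where c: "(\<lambda>n. of_real (sin_coeff n * m n) * w ^ n) sums c"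
    using summable_moments[OF abs_sin_coeff_le] by (auto simp: summable_def)
  have s: "(\<lambda>n. of_real (sin_coeff (2 * n + 1) * m (2 * n + 1)) * w ^ (2 * n + 1)) sums c"
  proof (subst sums_mono_reindex[of "\<lambda>n. 2 * n + 1"])
    show "strict_mono (\<lambda>n. 2 * n + 1 :: nat)" by (auto simp: strict_mono_def)
    fix n :: nat assume "n \<notin> range (\<lambda>n. 2 * n + 1)"
    then have "even n" by (metis oddE rangeI)
    then show "of_real (sin_coeff n * m n) * w ^ n = 0" by (simp add: sin_coeff_def)
  qed (rule c)
  have "w * odd_series m (w\<^sup>2) = c"
  proof (cases "w = 0")
    case True
    then show ?thesis using s by (simp add: sums_iff)
  next
    case False
    have "(\<lambda>n. of_real (sin_coeff (2 * n + 1) * m (2 * n + 1)) * (w\<^sup>2) ^ n) sums (c / w)"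
      using sums_divide[OF s, of w] False by (simp add: power_mult mult.assoc)
    then show ?thesis using False unfolding odd_series_def by (simp add: sums_iff)
  qed
  with c show ?thesis by simp
qed

private lemma summable_even: "summable (\<lambda>n. of_real (cos_coeff (2 * n) * m (2 * n)) * (z::complex) ^ n)"
proof -
  have "summable (\<lambda>n. of_real (cos_coeff n * m n) * csqrt z ^ n)"
    using even_series_sums by (rule sums_summable)
  then have "summable ((\<lambda>n. of_real (cos_coeff n * m n) * csqrt z ^ n) \<circ> (\<lambda>n. 2 * n))"
    using summable_moments[OF abs_cos_coeff_le, of "csqrt z"]
    by (subst o_def, subst summable_mono_reindex)
       (auto simp: strict_mono_def cos_coeff_def elim!: evenE)
  then show ?thesis by (simp add: o_def power_mult)
qed

private lemma summable_odd: "summable (\<lambda>n. of_real (sin_coeff (2 * n + 1) * m (2 * n + 1)) * (z::complex) ^ n)"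
proof (rule summable_comparison_test')
  show "summable (\<lambda>n. A * B * (inverse (fact n) * (B\<^sup>2 * cmod z) ^ n))"
    by (intro summable_mult summable_exp)
  show "norm (of_real (sin_coeff (2 * n + 1) * m (2 * n + 1)) * z ^ n) \<le> A * B * (inverse (fact n) * (B\<^sup>2 * cmod z) ^ n)" for n
  proof -
    have "norm (of_real (sin_coeff (2 * n + 1) * m (2 * n + 1)) * z ^ n) = \<bar>sin_coeff (2 * n + 1)\<bar> * \<bar>m (2 * n + 1)\<bar> * cmod z ^ n"
      by (simp add: norm_mult norm_power abs_mult)
    also have "\<dots> \<le> (1 / fact n) * (A * B ^ (2 * n + 1)) * cmod z ^ n"
    proof (intro mult_right_mono mult_mono m)
      show "\<bar>sin_coeff (2 * n + 1)\<bar> \<le> 1 / fact n"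
        by (rule order_trans[OF abs_sin_coeff_le]) (intro divide_left_mono fact_mono mult_pos_pos, auto simp del: fact_Suc)
    qed (use AB in auto)
    also have "\<dots> = A * B * (inverse (fact n) * (B\<^sup>2 * cmod z) ^ n)"
      by (simp add: power_mult_distrib power_mult divide_inverse)
    finally show ?thesis .
  qed
qed

lemma even_series_DERIV_0: "(even_series m has_field_derivative of_real (cos_coeff 2 * m 2)) (at 0)"
proof -
  have "diffs (\<lambda>n. complex_of_real (cos_coeff (2 * n) * m (2 * n))) 0 = of_real (cos_coeff 2 * m 2)"
    unfolding diffs_def by simp
  with termdiffs_strong_converges_everywhere[OF summable_even, of 0]
  show ?thesis unfolding even_series_def[abs_def] powser_zero by (simp only:)
qed

lemma odd_series_DERIV_0: "(odd_series m has_field_derivative of_real (sin_coeff 3 * m 3)) (at 0)"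
proof -
  have "diffs (\<lambda>n. complex_of_real (sin_coeff (2 * n + 1) * m (2 * n + 1))) 0 = of_real (sin_coeff 3 * m 3)"
    unfolding diffs_def by (simp add: numeral_3_eq_3)
  with termdiffs_strong_converges_everywhere[OF summable_odd, of 0]
  show ?thesis unfolding odd_series_def[abs_def] powser_zero by (simp only:)
qed

lemma even_series_holomorphic: "even_series m holomorphic_on S"
  unfolding even_series_def[abs_def] holomorphic_on_def field_differentiable_def
  by (intro ballI exI)
     (rule has_field_derivative_at_within[OF termdiffs_strong_converges_everywhere[OF summable_even]])

lemma odd_series_holomorphic: "odd_series m holomorphic_on S"
  unfolding odd_series_def[abs_def] holomorphic_on_def field_differentiable_def
  by (intro ballI exI)
     (rule has_field_derivative_at_within[OF termdiffs_strong_converges_everywhere[OF summable_odd]])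

private lemma power_series_zero_coeff:
  assumes s: "\<And>z. (\<lambda>n. a n * z ^ n) sums (0 :: complex)"
  shows "a n = 0"
proof (cases "n = 0")
  case True
  then show ?thesis using s[of 0] by (simp add: sums_iff powser_zero)
next
  case False
  show ?thesis
  proof (rule ccontr)
    assume "a n \<noteq> 0"
    \<comment> \<open>Zeros of a power series with a nonzero coefficient are isolated; since the sum
      here is the zero function, some punctured ball would have to be empty.\<close>
    have "\<exists>r>0. cball (0::complex) r - {0} = {}"
    proof (rule powser_0_nonzero[of 1 0 a "\<lambda>_. 0" n])
      show "(\<lambda>n. a n * (z - 0) ^ n) sums 0" for z using s[of z] by simp
      show "n > 0" "a n \<noteq> 0" using False \<open>a n \<noteq> 0\<close> by auto
      fix r :: real assume r: "r > 0" "\<And>z::complex. z \<in> cball 0 r - {0} \<Longrightarrow> (0::complex) \<noteq> 0"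
      have "cball (0::complex) r - {0} = {}" using r(2) by (metis equals0I)
      with r(1) show "\<exists>r>0. cball (0::complex) r - {0} = {}" by (intro exI[of _ r] conjI)
    qed simp_all
    then obtain r where r: "r > 0" "cball (0::complex) r - {0} = {}" by (elim exE conjE)
    have "of_real r \<in> cball (0::complex) r - {0}" using r(1) by simp
    with r(2) show False by blast
  qed
qed

lemma even_series_eq_0_imp:
  assumes "\<And>z. even_series m z = 0"
  shows "m (2 * n) = 0"
proof -
  have "(\<lambda>n. of_real (cos_coeff (2 * n) * m (2 * n)) * z ^ n) sums (0::complex)" for z
    using summable_sums[OF summable_even, of z] assms[of z] by (simp add: even_series_def)
  from power_series_zero_coeff[OF this, of n] show ?thesis by (simp add: cos_coeff_def)
qed

lemma odd_series_eq_0_imp: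
  assumes "\<And>z. odd_series m z = 0"
  shows "m (2 * n + 1) = 0"
proof -
  have "(\<lambda>n. of_real (sin_coeff (2 * n + 1) * m (2 * n + 1)) * z ^ n) sums (0::complex)" for z
    using summable_sums[OF summable_odd, of z] assms[of z] by (simp add: odd_series_def)
  from power_series_zero_coeff[OF this, of n] have "sin_coeff (2 * n + 1) * m (2 * n + 1) = 0"
    by (simp only: of_real_eq_0_iff)
  moreover have "sin_coeff (2 * n + 1) \<noteq> 0" by (simp add: sin_coeff_def del: fact_Suc)
  ultimately show ?thesis by simp
qed

end

text \<open>Powers of \<open>x\<close> are the moments of a point mass at \<open>x\<close>, so the
  series returns the cosine itself. The characteristic functions are built from the case of the end
  point \<open>pi/2\<close>.\<close>

lemma even_series_power:
  fixes x :: real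
  shows "even_series (\<lambda>n. x ^ n) (w\<^sup>2) = cos (w * of_real x)"
proof -
  have "(\<lambda>n. of_real (cos_coeff n * x ^ n) * w ^ n) sums even_series (\<lambda>n. x ^ n) (w\<^sup>2)"
    by (rule even_series_sums[of _ 1 "\<bar>x\<bar>"]) (auto simp: power_abs)
  moreover have "(\<lambda>n. of_real (cos_coeff n * x ^ n) * w ^ n) sums cos (w * of_real x)"
    using cos_converges[of "w * of_real x"] by (simp add: scaleR_conv_of_real power_mult_distrib mult_ac)
  ultimately show ?thesis by (rule sums_unique2)
qed

lemma odd_series_power:
  fixes x :: real
  shows "w * odd_series (\<lambda>n. x ^ n) (w\<^sup>2) = sin (w * of_real x)"
proof -
  have "(\<lambda>n. of_real (sin_coeff n * x ^ n) * w ^ n) sums (w * odd_series (\<lambda>n. x ^ n) (w\<^sup>2))"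
    by (rule odd_series_sums[of _ 1 "\<bar>x\<bar>"]) (auto simp: power_abs)
  moreover have "(\<lambda>n. of_real (sin_coeff n * x ^ n) * w ^ n) sums sin (w * of_real x)"
    using sin_converges[of "w * of_real x"] by (simp add: scaleR_conv_of_real power_mult_distrib mult_ac)
  ultimately show ?thesis by (rule sums_unique2)
qed

section \<open>Quotients and vanishing of entire functions\<close>

lemma field_differentiable_transform:
  assumes "f field_differentiable (at a)" "\<And>z. z \<in> S \<Longrightarrow> f z = g z" "open S" "a \<in> S"
  shows "g field_differentiable (at a)"
proof -
  obtain f' where "(f has_field_derivative f') (at a)" using assms(1) by (auto simp: field_differentiable_def)
  from has_field_derivative_transform_within_open[OF this assms(3,4,2)]
  show ?thesis by (auto simp: field_differentiable_def)
qed

text \<open>\<open>f / g\<close> is entire when the zeros of \<open>g\<close> are simple and are zeros of \<open>f\<close>.\<close>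

lemma entire_quotient:
  assumes f: "f holomorphic_on UNIV" and g: "g holomorphic_on UNIV"
    and zeros: "\<And>z. g z = 0 \<Longrightarrow> f z = 0 \<and> deriv g z \<noteq> 0"
  obtains q where "q holomorphic_on UNIV" "\<And>z. f z = q z * g z"
proof -
  \<comment> \<open>At zeros of \<open>g\<close> the quotient takes the l'Hopital value; it is
    differentiable there because the factor \<open>z - a\<close> can be cancelled from
    \<open>f\<close> and \<open>g\<close>.\<close>
  define q where "q = (\<lambda>z. if g z = 0 then deriv f z / deriv g z else f z / g z)"
  have "q field_differentiable (at a)" for a
  proof (cases "g a = 0")
    case False
    have "open {z. g z \<noteq> 0}"
      using g by (intro open_Collect_neq continuous_intros holomorphic_on_imp_continuous_on)
    moreover have "(\<lambda>z. f z / g z) holomorphic_on {z. g z \<noteq> 0}"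
      by (intro holomorphic_intros holomorphic_on_subset[OF f] holomorphic_on_subset[OF g]) auto
    ultimately have "(\<lambda>z. f z / g z) field_differentiable (at a)"
      using False by (intro holomorphic_on_imp_differentiable_at[of _ "{z. g z \<noteq> 0}"]) auto
    then show ?thesis
    proof (rule field_differentiable_transform[of _ a "{z. g z \<noteq> 0}"])
      show "f z / g z = q z" if "z \<in> {z. g z \<noteq> 0}" for z using that by (simp add: q_def)
    qed (use False \<open>open _\<close> in auto)
  next
    case True
    define F where "F = (\<lambda>z. if z = a then deriv f a else (f z - f a) / (z - a))"
    define G where "G = (\<lambda>z. if z = a then deriv g a else (g z - g a) / (z - a))"
    have F: "F holomorphic_on UNIV" and G: "G holomorphic_on UNIV"
      unfolding F_def G_def by (intro pole_lemma_open f g open_UNIV)+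
    have fF: "f z = (z - a) * F z" and gG: "g z = (z - a) * G z" for z
      using zeros[OF True] True by (auto simp: F_def G_def)
    have Ga: "G a \<noteq> 0" using zeros[OF True] by (simp add: G_def)
    have o: "open {z. G z \<noteq> 0}"
      using G by (intro open_Collect_neq continuous_intros holomorphic_on_imp_continuous_on)
    have "(\<lambda>z. F z / G z) holomorphic_on {z. G z \<noteq> 0}"
      by (intro holomorphic_intros holomorphic_on_subset[OF F] holomorphic_on_subset[OF G]) auto
    then have "(\<lambda>z. F z / G z) field_differentiable (at a)"
      using Ga o by (intro holomorphic_on_imp_differentiable_at[of _ "{z. G z \<noteq> 0}"]) auto
    then show ?thesis
    proof (rule field_differentiable_transform[of _ a "{z. G z \<noteq> 0}"])
      show "F z / G z = q z" if "z \<in> {z. G z \<noteq> 0}" for z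
      proof (cases "z = a")
        case True
        then show ?thesis using \<open>g a = 0\<close> by (simp add: q_def F_def G_def)
      next
        case False
        then show ?thesis using that gG[of z] fF[of z] by (simp add: q_def)
      qed
    qed (use Ga o in auto)
  qed
  then have "q holomorphic_on UNIV" by (simp add: holomorphic_on_def field_differentiable_at_within)
  moreover have "f z = q z * g z" for z using zeros[of z] by (auto simp: q_def)
  ultimately show thesis using that by blast
qed

text \<open>Maximum modulus principle on growing squares: the bound on the sides carries over to any
  fixed point inside and tends to zero. The squares lie in the plane of the square root
  \<open>w\<close>, where their sides can keep away from the zeros of sine or cosine.\<close>

lemma entire_zero_of_square_bounds:
  assumes q: "q holomorphic_on UNIV" and R: "filterlim R at_top sequentially"
    and bound: "\<And>n w. R n > 2 * t + 1 \<Longrightarrow> (\<bar>Re w\<bar> = R n \<and> \<bar>Im w\<bar> \<le> R n) \<or> (\<bar>Im w\<bar> = R n \<and> \<bar>Re w\<bar> \<le> R n) \<Longrightarrow>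
        norm (q (w\<^sup>2)) \<le> A / (R n / 2 - t)"
  shows "q z = 0"
proof -
  define w0 where "w0 = csqrt z"
  have hol: "(\<lambda>w. q (w\<^sup>2)) holomorphic_on S" for S
  proof -
    have "(\<lambda>w::complex. w\<^sup>2) holomorphic_on S" by (intro holomorphic_intros)
    from holomorphic_on_compose_gen[OF this q] show ?thesis by (simp add: o_def)
  qed
  have ev: "eventually (\<lambda>n. norm (q (w0\<^sup>2)) \<le> A / (R n / 2 - t)) sequentially"
    using R[unfolded filterlim_at_top, rule_format, of "cmod w0 + 1"]
      R[unfolded filterlim_at_top, rule_format, of "2 * t + 2"]
  proof eventually_elim
    case (elim n)
    define r where "r = R n"
    have r: "r > 0" "cmod w0 < r" "R n > 2 * t + 1"
      using elim norm_ge_zero[of w0] unfolding r_def by linarith+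
    let ?S = "cbox (Complex (-r) (-r)) (Complex r r)"
    have S: "w \<in> ?S \<longleftrightarrow> \<bar>Re w\<bar> \<le> r \<and> \<bar>Im w\<bar> \<le> r" for w
      by (auto simp: in_cbox_complex_iff)
    have S': "w \<in> interior ?S \<longleftrightarrow> \<bar>Re w\<bar> < r \<and> \<bar>Im w\<bar> < r" for w
      by (auto simp: interior_cbox in_box_complex_iff)
    have "norm (q (w0\<^sup>2)) \<le> A / (r / 2 - t)"
    proof (rule maximum_modulus_frontier[of "\<lambda>w. q (w\<^sup>2)" ?S])
      show "continuous_on (closure ?S) (\<lambda>w. q (w\<^sup>2))"
        by (intro holomorphic_on_imp_continuous_on hol)
      show "w0 \<in> ?S" unfolding S using abs_Re_le_cmod[of w0] abs_Im_le_cmod[of w0] r(2) by linarith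
      fix w assume "w \<in> frontier ?S"
      then have "w \<in> ?S" "w \<notin> interior ?S" by (auto simp: frontier_def closure_cbox)
      then have "(\<bar>Re w\<bar> = r \<and> \<bar>Im w\<bar> \<le> r) \<or> (\<bar>Im w\<bar> = r \<and> \<bar>Re w\<bar> \<le> r)"
        unfolding S S' by auto
      then show "norm (q (w\<^sup>2)) \<le> A / (r / 2 - t)"
        using bound[OF r(3), of w] unfolding r_def by blast
    qed (auto intro: hol)
    then show ?case by (simp add: r_def)
  qed
  have "((\<lambda>x::real. A / (x / 2 - t)) \<longlongrightarrow> 0) at_top" by real_asymp
  from filterlim_compose[OF this R] have "(\<lambda>n. A / (R n / 2 - t)) \<longlonglongrightarrow> 0" .
  from tendsto_lowerbound[OF this ev] have "norm (q (w0\<^sup>2)) \<le> 0" by simp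
  then show ?thesis by (simp add: w0_def)
qed

section \<open>Inequalities for circular and hyperbolic functions\<close>

lemma sinh_gt_self: "0 < x \<Longrightarrow> x < sinh (x::real)"
proof -
  assume x: "0 < x"
  have "\<exists>z>0. z < x \<and> sinh x - sinh 0 = (x - 0) * cosh z"
    by (rule MVT2) (use x in \<open>auto intro!: derivative_eq_intros\<close>)
  then obtain z where z: "0 < z" "sinh x = x * cosh z" by auto
  have "cosh z > 1" using cosh_real_nonneg_less_iff[of 0 z] z(1) by simp
  then show ?thesis using x z(2) by simp
qed

lemma abs_sinh_gt: "x \<noteq> 0 \<Longrightarrow> \<bar>x\<bar> < \<bar>sinh (x::real)\<bar>"
  using sinh_gt_self[of x] sinh_gt_self[of "- x"] by (cases "x > 0") auto

lemma sin_less_self: "0 < x \<Longrightarrow> sin x < (x::real)"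
proof (cases "x < 2")
  case True
  assume x: "0 < x"
  have "\<exists>z>0. z < x \<and> sin x - sin 0 = (x - 0) * cos z"
    by (rule MVT2) (use x in \<open>auto intro!: derivative_eq_intros\<close>)
  then obtain z where z: "0 < z" "z < x" "sin x = x * cos z" by auto
  have "cos z < 1" using cos_monotone_0_pi[of 0 z] z True pi_gt3 by simp
  then show ?thesis using x z(3) by simp
next
  case False
  then show ?thesis using sin_le_one[of x] by linarith
qed

lemma abs_sin_less: "x \<noteq> 0 \<Longrightarrow> \<bar>sin x\<bar> < \<bar>x::real\<bar>"
proof (cases "x > 0")
  case True
  then have "- x < sin x"
    using True sin_ge_zero[of x] sin_ge_minus_one[of x] pi_gt3 by (cases "x \<le> pi") linarith+
  then show ?thesis using sin_less_self[of x] True by auto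
next
  case False
  assume "x \<noteq> 0"
  with False have x: "- x > 0" by simp
  then have "- (- x) < sin (- x)"
    using x sin_ge_zero[of "-x"] sin_ge_minus_one[of "-x"] pi_gt3 by (cases "-x \<le> pi") linarith+
  then show ?thesis using sin_less_self[OF x] by auto
qed

text \<open>The double-angle form of \<open>abs_sin_less\<close>. Together with
  \<open>abs_sinh_cosh_gt\<close> it decides both where the characteristic functions can vanish and
  that their zeros are simple.\<close>

lemma abs_sin_cos_less:
  assumes "x \<noteq> 0" shows "\<bar>sin x * cos x\<bar> < \<bar>x::real\<bar>"
proof -
  have "\<bar>sin (2 * x)\<bar> < \<bar>2 * x\<bar>" using assms by (intro abs_sin_less) simp
  then show ?thesis by (simp add: sin_double abs_mult)
qed

lemma abs_sinh_cosh_gt: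
  assumes "x \<noteq> 0" shows "\<bar>x\<bar> < \<bar>sinh x * cosh (x::real)\<bar>"
proof -
  have "\<bar>2 * x\<bar> < \<bar>sinh (2 * x)\<bar>" using assms by (intro abs_sinh_gt) simp
  then show ?thesis by (simp add: sinh_double abs_mult)
qed

lemma Re_Im_sin_cos:
  "Re (sin z) = sin (Re z) * cosh (Im z)" "Im (sin z) = cos (Re z) * sinh (Im z)"
  "Re (cos z) = cos (Re z) * cosh (Im z)" "Im (cos z) = - (sin (Re z) * sinh (Im z))"
  by (auto simp: Re_sin Im_sin Re_cos Im_cos cosh_field_def sinh_field_def field_simps)

lemma cmod_sin_squared: "(cmod (sin z))\<^sup>2 = (sin (Re z))\<^sup>2 + (sinh (Im z))\<^sup>2"
proof -
  have "(sin (Re z))\<^sup>2 * (cosh (Im z))\<^sup>2 + (cos (Re z))\<^sup>2 * (sinh (Im z))\<^sup>2 = (sin (Re z))\<^sup>2 + (sinh (Im z))\<^sup>2"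
    unfolding cosh_square_eq cos_squared_eq by (simp add: algebra_simps)
  then show ?thesis by (simp add: cmod_power2 Re_Im_sin_cos power_mult_distrib)
qed

lemma cmod_cos_squared: "(cmod (cos z))\<^sup>2 = (cos (Re z))\<^sup>2 + (sinh (Im z))\<^sup>2"
proof -
  have "(cos (Re z))\<^sup>2 * (cosh (Im z))\<^sup>2 + (sin (Re z))\<^sup>2 * (sinh (Im z))\<^sup>2 = (cos (Re z))\<^sup>2 + (sinh (Im z))\<^sup>2"
    unfolding cosh_square_eq sin_squared_eq by (simp add: algebra_simps)
  then show ?thesis by (simp add: cmod_power2 Re_Im_sin_cos power_mult_distrib)
qed

lemma cmod_sin_le_cosh: "cmod (sin z) \<le> cosh (Im z)" and cmod_cos_le_cosh: "cmod (cos z) \<le> cosh (Im z)"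
  by (rule power2_le_imp_le; simp add: cmod_sin_squared cmod_cos_squared cosh_square_eq abs_square_le_1)+

lemma cmod_sin_ge: "\<bar>sinh (Im z)\<bar> \<le> cmod (sin z)" and cmod_cos_ge: "\<bar>sinh (Im z)\<bar> \<le> cmod (cos z)"
  by (rule power2_le_imp_le; simp add: cmod_sin_squared cmod_cos_squared)+

text \<open>Equivalent to \<open>3 \<le> exp (2 * \<bar>y\<bar>)\<close>, which follows from the
  tangent of the exponential at the origin.\<close>

lemma cosh_le_2_sinh: "1 \<le> \<bar>y\<bar> \<Longrightarrow> cosh y / 2 \<le> \<bar>sinh (y::real)\<bar>"
proof -
  assume y: "1 \<le> \<bar>y\<bar>"
  have *: "cosh x \<le> 2 * sinh x" if "1 \<le> x" for x :: real
  proof -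
    have "3 \<le> exp (2 * x)" using exp_ge_add_one_self[of "2 * x"] that by linarith
    then have "3 * exp (- x) \<le> exp (2 * x) * exp (- x)" by (intro mult_right_mono) auto
    also have "\<dots> = exp x" by (simp flip: exp_add)
    finally show ?thesis by (simp add: cosh_field_def sinh_field_def)
  qed
  show ?thesis using *[of "\<bar>y\<bar>"] y by (cases "y \<ge> 0") auto
qed

text \<open>Together with \<open>odd_mode\<close>, the solutions of X'' = - \<mu> X with initial
  values (1, 0) and (0, 1) at the origin. Despite the case distinctions both are analytic in
  \<open>\<mu>\<close>, which is why \<open>odd_mode\<close> carries the divisor.\<close>

definition even_mode :: "real \<Rightarrow> real \<Rightarrow> real" where
  "even_mode \<mu> x = (if \<mu> \<ge> 0 then cos (sqrt \<mu> * x) else cosh (sqrt (- \<mu>) * x))"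

definition odd_mode :: "real \<Rightarrow> real \<Rightarrow> real" where
  "odd_mode \<mu> x = (if \<mu> > 0 then sin (sqrt \<mu> * x) / sqrt \<mu> else if \<mu> = 0 then x
     else sinh (sqrt (- \<mu>) * x) / sqrt (- \<mu>))"

lemma cosh_complex_of_real: "cosh (complex_of_real x) = of_real (cosh x)"
  and sinh_complex_of_real: "sinh (complex_of_real x) = of_real (sinh x)"
  by (simp_all add: cosh_field_def sinh_field_def exp_minus exp_of_real)

text \<open>Takes \<open>w\<close> real or imaginary according to the sign of \<open>\<mu>\<close>,
  so that both signs are handled by the complex sine and cosine from here on.\<close>

lemma real_square_root_complex:
  obtains w :: complex where "of_real \<mu> = w\<^sup>2" "\<mu> \<noteq> 0 \<Longrightarrow> w \<noteq> 0"
    "\<And>x. cos (w * of_real x) = of_real (even_mode \<mu> x)"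
    "\<And>x. sin (w * of_real x) = w * of_real (odd_mode \<mu> x)"
proof (cases "\<mu> \<ge> 0")
  case True
  show thesis
  proof (rule that[of "of_real (sqrt \<mu>)"])
    show "of_real \<mu> = (complex_of_real (sqrt \<mu>))\<^sup>2" using True by (simp flip: of_real_power)
    show "cos (of_real (sqrt \<mu>) * of_real x) = complex_of_real (even_mode \<mu> x)" for x
      using True by (simp add: even_mode_def cos_of_real flip: of_real_mult)
    show "sin (of_real (sqrt \<mu>) * of_real x) = complex_of_real (sqrt \<mu>) * of_real (odd_mode \<mu> x)" for x
      using True by (simp add: odd_mode_def sin_of_real flip: of_real_mult)
  qed (use True in auto)
next
  case False
  show thesis
  proof (rule that[of "\<i> * of_real (sqrt (- \<mu>))"])
    show "of_real \<mu> = (\<i> * complex_of_real (sqrt (- \<mu>)))\<^sup>2" using False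
      by (simp add: power_mult_distrib flip: of_real_power)
    show "cos (\<i> * of_real (sqrt (- \<mu>)) * of_real x) = complex_of_real (even_mode \<mu> x)" for x
      using False by (simp add: even_mode_def mult.assoc flip: of_real_mult cosh_conv_cos cosh_complex_of_real)
    show "sin (\<i> * of_real (sqrt (- \<mu>)) * of_real x) = \<i> * complex_of_real (sqrt (- \<mu>)) * of_real (odd_mode \<mu> x)" for x
    proof -
      have "sin (\<i> * complex_of_real (sqrt (- \<mu>) * x)) = \<i> * sinh (complex_of_real (sqrt (- \<mu>) * x))"
        by (simp add: sinh_conv_sin)
      also have "\<dots> = \<i> * complex_of_real (sinh (sqrt (- \<mu>) * x))" by (simp only: sinh_complex_of_real)
      finally show ?thesis using False by (simp add: odd_mode_def mult.assoc)
    qed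
  qed (use False in auto)
qed

lemma even_series_real: "even_series (\<lambda>n. x ^ n) (of_real \<mu>) = of_real (even_mode \<mu> x)"
proof -
  obtain w :: complex where w: "of_real \<mu> = w\<^sup>2" "\<And>x. cos (w * of_real x) = of_real (even_mode \<mu> x)"
    using real_square_root_complex by metis
  then show ?thesis by (simp add: even_series_power)
qed

lemma odd_series_0: "odd_series m 0 = of_real (m 1)"
  unfolding odd_series_def powser_zero by (simp add: sin_coeff_def)

lemma even_series_0: "even_series m 0 = of_real (m 0)"
  unfolding even_series_def powser_zero by (simp add: cos_coeff_def)

lemma odd_series_real: "odd_series (\<lambda>n. x ^ n) (of_real \<mu>) = of_real (odd_mode \<mu> x)"
proof (cases "\<mu> = 0")
  case True
  then show ?thesis by (simp add: odd_series_0 odd_mode_def)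
next
  case False
  obtain w :: complex where w: "of_real \<mu> = w\<^sup>2" "\<And>x. sin (w * of_real x) = w * of_real (odd_mode \<mu> x)" "w \<noteq> 0"
    using real_square_root_complex False by metis
  then show ?thesis using odd_series_power[of w x] by simp
qed

section \<open>Transforms of an integrable function and their growth\<close>

abbreviation moments :: "(real \<Rightarrow> real) \<Rightarrow> nat \<Rightarrow> real" where
  "moments f n \<equiv> (LINT x|side_measure. f x * x ^ n)"

context
  fixes f :: "real \<Rightarrow> real"
  assumes f: "integrable side_measure f"
begin

private abbreviation "A \<equiv> (LINT x|side_measure. \<bar>f x\<bar>)"

private lemma bound: "\<bar>f x * x ^ n\<bar> \<le> \<bar>f x\<bar> * (pi/2) ^ n" if "x \<in> space side_measure"
proof -
  have "\<bar>x\<bar> \<le> pi/2" using that by (auto simp: space_restrict_space)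
  then have "\<bar>x\<bar> ^ n \<le> (pi/2) ^ n" by (intro power_mono) auto
  then show ?thesis by (simp add: abs_mult power_abs mult_left_mono)
qed

private lemma integrable_moment: "integrable side_measure (\<lambda>x. f x * x ^ n)"
proof -
  have "integrable side_measure (\<lambda>x. \<bar>f x\<bar> * (pi/2) ^ n)" using f by simp
  moreover have "(\<lambda>x. f x * x ^ n) \<in> borel_measurable side_measure"
    by (intro borel_measurable_times borel_measurable_integrable[OF f] measurable_restrict_space1) simp
  ultimately show ?thesis
    by (rule Bochner_Integration.integrable_bound) (use bound in \<open>auto intro!: AE_I2\<close>)
qed

lemma moment_bound: "\<bar>moments f n\<bar> \<le> A * (pi/2) ^ n"
proof -
  have "\<bar>moments f n\<bar> \<le> (LINT x|side_measure. \<bar>f x * x ^ n\<bar>)"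
    using integral_norm_bound[of side_measure "\<lambda>x. f x * x ^ n"] by simp
  also have "\<dots> \<le> (LINT x|side_measure. \<bar>f x\<bar> * (pi/2) ^ n)"
    by (intro integral_mono integrable_abs integrable_moment bound) (use f in auto)
  finally show ?thesis using f by simp
qed

private lemma A_nonneg: "A \<ge> 0" by simp

text \<open>Termwise integration; an exponential series times \<open>\<bar>f x\<bar>\<close>
  dominates the terms.\<close>

private lemma transform_sums:
  fixes w :: complex
  assumes c: "\<And>n. \<bar>c n\<bar> \<le> 1 / fact n"
    and g: "\<And>x. (\<lambda>n. of_real (c n * x ^ n) * w ^ n) sums g x"
  shows "(\<lambda>n. of_real (c n * moments f n) * w ^ n) sums (LINT x|side_measure. of_real (f x) * g x)"
proof -
  let ?h = "\<lambda>n x. complex_of_real (f x * x ^ n) * (of_real (c n) * w ^ n)"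
  have i: "integrable side_measure (?h n)" for n
    by (intro integrable_mult_left integrable_of_real integrable_moment)
  have nh: "norm (?h n x) \<le> \<bar>f x\<bar> * (inverse (fact n) * (pi/2 * cmod w) ^ n)" if "x \<in> space side_measure" for n x
  proof -
    have "norm (?h n x) = \<bar>f x * x ^ n\<bar> * (\<bar>c n\<bar> * cmod w ^ n)"
      by (simp only: norm_mult norm_power norm_of_real)
    also have "\<dots> \<le> (\<bar>f x\<bar> * (pi/2) ^ n) * ((1 / fact n) * cmod w ^ n)"
      by (intro mult_mono bound that c) auto
    also have "\<dots> = \<bar>f x\<bar> * (inverse (fact n) * (pi/2 * cmod w) ^ n)"
      by (simp only: power_mult_distrib divide_inverse mult_1 mult_ac)
    finally show ?thesis .
  qed
  have s: "summable (\<lambda>n. B * (inverse (fact n) * (pi/2 * cmod w) ^ n))" for B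
    by (intro summable_mult summable_exp)
  have "(\<lambda>n. LINT x|side_measure. ?h n x) sums (LINT x|side_measure. (\<Sum>n. ?h n x))"
  proof (rule sums_integral[OF i])
    show "AE x in side_measure. summable (\<lambda>n. norm (?h n x))"
    proof (rule AE_I2)
      fix x assume x: "x \<in> space side_measure"
      show "summable (\<lambda>n. norm (?h n x))"
        by (rule summable_comparison_test'[OF s[of "\<bar>f x\<bar>"]])
           (simp only: real_norm_def abs_norm_cancel nh[OF x])
    qed
    show "summable (\<lambda>n. LINT x|side_measure. norm (?h n x))"
    proof (rule summable_comparison_test'[OF s])
      show "norm (LINT x|side_measure. norm (?h n x)) \<le> A * (inverse (fact n) * (pi/2 * cmod w) ^ n)" for n
      proof -
        have "norm (LINT x|side_measure. norm (?h n x)) = (LINT x|side_measure. norm (?h n x))"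
          by (simp only: real_norm_def abs_of_nonneg Bochner_Integration.integral_nonneg norm_ge_zero)
        also have "\<dots> \<le> (LINT x|side_measure. \<bar>f x\<bar> * (inverse (fact n) * (pi/2 * cmod w) ^ n))"
          by (intro integral_mono integrable_norm i nh integrable_mult_left integrable_abs f)
        also have "\<dots> = A * (inverse (fact n) * (pi/2 * cmod w) ^ n)"
          by (rule integral_mult_left_zero)
        finally show ?thesis .
      qed
    qed
  qed
  moreover have "(LINT x|side_measure. ?h n x) = of_real (c n * moments f n) * w ^ n" for n
    by (subst integral_mult_left_zero, subst integral_complex_of_real) (simp add: mult_ac)
  moreover have "(\<Sum>n. ?h n x) = of_real (f x) * g x" for x
    using sums_mult[OF g, of "of_real (f x)" x] by (simp add: sums_iff mult_ac)
  ultimately show ?thesis by (simp only:)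
qed

lemma even_series_moments: "even_series (moments f) (w\<^sup>2) = (LINT x|side_measure. of_real (f x) * cos (w * of_real x))"
proof -
  have "(\<lambda>n. of_real (cos_coeff n * x ^ n) * w ^ n) sums cos (w * of_real x)" for x
    using even_series_sums[of "\<lambda>n. x ^ n" 1 "\<bar>x\<bar>" w] by (simp add: even_series_power power_abs)
  from transform_sums[OF abs_cos_coeff_le this] even_series_sums[OF moment_bound A_nonneg, of w]
  show ?thesis by (auto intro: sums_unique2)
qed

lemma odd_series_moments: "w * odd_series (moments f) (w\<^sup>2) = (LINT x|side_measure. of_real (f x) * sin (w * of_real x))"
proof -
  have "(\<lambda>n. of_real (sin_coeff n * x ^ n) * w ^ n) sums sin (w * of_real x)" for x
    using odd_series_sums[of "\<lambda>n. x ^ n" 1 "\<bar>x\<bar>" w] by (simp add: odd_series_power power_abs)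
  from transform_sums[OF abs_sin_coeff_le this] odd_series_sums[OF moment_bound A_nonneg, of w]
  show ?thesis by (auto intro: sums_unique2)
qed

lemma even_series_moments_real: "even_series (moments f) (of_real \<mu>) = of_real (LINT x|side_measure. f x * even_mode \<mu> x)"
proof -
  obtain w :: complex where w: "of_real \<mu> = w\<^sup>2" "\<And>x. cos (w * of_real x) = of_real (even_mode \<mu> x)"
    using real_square_root_complex by metis
  show ?thesis
    unfolding w(1) even_series_moments w(2) of_real_mult[symmetric] integral_complex_of_real ..
qed

lemma odd_series_moments_real: "odd_series (moments f) (of_real \<mu>) = of_real (LINT x|side_measure. f x * odd_mode \<mu> x)"
proof (cases "\<mu> = 0")
  case True
  then show ?thesis by (simp add: odd_series_0 odd_mode_def)
next
  case False
  obtain w :: complex where w: "of_real \<mu> = w\<^sup>2" "\<And>x. sin (w * of_real x) = w * of_real (odd_mode \<mu> x)" "w \<noteq> 0"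
    using real_square_root_complex False by metis
  have "w * odd_series (moments f) (w\<^sup>2) = (LINT x|side_measure. w * of_real (f x * odd_mode \<mu> x))"
    unfolding odd_series_moments w(2) by (simp add: mult_ac)
  also have "\<dots> = w * of_real (LINT x|side_measure. f x * odd_mode \<mu> x)"
    by (simp only: integral_mult_right_zero integral_complex_of_real)
  finally show ?thesis using w by simp
qed

text \<open>The transforms have exponential type \<open>pi/2\<close>, half the side length. This is
  exactly the growth of the characteristic functions, so that it cancels in the quotients.\<close>

private lemma transform_bound:
  assumes "\<And>z. cmod (g z) \<le> cosh (Im z)"
  shows "cmod (LINT x|side_measure. of_real (f x) * g (w * of_real x)) \<le> A * cosh (Im w * (pi/2))"
proof -
  have "cmod (LINT x|side_measure. of_real (f x) * g (w * of_real x)) \<le>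
      (LINT x|side_measure. cmod (of_real (f x) * g (w * of_real x)))"
    by (rule integral_norm_bound)
  also have "\<dots> \<le> (LINT x|side_measure. \<bar>f x\<bar> * cosh (Im w * (pi/2)))"
  proof (rule integral_mono')
    show "integrable side_measure (\<lambda>x. \<bar>f x\<bar> * cosh (Im w * (pi/2)))" using f by simp
    fix x assume "x \<in> space side_measure"
    then have "\<bar>x\<bar> \<le> pi/2" by (auto simp: space_restrict_space)
    then have "\<bar>Im w\<bar> * \<bar>x\<bar> \<le> \<bar>Im w\<bar> * (pi/2)" by (intro mult_left_mono) auto
    then have "cosh (\<bar>Im w\<bar> * \<bar>x\<bar>) \<le> cosh (\<bar>Im w\<bar> * (pi/2))"
      by (subst cosh_real_nonneg_le_iff) auto
    moreover have "cosh (\<bar>Im w\<bar> * \<bar>x\<bar>) = cosh (Im w * x)"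
      by (metis abs_mult cosh_real_abs)
    moreover have "cosh (\<bar>Im w\<bar> * (pi/2)) = cosh (Im w * (pi/2))"
      using cosh_real_abs[of "Im w * (pi/2)"] by (simp add: abs_mult)
    moreover have "cmod (g (w * of_real x)) \<le> cosh (Im w * x)"
      using assms[of "w * of_real x"] by simp
    ultimately have "cmod (g (w * of_real x)) \<le> cosh (Im w * (pi/2))" by linarith
    then show "cmod (of_real (f x) * g (w * of_real x)) \<le> \<bar>f x\<bar> * cosh (Im w * (pi/2))"
      unfolding norm_mult norm_of_real by (intro mult_left_mono) auto
    show "0 \<le> \<bar>f x\<bar> * cosh (Im w * (pi/2))" by simp
  qed
  finally show ?thesis using f by simp
qed

lemma even_series_moments_bound: "cmod (even_series (moments f) (w\<^sup>2)) \<le> A * cosh (Im w * (pi/2))"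
  unfolding even_series_moments by (rule transform_bound) (rule cmod_cos_le_cosh)

lemma odd_series_moments_bound: "cmod (w * odd_series (moments f) (w\<^sup>2)) \<le> A * cosh (Im w * (pi/2))"
  unfolding odd_series_moments by (rule transform_bound) (rule cmod_sin_le_cosh)

end

section \<open>Characteristic functions\<close>

text \<open>Up to sign, the expression X' - t X at the right end for the even mode, as an entire
  function of the eigenvalue parameter; \<open>odd_char\<close> is the same for the odd mode. By
  parity the left end yields the same condition.\<close>

definition even_char :: "real \<Rightarrow> complex \<Rightarrow> complex" where
  "even_char t z = z * odd_series (\<lambda>n. (pi/2) ^ n) z + of_real t * even_series (\<lambda>n. (pi/2) ^ n) z"

definition odd_char :: "real \<Rightarrow> complex \<Rightarrow> complex" where
  "odd_char t z = even_series (\<lambda>n. (pi/2) ^ n) z - of_real t * odd_series (\<lambda>n. (pi/2) ^ n) z"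

lemma powers_pi_bound: "\<bar>(pi/2) ^ n\<bar> \<le> 1 * (pi/2) ^ n" "(1::real) \<ge> 0" "(pi/2 :: real) \<ge> 0"
  by auto

lemma holomorphic_chars: "even_char t holomorphic_on S" "odd_char t holomorphic_on S"
  unfolding even_char_def[abs_def] odd_char_def[abs_def]
  by (intro holomorphic_intros even_series_holomorphic[OF powers_pi_bound] odd_series_holomorphic[OF powers_pi_bound])+

lemma even_char_square: "even_char t (w\<^sup>2) = w * sin (w * of_real (pi/2)) + of_real t * cos (w * of_real (pi/2))"
  unfolding even_char_def even_series_power odd_series_power[symmetric] by (simp add: power2_eq_square)

lemma odd_char_square: "w * odd_char t (w\<^sup>2) = w * cos (w * of_real (pi/2)) - of_real t * sin (w * of_real (pi/2))"
  unfolding odd_char_def even_series_power odd_series_power[symmetric] by (simp add: algebra_simps)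

lemma even_char_real: "even_char t (of_real \<mu>) = of_real (\<mu> * odd_mode \<mu> (pi/2) + t * even_mode \<mu> (pi/2))"
  unfolding even_char_def even_series_real odd_series_real by simp

lemma odd_char_real: "odd_char t (of_real \<mu>) = of_real (even_mode \<mu> (pi/2) - t * odd_mode \<mu> (pi/2))"
  unfolding odd_char_def even_series_real odd_series_real by simp

text \<open>With \<open>w = a + ib\<close> and \<open>L = pi/2\<close>, the imaginary part of the characteristic equation reads
  \<open>a sinh (bL) cosh (bL) = \<plusminus> b sin (aL) cos (aL)\<close>.\<close>

lemma real_or_imaginary_aux:
  fixes a b L :: real
  assumes "\<bar>a * (sinh (b * L) * cosh (b * L))\<bar> = \<bar>b * (sin (a * L) * cos (a * L))\<bar>" "L > 0"
  shows "a = 0 \<or> b = 0"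
proof (rule ccontr)
  assume "\<not> (a = 0 \<or> b = 0)"
  then have ab: "a \<noteq> 0" "b \<noteq> 0" by auto
  have "\<bar>a\<bar> * \<bar>b * L\<bar> < \<bar>a\<bar> * \<bar>sinh (b * L) * cosh (b * L)\<bar>"
    using ab assms(2) by (intro mult_strict_left_mono abs_sinh_cosh_gt) auto
  also have "\<dots> = \<bar>b\<bar> * \<bar>sin (a * L) * cos (a * L)\<bar>" using assms(1) by (simp only: abs_mult)
  also have "\<dots> < \<bar>b\<bar> * \<bar>a * L\<bar>"
    using ab assms(2) by (intro mult_strict_left_mono abs_sin_cos_less) auto
  finally show False by (simp add: abs_mult)
qed

lemma even_char_zero_real_or_imaginary:
  assumes "even_char t (w\<^sup>2) = 0"
  shows "Re w = 0 \<or> Im w = 0"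
proof (rule real_or_imaginary_aux[of "Re w" "Im w" "pi/2"])
  define a b S C h k where "a = Re w" "b = Im w" "S = sin (a * (pi/2))" "C = cos (a * (pi/2))"
    "h = sinh (b * (pi/2))" "k = cosh (b * (pi/2))"
  note d = this
  have id: "S\<^sup>2 + C\<^sup>2 = 1" "k\<^sup>2 = h\<^sup>2 + 1" unfolding d by (simp_all add: cosh_square_eq)
  have e: "w * sin (w * of_real (pi/2)) + of_real t * cos (w * of_real (pi/2)) = 0"
    using assms by (simp add: even_char_square)
  have "Re (w * sin (w * of_real (pi/2)) + of_real t * cos (w * of_real (pi/2))) = a * (S * k) - b * (C * h) + t * (C * k)"
    "Im (w * sin (w * of_real (pi/2)) + of_real t * cos (w * of_real (pi/2))) = a * (C * h) + b * (S * k) - t * (S * h)"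
    unfolding d by (simp_all add: Re_Im_sin_cos)
  then have "a * (S * k) - b * (C * h) + t * (C * k) = 0" "a * (C * h) + b * (S * k) - t * (S * h) = 0"
    unfolding e by simp_all
  \<comment> \<open>The weights \<open>S * h\<close> and \<open>C * k\<close> for the real and the
    imaginary part are chosen so that \<open>t\<close> drops out.\<close>
  then have "(a * (S * k) - b * (C * h) + t * (C * k)) * (S * h) + (a * (C * h) + b * (S * k) - t * (S * h)) * (C * k) = 0"
    by simp
  moreover have "(a * (S * k) - b * (C * h) + t * (C * k)) * (S * h) + (a * (C * h) + b * (S * k) - t * (S * h)) * (C * k)
    = a * (h * k) * (S\<^sup>2 + C\<^sup>2) + b * (S * C) * (k\<^sup>2 - h\<^sup>2)"
    by (simp add: algebra_simps power2_eq_square)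
  ultimately have "a * (h * k) = - (b * (S * C))" using id by simp
  then show "\<bar>Re w * (sinh (Im w * (pi/2)) * cosh (Im w * (pi/2)))\<bar> = \<bar>Im w * (sin (Re w * (pi/2)) * cos (Re w * (pi/2)))\<bar>"
    unfolding d by simp
qed simp

lemma odd_char_zero_real_or_imaginary:
  assumes "odd_char t (w\<^sup>2) = 0"
  shows "Re w = 0 \<or> Im w = 0"
proof (rule real_or_imaginary_aux[of "Re w" "Im w" "pi/2"])
  define a b S C h k where "a = Re w" "b = Im w" "S = sin (a * (pi/2))" "C = cos (a * (pi/2))"
    "h = sinh (b * (pi/2))" "k = cosh (b * (pi/2))"
  note d = this
  have id: "S\<^sup>2 + C\<^sup>2 = 1" "k\<^sup>2 = h\<^sup>2 + 1" unfolding d by (simp_all add: cosh_square_eq)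
  have e: "w * cos (w * of_real (pi/2)) - of_real t * sin (w * of_real (pi/2)) = 0"
    using assms odd_char_square[of w t] by simp
  have "Re (w * cos (w * of_real (pi/2)) - of_real t * sin (w * of_real (pi/2))) = a * (C * k) + b * (S * h) - t * (S * k)"
    "Im (w * cos (w * of_real (pi/2)) - of_real t * sin (w * of_real (pi/2))) = b * (C * k) - a * (S * h) - t * (C * h)"
    unfolding d by (simp_all add: Re_Im_sin_cos)
  then have "a * (C * k) + b * (S * h) - t * (S * k) = 0" "b * (C * k) - a * (S * h) - t * (C * h) = 0"
    unfolding e by simp_all
  then have "(a * (C * k) + b * (S * h) - t * (S * k)) * (C * h) - (b * (C * k) - a * (S * h) - t * (C * h)) * (S * k) = 0"
    by simp
  moreover have "(a * (C * k) + b * (S * h) - t * (S * k)) * (C * h) - (b * (C * k) - a * (S * h) - t * (C * h)) * (S * k)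
    = a * (h * k) * (S\<^sup>2 + C\<^sup>2) - b * (S * C) * (k\<^sup>2 - h\<^sup>2)"
    by (simp add: algebra_simps power2_eq_square)
  ultimately have "a * (h * k) = b * (S * C)" using id by simp
  then show "\<bar>Re w * (sinh (Im w * (pi/2)) * cosh (Im w * (pi/2)))\<bar> = \<bar>Im w * (sin (Re w * (pi/2)) * cos (Re w * (pi/2)))\<bar>"
    unfolding d by simp
qed simp

text \<open>The strict inequalities for \<open>sin x * cos x\<close> and
  \<open>sinh x * cosh x\<close> exclude equality up to sign. The two expressions are what is left
  of the derivatives of the characteristic functions at a zero.\<close>

lemma sin_cos_ne:
  assumes w: "Re w = 0 \<or> Im w = 0" "w \<noteq> 0" and L: "L > 0"
  shows "sin (w * of_real L) * cos (w * of_real L) + w * of_real L \<noteq> 0"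
    and "sin (w * of_real L) * cos (w * of_real L) - w * of_real L \<noteq> 0"
proof -
  have "sin (w * of_real L) * cos (w * of_real L) \<noteq> w * of_real L \<and> sin (w * of_real L) * cos (w * of_real L) \<noteq> - (w * of_real L)"
    using w(1)
  proof
    assume r: "Re w = 0"
    define y where "y = Im w * L"
    have y: "y \<noteq> 0" using w(2) r L by (auto simp: y_def complex_eq_iff)
    have "Im (sin (w * of_real L) * cos (w * of_real L)) = sinh y * cosh y"
      using r by (simp add: Re_Im_sin_cos y_def)
    moreover have "\<bar>Im (w * of_real L)\<bar> < \<bar>sinh y * cosh y\<bar>"
      using abs_sinh_cosh_gt[OF y] by (simp add: y_def)
    ultimately show ?thesis by (metis abs_minus_cancel less_irrefl uminus_complex.simps(2))
  next
    assume r: "Im w = 0"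
    define y where "y = Re w * L"
    have y: "y \<noteq> 0" using w(2) r L by (auto simp: y_def complex_eq_iff)
    have "Re (sin (w * of_real L) * cos (w * of_real L)) = sin y * cos y"
      using r by (simp add: Re_Im_sin_cos y_def)
    moreover have "\<bar>sin y * cos y\<bar> < \<bar>Re (w * of_real L)\<bar>"
      using abs_sin_cos_less[OF y] by (simp add: y_def)
    ultimately show ?thesis by (metis abs_minus_cancel less_irrefl uminus_complex.simps(1))
  qed
  then show "sin (w * of_real L) * cos (w * of_real L) + w * of_real L \<noteq> 0"
    "sin (w * of_real L) * cos (w * of_real L) - w * of_real L \<noteq> 0"
    by (auto simp: add_eq_0_iff2)
qed

text \<open>Differentiate along z = w^2, multiply by the cosine and remove \<open>t\<close> with the
  characteristic equation: what remains is nonzero by \<open>sin_cos_ne\<close>. At z = 0 the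
  substitution degenerates, and the derivative is read off the power series.\<close>

lemma even_char_simple:
  assumes z: "even_char t z = 0"
  shows "deriv (even_char t) z \<noteq> 0"
proof (cases "z = 0")
  case True
  have t: "t = 0" using z by (simp add: True even_char_def even_series_0)
  have "(even_char t has_field_derivative of_real (pi/2)) (at 0)"
    unfolding even_char_def[abs_def] t
    by (rule derivative_eq_intros odd_series_DERIV_0[OF powers_pi_bound]
          even_series_DERIV_0[OF powers_pi_bound] refl)+ (simp add: odd_series_0)
  then show ?thesis using True by (simp add: DERIV_imp_deriv)
next
  case False
  define w where "w = csqrt z"
  have w: "w\<^sup>2 = z" "w \<noteq> 0" using False by (auto simp: w_def)
  let ?L = "of_real (pi/2) :: complex"
  have "(even_char t has_field_derivative deriv (even_char t) (w\<^sup>2)) (at (w\<^sup>2))"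
    using holomorphic_derivI[OF holomorphic_chars(1)[of t UNIV]] by simp
  from DERIV_chain2[where g = "\<lambda>w. w\<^sup>2" and f = "even_char t" and x = w and Db = "2 * w", OF this]
  have 1: "((\<lambda>w. even_char t (w\<^sup>2)) has_field_derivative deriv (even_char t) (w\<^sup>2) * (2 * w)) (at w)"
    by this (auto intro!: derivative_eq_intros)
  have 2: "((\<lambda>w. even_char t (w\<^sup>2)) has_field_derivative
     (sin (w * ?L) + w * ?L * cos (w * ?L) - of_real t * ?L * sin (w * ?L))) (at w)"
    unfolding even_char_square by (auto intro!: derivative_eq_intros simp: algebra_simps)
  have e: "of_real t * cos (w * ?L) = - (w * sin (w * ?L))"
    using z w(1) even_char_square[of t w] by (simp add: add_eq_0_iff2)
  have "cos (w * ?L) * (sin (w * ?L) + w * ?L * cos (w * ?L) - of_real t * ?L * sin (w * ?L))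
     = sin (w * ?L) * cos (w * ?L) + w * ?L * (cos (w * ?L))\<^sup>2 - ?L * sin (w * ?L) * (of_real t * cos (w * ?L))"
    by (simp add: algebra_simps power2_eq_square)
  also have "\<dots> = sin (w * ?L) * cos (w * ?L) + w * ?L * ((sin (w * ?L))\<^sup>2 + (cos (w * ?L))\<^sup>2)"
  proof -
    have "s * c + w * l * c\<^sup>2 - l * s * (- (w * s)) = s * c + w * l * (s\<^sup>2 + c\<^sup>2)" for s c l :: complex
      by (simp add: algebra_simps power2_eq_square)
    then show ?thesis unfolding e .
  qed
  also have "\<dots> = sin (w * ?L) * cos (w * ?L) + w * ?L" by (simp only: sin_cos_squared_add mult_1_right)
  also have "\<dots> \<noteq> 0"
    using even_char_zero_real_or_imaginary[of t w] z w by (intro sin_cos_ne) auto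
  finally show ?thesis using DERIV_unique[OF 1 2] w(1) by auto
qed

lemma odd_char_simple:
  assumes z: "odd_char t z = 0"
  shows "deriv (odd_char t) z \<noteq> 0"
proof (cases "z = 0")
  case True
  \<comment> \<open>The value of the odd characteristic function at the origin is
    \<open>1 - t * (pi/2)\<close>.\<close>
  have t: "t * (pi/2) = 1"
  proof -
    have "complex_of_real (1 - t * (pi/2)) = 0"
      using z by (simp add: True odd_char_def even_series_0 odd_series_0)
    then show ?thesis by (simp only: of_real_eq_0_iff)
  qed
  let ?d = "cos_coeff 2 * (pi/2)\<^sup>2 - t * (sin_coeff 3 * (pi/2) ^ 3)"
  have "(odd_char t has_field_derivative of_real ?d) (at 0)"
    unfolding odd_char_def[abs_def]
    by (rule derivative_eq_intros even_series_DERIV_0[OF powers_pi_bound] odd_series_DERIV_0[OF powers_pi_bound] refl)+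
       simp
  moreover have "?d = - (pi/2)\<^sup>2 / 3"
  proof -
    have "?d = - (pi/2)\<^sup>2 / 2 + (t * (pi/2)) * (pi/2)\<^sup>2 / 6"
      by (simp add: cos_coeff_def sin_coeff_def fact_numeral power2_eq_square power3_eq_cube)
    then show ?thesis unfolding t by simp
  qed
  ultimately have "deriv (odd_char t) 0 = of_real (- (pi/2)\<^sup>2 / 3)" by (simp only: DERIV_imp_deriv)
  moreover have "- (pi/2)\<^sup>2 / 3 \<noteq> (0::real)" by simp
  ultimately show ?thesis using True by (metis of_real_eq_0_iff)
next
  case False
  define w where "w = csqrt z"
  have w: "w\<^sup>2 = z" "w \<noteq> 0" using False by (auto simp: w_def)
  let ?L = "of_real (pi/2) :: complex"
  have "(odd_char t has_field_derivative deriv (odd_char t) (w\<^sup>2)) (at (w\<^sup>2))"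
    using holomorphic_derivI[OF holomorphic_chars(2)[of t UNIV]] by simp
  from DERIV_chain2[where g = "\<lambda>w. w\<^sup>2" and f = "odd_char t" and x = w and Db = "2 * w", OF this]
  have "((\<lambda>w. odd_char t (w\<^sup>2)) has_field_derivative deriv (odd_char t) (w\<^sup>2) * (2 * w)) (at w)"
    by this (auto intro!: derivative_eq_intros)
  from DERIV_mult[OF DERIV_ident this]
  have 1: "((\<lambda>w. w * odd_char t (w\<^sup>2)) has_field_derivative w * (deriv (odd_char t) (w\<^sup>2) * (2 * w))) (at w)"
    using z w by (simp add: mult_ac)
  have 2: "((\<lambda>w. w * odd_char t (w\<^sup>2)) has_field_derivative
     (cos (w * ?L) - w * ?L * sin (w * ?L) - of_real t * ?L * cos (w * ?L))) (at w)"
    unfolding odd_char_square by (auto intro!: derivative_eq_intros simp: algebra_simps)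
  have e: "of_real t * sin (w * ?L) = w * cos (w * ?L)"
    using z w(1) odd_char_square[of w t] by simp
  have "sin (w * ?L) * (cos (w * ?L) - w * ?L * sin (w * ?L) - of_real t * ?L * cos (w * ?L))
     = sin (w * ?L) * cos (w * ?L) - w * ?L * (sin (w * ?L))\<^sup>2 - ?L * cos (w * ?L) * (of_real t * sin (w * ?L))"
    by (simp add: algebra_simps power2_eq_square)
  also have "\<dots> = sin (w * ?L) * cos (w * ?L) - w * ?L * ((sin (w * ?L))\<^sup>2 + (cos (w * ?L))\<^sup>2)"
  proof -
    have "s * c - w * l * s\<^sup>2 - l * c * (w * c) = s * c - w * l * (s\<^sup>2 + c\<^sup>2)" for s c l :: complex
      by (simp add: algebra_simps power2_eq_square)
    then show ?thesis unfolding e .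
  qed
  also have "\<dots> = sin (w * ?L) * cos (w * ?L) - w * ?L" by (simp only: sin_cos_squared_add mult_1_right)
  also have "\<dots> \<noteq> 0"
    using odd_char_zero_real_or_imaginary[of t w] z w by (intro sin_cos_ne) auto
  finally show ?thesis using DERIV_unique[OF 1 2] w(1) by auto
qed

text \<open>Lower bounds on squares with corners \<open>\<plusminus>R \<plusminus> iR\<close>, where \<open>R\<close> is odd for the even modes and
  even for the odd ones.\<close>

lemma char_lower_bound_aux:
  fixes w X Y :: complex
  assumes t: "t \<ge> 0" and R: "R > 2 * t + 1"
    and Y: "cmod Y \<le> cosh y"
    and X: "cmod X = cosh y \<or> \<bar>sinh y\<bar> \<le> cmod X \<and> 1 \<le> \<bar>y\<bar>" and w: "R \<le> cmod w"
  shows "(R / 2 - t) * cosh y \<le> cmod (w * X + of_real t * Y)" "(R / 2 - t) * cosh y \<le> cmod (w * X - of_real t * Y)"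
proof -
  have X': "cosh y / 2 \<le> cmod X"
    using X cosh_le_2_sinh[of y] cosh_real_pos[of y] by auto
  have "R * (cosh y / 2) \<le> cmod w * cmod X"
    using X' w R t by (intro mult_mono) auto
  moreover have "t * cmod Y \<le> t * cosh y" using Y t by (intro mult_left_mono) auto
  ultimately have "(R / 2 - t) * cosh y \<le> cmod (w * X) - cmod (of_real t * Y)"
    using t by (simp add: norm_mult algebra_simps)
  then show "(R / 2 - t) * cosh y \<le> cmod (w * X + of_real t * Y)" "(R / 2 - t) * cosh y \<le> cmod (w * X - of_real t * Y)"
    using norm_diff_ineq[of "w * X" "of_real t * Y"] norm_triangle_ineq2[of "w * X" "of_real t * Y"] by linarith+
qed

definition on_square :: "real \<Rightarrow> complex \<Rightarrow> bool" where
  "on_square R w \<longleftrightarrow> (\<bar>Re w\<bar> = R \<and> \<bar>Im w\<bar> \<le> R) \<or> (\<bar>Im w\<bar> = R \<and> \<bar>Re w\<bar> \<le> R)"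

lemma on_square_cmod: "on_square R w \<Longrightarrow> R \<le> cmod w"
  unfolding on_square_def using abs_Re_le_cmod[of w] abs_Im_le_cmod[of w] by auto

lemma even_char_lower_bound:
  assumes t: "t \<ge> 0" and R: "R = 2 * real n + 1" "R > 2 * t + 1" and w: "on_square R w"
  shows "(R / 2 - t) * cosh (Im w * (pi/2)) \<le> cmod (even_char t (w\<^sup>2))"
  unfolding even_char_square
proof (rule char_lower_bound_aux(1)[OF t R(2)])
  show "cmod (cos (w * of_real (pi/2))) \<le> cosh (Im w * (pi/2))"
    using cmod_cos_le_cosh[of "w * of_real (pi/2)"] by simp
  show "R \<le> cmod w" by (rule on_square_cmod[OF w])
  show "cmod (sin (w * of_real (pi/2))) = cosh (Im w * (pi/2)) \<or>
     \<bar>sinh (Im w * (pi/2))\<bar> \<le> cmod (sin (w * of_real (pi/2))) \<and> 1 \<le> \<bar>Im w * (pi/2)\<bar>"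
  \<comment> \<open>On the vertical sides the odd integer \<open>R\<close> annihilates the cosine of
    the real part, so the sine has modulus exactly cosh. On the horizontal sides the imaginary part
    is large enough for sinh alone to suffice.\<close>
  proof (cases "\<bar>Re w\<bar> = R")
    case True
    have "cos (\<bar>Re w\<bar> * (pi/2)) = 0" unfolding True R(1)
      by (rule cos_zero_iff[THEN iffD2]) (intro disjI1 exI[of _ "2 * n + 1"], simp)
    then have "cos (Re w * (pi/2)) = 0" by (cases "Re w \<ge> 0") auto
    then have "(sin (Re w * (pi/2)))\<^sup>2 = 1" by (simp add: sin_squared_eq)
    then have "(cmod (sin (w * of_real (pi/2))))\<^sup>2 = (cosh (Im w * (pi/2)))\<^sup>2"
      by (simp add: cmod_sin_squared cosh_square_eq)
    then show ?thesis by (auto simp: power2_eq_iff_nonneg)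
  next
    case False
    then have "\<bar>Im w\<bar> = R" using w by (auto simp: on_square_def)
    then have "1 * 1 \<le> \<bar>Im w\<bar> * (pi/2)" using R t pi_gt3 by (intro mult_mono) auto
    then show ?thesis using cmod_sin_ge[of "w * of_real (pi/2)"] by (simp add: abs_mult)
  qed
qed

lemma odd_char_lower_bound:
  assumes t: "t \<ge> 0" and R: "R = 2 * real n" "R > 2 * t + 1" and w: "on_square R w"
  shows "(R / 2 - t) * cosh (Im w * (pi/2)) \<le> cmod (w * odd_char t (w\<^sup>2))"
  unfolding odd_char_square
proof (rule char_lower_bound_aux(2)[OF t R(2)])
  show "cmod (sin (w * of_real (pi/2))) \<le> cosh (Im w * (pi/2))"
    using cmod_sin_le_cosh[of "w * of_real (pi/2)"] by simp
  show "R \<le> cmod w" by (rule on_square_cmod[OF w])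
  show "cmod (cos (w * of_real (pi/2))) = cosh (Im w * (pi/2)) \<or>
     \<bar>sinh (Im w * (pi/2))\<bar> \<le> cmod (cos (w * of_real (pi/2))) \<and> 1 \<le> \<bar>Im w * (pi/2)\<bar>"
  proof (cases "\<bar>Re w\<bar> = R")
    case True
    have "sin (\<bar>Re w\<bar> * (pi/2)) = 0" unfolding True R(1)
      by (rule sin_zero_iff[THEN iffD2]) (intro disjI1 exI[of _ "2 * n"], simp)
    then have "sin (Re w * (pi/2)) = 0" by (cases "Re w \<ge> 0") auto
    then have "(cos (Re w * (pi/2)))\<^sup>2 = 1" by (simp add: cos_squared_eq)
    then have "(cmod (cos (w * of_real (pi/2))))\<^sup>2 = (cosh (Im w * (pi/2)))\<^sup>2"
      by (simp add: cmod_cos_squared cosh_square_eq)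
    then show ?thesis by (auto simp: power2_eq_iff_nonneg)
  next
    case False
    then have "\<bar>Im w\<bar> = R" using w by (auto simp: on_square_def)
    then have "1 * 1 \<le> \<bar>Im w\<bar> * (pi/2)" using R t pi_gt3 by (intro mult_mono) auto
    then show ?thesis using cmod_cos_ge[of "w * of_real (pi/2)"] by (simp add: abs_mult)
  qed
qed

lemma quotient_bound:
  assumes "x * cosh y \<le> cmod c" "x > 0" "cmod (q * c) \<le> A * cosh (y::real)"
  shows "cmod q \<le> A / x"
proof -
  have "cmod q * (x * cosh y) \<le> A * cosh y"
    using order_trans[OF mult_left_mono[OF assms(1) norm_ge_zero] assms(3)[unfolded norm_mult]] .
  then have "(cmod q * x) * cosh y \<le> A * cosh y" by (simp add: mult_ac)
  then have "cmod q * x \<le> A" by (rule mult_right_le_imp_le) (rule cosh_real_pos)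
  then show ?thesis using assms(2) by (simp add: field_simps)
qed

section \<open>Completeness of the one-dimensional modes\<close>

text \<open>The parameter \<open>b\<close> is true for the odd mode, and \<open>t\<close> is minus the Robin parameter.\<close>

definition robin_root :: "real \<Rightarrow> bool \<Rightarrow> real \<Rightarrow> bool" where
  "robin_root t b \<mu> \<longleftrightarrow> (if b then even_mode \<mu> (pi/2) = t * odd_mode \<mu> (pi/2)
     else - \<mu> * odd_mode \<mu> (pi/2) = t * even_mode \<mu> (pi/2))"

definition mode :: "bool \<Rightarrow> real \<Rightarrow> real \<Rightarrow> real" where
  "mode b = (if b then odd_mode else even_mode)"

context
  fixes f :: "real \<Rightarrow> real" and t :: real
  assumes f: "integrable side_measure f" and t: "t \<ge> 0"
    and orth: "\<And>b \<mu>. robin_root t b \<mu> \<Longrightarrow> (LINT x|side_measure. f x * mode b \<mu> x) = 0"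
begin

private lemma real_of_zero:
  assumes "Re (csqrt z) = 0 \<or> Im (csqrt z) = 0"
  shows "z = of_real (Re z)"
proof -
  have "Im ((csqrt z)\<^sup>2) = 0" using assms unfolding Im_power2 by auto
  then have "Im z = 0" by simp
  then show ?thesis by (simp add: complex_eq_iff)
qed

private lemma even_series_zero: "even_series (moments f) z = 0"
proof -
  have "even_series (moments f) z = 0 \<and> deriv (even_char t) z \<noteq> 0" if z: "even_char t z = 0" for z
  proof -
    have "z = of_real (Re z)" using even_char_zero_real_or_imaginary[of t "csqrt z"] z
      by (intro real_of_zero) simp
    moreover from this have "robin_root t False (Re z)"
      using z even_char_real[of t "Re z"] by (auto simp: robin_root_def simp flip: of_real_mult of_real_add)
    ultimately have "even_series (moments f) z = 0"
      using even_series_moments_real[OF f, of "Re z"] orth[of False "Re z"] by (simp add: mode_def)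
    then show ?thesis using even_char_simple[OF z] by simp
  qed
  then obtain q where q: "q holomorphic_on UNIV" "\<And>z. even_series (moments f) z = q z * even_char t z"
    using entire_quotient[OF even_series_holomorphic[OF moment_bound[OF f]] holomorphic_chars(1)] by auto
  have "q z = 0" for z
  proof (rule entire_zero_of_square_bounds[OF q(1), of "\<lambda>n. 2 * real n + 1" t])
    show "filterlim (\<lambda>n. 2 * real n + 1) at_top sequentially" by real_asymp
    fix n w assume R: "2 * t + 1 < 2 * real n + 1" and w: "\<bar>Re w\<bar> = 2 * real n + 1 \<and> \<bar>Im w\<bar> \<le> 2 * real n + 1 \<or>
           \<bar>Im w\<bar> = 2 * real n + 1 \<and> \<bar>Re w\<bar> \<le> 2 * real n + 1"
    show "cmod (q (w\<^sup>2)) \<le> (LINT x|side_measure. \<bar>f x\<bar>) / ((2 * real n + 1) / 2 - t)"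
    proof (rule quotient_bound)
      show "((2 * real n + 1) / 2 - t) * cosh (Im w * (pi/2)) \<le> cmod (even_char t (w\<^sup>2))"
        by (rule even_char_lower_bound[OF t refl R]) (use w in \<open>simp add: on_square_def\<close>)
      show "cmod (q (w\<^sup>2) * even_char t (w\<^sup>2)) \<le> (LINT x|side_measure. \<bar>f x\<bar>) * cosh (Im w * (pi/2))"
        unfolding q(2)[symmetric] by (rule even_series_moments_bound[OF f])
    qed (use R in simp)
  qed
  then show ?thesis by (simp add: q(2))
qed

private lemma odd_series_zero: "odd_series (moments f) z = 0"
proof -
  have "odd_series (moments f) z = 0 \<and> deriv (odd_char t) z \<noteq> 0" if z: "odd_char t z = 0" for z
  proof -
    have "z = of_real (Re z)" using odd_char_zero_real_or_imaginary[of t "csqrt z"] z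
      by (intro real_of_zero) simp
    moreover from this have "robin_root t True (Re z)"
      using z odd_char_real[of t "Re z"] by (auto simp: robin_root_def simp flip: of_real_mult of_real_diff)
    ultimately have "odd_series (moments f) z = 0"
      using odd_series_moments_real[OF f, of "Re z"] orth[of True "Re z"] by (simp add: mode_def)
    then show ?thesis using odd_char_simple[OF z] by simp
  qed
  then obtain q where q: "q holomorphic_on UNIV" "\<And>z. odd_series (moments f) z = q z * odd_char t z"
    using entire_quotient[OF odd_series_holomorphic[OF moment_bound[OF f]] holomorphic_chars(2)] by auto
  have "q z = 0" for z
  proof (rule entire_zero_of_square_bounds[OF q(1), of "\<lambda>n. 2 * real n" t])
    show "filterlim (\<lambda>n. 2 * real n) at_top sequentially" by real_asymp
    fix n w assume R: "2 * t + 1 < 2 * real n" and w: "\<bar>Re w\<bar> = 2 * real n \<and> \<bar>Im w\<bar> \<le> 2 * real n \<or>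
           \<bar>Im w\<bar> = 2 * real n \<and> \<bar>Re w\<bar> \<le> 2 * real n"
    show "cmod (q (w\<^sup>2)) \<le> (LINT x|side_measure. \<bar>f x\<bar>) / ((2 * real n) / 2 - t)"
    proof (rule quotient_bound)
      show "((2 * real n) / 2 - t) * cosh (Im w * (pi/2)) \<le> cmod (w * odd_char t (w\<^sup>2))"
        by (rule odd_char_lower_bound[OF t refl R]) (use w in \<open>simp add: on_square_def\<close>)
      \<comment> \<open>The bounds on the odd transform and the odd characteristic function both
        carry a factor \<open>w\<close>, which cancels in the quotient.\<close>
      have "q (w\<^sup>2) * (w * odd_char t (w\<^sup>2)) = w * odd_series (moments f) (w\<^sup>2)" by (simp add: q(2))
      then show "cmod (q (w\<^sup>2) * (w * odd_char t (w\<^sup>2))) \<le> (LINT x|side_measure. \<bar>f x\<bar>) * cosh (Im w * (pi/2))"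
        using odd_series_moments_bound[OF f, of w] by (simp only:)
    qed (use R in simp)
  qed
  then show ?thesis by (simp add: q(2))
qed

lemma moments_zero: "(LINT x|side_measure. f x * x ^ n) = 0"
proof (cases "even n")
  case True
  then obtain k where "n = 2 * k" by (auto elim: evenE)
  then show ?thesis
    using even_series_eq_0_imp[OF moment_bound[OF f] _ _ even_series_zero, of k] by simp
next
  case False
  then obtain k where "n = 2 * k + 1" by (auto elim: oddE)
  then show ?thesis
    using odd_series_eq_0_imp[OF moment_bound[OF f] _ _ odd_series_zero, of k] by simp
qed

end

text \<open>Weierstrass approximation extends orthogonality from monomials to continuous functions,
  and cutoffs extend it to indicators of intervals.\<close>

lemma AE_zero_of_moments:
  assumes f: "integrable side_measure f" and m: "\<And>n. (LINT x|side_measure. f x * x ^ n) = 0"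
  shows "AE x in side_measure. f x = 0"
proof -
  define D where "D = (\<lambda>x. indicator {- (pi/2)<..<pi/2} x * f x)"
  have D: "integrable lborel D"
    using f by (subst (asm) integrable_restrict_space) (auto simp: D_def)
  have fm: "f \<in> borel_measurable side_measure" using f by simp
  have int: "integrable side_measure (\<lambda>x. f x * g x)" if "continuous_on {- (pi/2)..pi/2} g"
     "g \<in> borel_measurable borel" for g :: "real \<Rightarrow> real"
  proof -
    have "compact (g ` {- (pi/2)..pi/2})" by (intro compact_continuous_image that) auto
    then obtain B where B: "\<And>x. x \<in> {- (pi/2)..pi/2} \<Longrightarrow> norm (g x) \<le> B"
      using compact_imp_bounded bounded_iff by (metis imageI)
    have "integrable side_measure (\<lambda>x. B * \<bar>f x\<bar>)" using f by simp
    moreover have "(\<lambda>x. f x * g x) \<in> borel_measurable side_measure"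
      by (intro borel_measurable_times fm measurable_restrict_space1) (simp add: that)
    moreover have "AE x in side_measure. norm (f x * g x) \<le> norm (B * \<bar>f x\<bar>)"
    proof (rule AE_I2)
      fix x assume "x \<in> space side_measure"
      then have x: "\<bar>g x\<bar> \<le> B" using B[of x] by (auto simp: space_restrict_space)
      then have "\<bar>f x\<bar> * \<bar>g x\<bar> \<le> \<bar>f x\<bar> * B" by (intro mult_left_mono) auto
      also have "\<dots> \<le> \<bar>B * \<bar>f x\<bar>\<bar>" by (simp add: mult.commute)
      finally show "norm (f x * g x) \<le> norm (B * \<bar>f x\<bar>)" by (simp add: abs_mult)
    qed
    ultimately show ?thesis by (rule Bochner_Integration.integrable_bound)
  qed
  have poly: "(LINT x|side_measure. f x * g x) = 0" if g: "continuous_on UNIV g" for g :: "real \<Rightarrow> real"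
  proof -
    let ?A = "LINT x|side_measure. \<bar>f x\<bar>"
    have gm: "g \<in> borel_measurable borel" by (rule borel_measurable_continuous_onI[OF g])
    have "\<bar>LINT x|side_measure. f x * g x\<bar> \<le> 0 + e" if e: "e > 0" for e
    proof -
      \<comment> \<open>Adding 1 to the integral of \<open>\<bar>f x\<bar>\<close> avoids a division
        by zero.\<close>
      define e' where "e' = e / (?A + 1)"
      have *: "e / (A + 1) > 0 \<and> e / (A + 1) * A \<le> e" if "A \<ge> 0" for A
        using e that by (simp add: field_simps)
      have e': "e' > 0" "e' * ?A \<le> e" using *[of ?A] by (simp_all add: e'_def)
      obtain p where p: "real_polynomial_function p" "\<And>x. x \<in> {- (pi/2)..pi/2} \<Longrightarrow> \<bar>g x - p x\<bar> < e'"
        using Stone_Weierstrass_real_polynomial_function[of "{- (pi/2)..pi/2}" g e'] e'(1) continuous_on_subset[OF g]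
        by (metis compact_Icc top_greatest)
      obtain a N where a: "p = (\<lambda>x. \<Sum>i\<le>N::nat. a i * x ^ i)"
        using p(1) unfolding real_polynomial_function_iff_sum by blast
      have pc: "continuous_on A p" for A unfolding a by (intro continuous_intros)
      have pm: "p \<in> borel_measurable borel" by (rule borel_measurable_continuous_onI[OF pc])
      have ipow: "integrable side_measure (\<lambda>x. f x * x ^ i)" for i
        by (rule int) (auto intro!: continuous_intros)
      have "(LINT x|side_measure. f x * p x) = (LINT x|side_measure. (\<Sum>i\<le>N. a i * (f x * x ^ i)))"
        by (simp add: a sum_distrib_left mult_ac)
      also have "\<dots> = (\<Sum>i\<le>N. a i * (LINT x|side_measure. f x * x ^ i))"
        by (subst Bochner_Integration.integral_sum) (simp_all add: ipow)
      also have "\<dots> = 0" by (simp add: m)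
      finally have p0: "(LINT x|side_measure. f x * p x) = 0" .
      have "(LINT x|side_measure. f x * g x) = (LINT x|side_measure. f x * g x) - (LINT x|side_measure. f x * p x)"
        using p0 by simp
      also have "\<dots> = (LINT x|side_measure. f x * g x - f x * p x)"
        by (intro Bochner_Integration.integral_diff[symmetric] int continuous_on_subset[OF g] gm pc pm) simp
      also have "\<bar>\<dots>\<bar> \<le> (LINT x|side_measure. \<bar>f x * g x - f x * p x\<bar>)"
        using integral_norm_bound[of side_measure "\<lambda>x. f x * g x - f x * p x"] by simp
      also have "\<dots> \<le> (LINT x|side_measure. e' * \<bar>f x\<bar>)"
      proof (rule integral_mono')
        show "integrable side_measure (\<lambda>x. e' * \<bar>f x\<bar>)" using f by simp
        fix x assume "x \<in> space side_measure"
        then have "\<bar>g x - p x\<bar> \<le> e'" using p(2)[of x] by (auto simp: space_restrict_space)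
        then have "\<bar>f x\<bar> * \<bar>g x - p x\<bar> \<le> \<bar>f x\<bar> * e'" by (intro mult_left_mono) auto
        then show "\<bar>f x * g x - f x * p x\<bar> \<le> e' * \<bar>f x\<bar>"
          by (simp add: abs_mult mult.commute flip: right_diff_distrib)
        show "0 \<le> e' * \<bar>f x\<bar>" using e' by simp
      qed
      also have "\<dots> = e' * ?A" by simp
      finally show ?thesis using e' by simp
    qed
    then have "\<bar>LINT x|side_measure. f x * g x\<bar> \<le> 0" by (rule field_le_epsilon)
    then show ?thesis by simp
  qed
  have "AE x in lborel. D x = 0"
  proof (rule set_integral_zero_of_boxes[OF D, of "- (pi/2)" "pi/2"])
    show "D x = 0" if "x \<notin> box (- (pi/2)) (pi/2)" for x using that by (auto simp: D_def)
    fix a b :: real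
    have "set_lebesgue_integral lborel (box a b) D = (LINT x|side_measure. indicator {a<..<b} x * f x)"
      unfolding set_lebesgue_integral_def
      by (subst integral_restrict_space)
         (auto simp: D_def indicator_def intro!: Bochner_Integration.integral_cong)
    also have "\<dots> = 0"
    proof (cases "a < b")
      case True
      have c: "continuous_on UNIV (cutoff a b n)" for n
        by (meson DERIV_continuous cutoff_deriv continuous_at_imp_continuous_on)
      have "(\<lambda>n. LINT x|side_measure. cutoff a b n x * f x) \<longlonglongrightarrow> (LINT x|side_measure. indicator {a<..<b} x * f x)"
      proof (rule integral_dominated_convergence[where w = "\<lambda>x. norm (f x)"])
        show "(\<lambda>x. indicator {a<..<b} x * f x) \<in> borel_measurable side_measure"
          by (intro borel_measurable_times fm measurable_restrict_space1) simp
        show "(\<lambda>x. cutoff a b n x * f x) \<in> borel_measurable side_measure" for n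
          by (intro borel_measurable_times fm measurable_restrict_space1)
             (simp add: borel_measurable_continuous_onI[OF c])
        show "integrable side_measure (\<lambda>x. norm (f x))" using f by simp
        show "AE x in side_measure. (\<lambda>n. cutoff a b n x * f x) \<longlonglongrightarrow> indicator {a<..<b} x * f x"
          by (rule AE_I2) (intro tendsto_mult tendsto_const cutoff_tendsto True)
        show "AE x in side_measure. norm (cutoff a b n x * f x) \<le> norm (f x)" for n
          by (rule AE_I2) (simp add: abs_mult cutoff_range mult_left_le_one_le)
      qed
      moreover have "(LINT x|side_measure. cutoff a b n x * f x) = 0" for n
        using poly[OF c] by (simp add: mult.commute)
      ultimately show ?thesis by (simp add: LIMSEQ_const_iff)
    qed simp
    finally show "set_lebesgue_integral lborel (box a b) D = 0" .
  qed
  then show ?thesis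
    by (subst AE_restrict_space_iff) (auto simp: D_def elim!: eventually_mono)
qed

theorem modes_complete:
  assumes "integrable side_measure f" "t \<ge> 0"
    and "\<And>b \<mu>. robin_root t b \<mu> \<Longrightarrow> (LINT x|side_measure. f x * mode b \<mu> x) = 0"
  shows "AE x in side_measure. f x = 0"
  using AE_zero_of_moments[OF assms(1) moments_zero[OF assms]] by simp

section \<open>Eigenvalues of the square\<close>

text \<open>More vectors than coordinates are dependent, by Gaussian elimination of the last
  coordinate with the pivot \<open>j0\<close>. It serves to show that the multiplicity of an
  eigenvalue is unique.\<close>

lemma nontrivial_linear_relation:
  fixes a :: "'a \<Rightarrow> nat \<Rightarrow> real"
  assumes "finite J" "n < card J"
  shows "\<exists>d. (\<exists>j\<in>J. d j \<noteq> 0) \<and> (\<forall>i<n. (\<Sum>j\<in>J. d j * a j i) = 0)"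
  using assms
proof (induction n arbitrary: J a)
  case 0
  then obtain j where "j \<in> J" by (metis card.empty equals0I less_irrefl)
  then show ?case by (intro exI[of _ "\<lambda>_. 1"]) auto
next
  case (Suc n)
  show ?case
  proof (cases "\<forall>j\<in>J. a j n = 0")
    case True
    obtain d where d: "\<exists>j\<in>J. d j \<noteq> 0" "\<forall>i<n. (\<Sum>j\<in>J. d j * a j i) = 0"
      using Suc.IH[of J a] Suc.prems by auto
    moreover have "(\<Sum>j\<in>J. d j * a j n) = 0" using True by simp
    ultimately show ?thesis by (intro exI[of _ d]) (auto simp: less_Suc_eq)
  next
    case False
    then obtain j0 where j0: "j0 \<in> J" "a j0 n \<noteq> 0" by auto
    define J' where "J' = J - {j0}"
    have J': "finite J'" "n < card J'" "J = insert j0 J'" "j0 \<notin> J'"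
      using Suc.prems j0 by (auto simp: J'_def)
    define b where "b = (\<lambda>j i. a j i - a j n / a j0 n * a j0 i)"
    obtain d where d: "\<exists>j\<in>J'. d j \<noteq> 0" "\<forall>i<n. (\<Sum>j\<in>J'. d j * b j i) = 0"
      using Suc.IH[OF J'(1,2), of b] by auto
    define D where "D = - (\<Sum>j\<in>J'. d j * a j n) / a j0 n"
    define e where "e = d(j0 := D)"
    have sum: "(\<Sum>j\<in>J. e j * a j i) = D * a j0 i + (\<Sum>j\<in>J'. d j * a j i)" for i
    proof -
      have "(\<Sum>j\<in>J'. e j * a j i) = (\<Sum>j\<in>J'. d j * a j i)"
        by (rule sum.cong) (use J'(4) in \<open>auto simp: e_def\<close>)
      then show ?thesis using J' by (simp add: e_def)
    qed
    have "(\<Sum>j\<in>J. e j * a j i) = 0" if "i < Suc n" for i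
    proof (cases "i = n")
      case True
      then show ?thesis using j0 sum[of n] by (simp add: D_def)
    next
      case False
      then have "(\<Sum>j\<in>J'. d j * b j i) = 0" using d(2) that by auto
      moreover have "(\<Sum>j\<in>J'. d j * b j i) = (\<Sum>j\<in>J'. d j * a j i) - (\<Sum>j\<in>J'. d j * a j n) / a j0 n * a j0 i"
      proof -
        have "d j * b j i = d j * a j i - d j * a j n * (a j0 i / a j0 n)" for j
          by (simp add: b_def algebra_simps)
        then have "(\<Sum>j\<in>J'. d j * b j i) = (\<Sum>j\<in>J'. d j * a j i) - (\<Sum>j\<in>J'. d j * a j n) * (a j0 i / a j0 n)"
          by (simp only: sum_subtractf sum_distrib_right)
        then show ?thesis by simp
      qed
      ultimately show ?thesis using sum[of i] by (simp add: D_def)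
    qed
    moreover have "\<exists>j\<in>J. e j \<noteq> 0" using d(1) J' by (auto simp: e_def)
    ultimately show ?thesis by (intro exI[of _ e]) auto
  qed
qed

lemma downward_closed_eq_atLeastAtMost:
  assumes "finite A" "A \<subseteq> {1..}" "\<And>i j :: nat. j \<in> A \<Longrightarrow> 1 \<le> i \<Longrightarrow> i \<le> j \<Longrightarrow> i \<in> A"
  shows "A = {1..card A}"
proof (cases "A = {}")
  case False
  have "A = {1..Max A}"
  proof (intro equalityI subsetI)
    fix x assume "x \<in> A" then show "x \<in> {1..Max A}" using assms(2) Max_ge[OF assms(1)] by auto
  next
    fix x assume "x \<in> {1..Max A}" then show "x \<in> A" using assms(3)[OF Max_in[OF assms(1) False], of x] by auto
  qed
  then show ?thesis by (metis card_atLeastAtMost diff_Suc_1)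
qed simp

context
  fixes P :: "'a set" and v :: "'a \<Rightarrow> real"
  assumes fin: "\<And>\<nu>. finite {x \<in> P. v x \<le> \<nu>}"
begin

private lemma fin_less: "finite {x \<in> P. v x < \<nu>}" and fin_eq: "finite {x \<in> P. v x = \<nu>}"
  by (rule finite_subset[OF _ fin[of \<nu>]]; auto)+

text \<open>By monotonicity the indices with \<open>l k \<le> \<nu>\<close> form an initial segment,
  whose length is the value of the counting function. Hence the prescribed counts determine the
  whole list.\<close>

lemma list_le_iff_count:
  assumes mono: "mono_on {1..} l"
    and l: "\<And>\<mu>. finite {k. 1 \<le> k \<and> l k = \<mu>}" "\<And>\<mu>. card {k. 1 \<le> k \<and> l k = \<mu>} = card {x \<in> P. v x = \<mu>}"
    and k: "1 \<le> (k::nat)"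
  shows "l k \<le> \<nu> \<longleftrightarrow> k \<le> card {x \<in> P. v x \<le> \<nu>}"
proof -
  define K where "K = v ` {x \<in> P. v x \<le> \<nu>}"
  have K: "finite K" using fin by (simp add: K_def)
  have "{k. 1 \<le> k \<and> l k \<le> \<nu>} = (\<Union>\<kappa>\<in>K. {k. 1 \<le> k \<and> l k = \<kappa>})" (is "?A = _")
  proof (intro equalityI subsetI)
    fix k assume "k \<in> {k. 1 \<le> k \<and> l k \<le> \<nu>}"
    then have k: "1 \<le> k" "l k \<le> \<nu>" by auto
    have "k \<in> {j. 1 \<le> j \<and> l j = l k}" using k by auto
    then have "card {j. 1 \<le> j \<and> l j = l k} \<noteq> 0" using l(1)[of "l k"] by (metis card_0_eq empty_iff)
    then have "card {x \<in> P. v x = l k} \<noteq> 0" by (simp only: l(2) not_False_eq_True)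
    then obtain x where "x \<in> P" "v x = l k" by (metis (mono_tags, lifting) card.empty empty_Collect_eq)
    then have "l k \<in> K" using k unfolding K_def by (intro image_eqI[of _ _ x]) auto
    then show "k \<in> (\<Union>\<kappa>\<in>K. {k. 1 \<le> k \<and> l k = \<kappa>})" using k by auto
  qed (auto simp: K_def)
  note A = this
  have finA: "finite ?A" unfolding A by (intro finite_UN_I K l(1))
  have "card ?A = (\<Sum>\<kappa>\<in>K. card {k. 1 \<le> k \<and> l k = \<kappa>})"
    unfolding A by (rule card_UN_disjoint) (use K l(1) in auto)
  also have "\<dots> = (\<Sum>\<kappa>\<in>K. card {x \<in> P. v x = \<kappa>})" by (simp only: l(2))
  also have "\<dots> = card (\<Union>\<kappa>\<in>K. {x \<in> P. v x = \<kappa>})"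
    by (rule card_UN_disjoint[symmetric]) (use K fin_eq in auto)
  also have "(\<Union>\<kappa>\<in>K. {x \<in> P. v x = \<kappa>}) = {x \<in> P. v x \<le> \<nu>}" by (auto simp: K_def)
  finally have c: "card ?A = card {x \<in> P. v x \<le> \<nu>}" .
  have "?A = {1..card ?A}"
  proof (rule downward_closed_eq_atLeastAtMost[OF finA])
    show "i \<in> ?A" if "j \<in> ?A" "1 \<le> i" "i \<le> j" for i j
    proof -
      have "l i \<le> l j" by (rule mono_onD[OF mono]) (use that in auto)
      then show ?thesis using that by auto
    qed
  qed auto
  then have "k \<in> ?A \<longleftrightarrow> k \<in> {1..card {x \<in> P. v x \<le> \<nu>}}" unfolding c by (rule arg_cong)
  then show ?thesis using k by simp
qed

text \<open>The k-th entry is the quantile of the counting function \<open>N\<close>: the infimum of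
  all \<open>\<nu>\<close> with \<open>k \<le> N \<nu>\<close>. The infimum is attained because only
  finitely many values lie below any bound, which makes \<open>N\<close> continuous from the
  right.\<close>

lemma ex_list_with_counts:
  assumes inf: "infinite P"
  shows "\<exists>l. mono_on {1..} l \<and> (\<forall>\<mu>. finite {k::nat. 1 \<le> k \<and> l k = \<mu>} \<and>
     card {k. 1 \<le> k \<and> l k = \<mu>} = card {x \<in> P. v x = \<mu>})"
proof -
  define N where "N = (\<lambda>\<nu>. card {x \<in> P. v x \<le> \<nu>})"
  have Nmono: "N \<nu> \<le> N \<nu>'" if "\<nu> \<le> \<nu>'" for \<nu> \<nu>'
    unfolding N_def by (rule card_mono[OF fin]) (use that in auto)
  define A where "A = (\<lambda>k. {\<nu>. k \<le> N \<nu>})"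
  define l where "l = (\<lambda>k. Inf (A k))"
  have A_ne: "A k \<noteq> {}" for k
  proof -
    obtain F where F: "F \<subseteq> P" "finite F" "card F = k" using inf infinite_arbitrarily_large by metis
    define \<nu> where "\<nu> = Max (insert 0 (v ` F))"
    have "v x \<le> \<nu>" if "x \<in> F" for x unfolding \<nu>_def using F that by (intro Max_ge) auto
    then have "F \<subseteq> {x \<in> P. v x \<le> \<nu>}" using F by auto
    then have "k \<le> N \<nu>" unfolding N_def using card_mono[OF fin] F(3) by metis
    then show ?thesis by (auto simp: A_def)
  qed
  have A_bdd: "bdd_below (A k)" if "1 \<le> k" for k
  proof -
    define m where "m = Min (insert 0 (v ` {x \<in> P. v x \<le> 0}))"
    have m: "m \<le> v x" if "x \<in> P" for x
    proof (cases "v x \<le> 0")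
      case True
      then show ?thesis unfolding m_def using that fin by (intro Min_le) auto
    next
      case False
      have "m \<le> 0" unfolding m_def using fin by (intro Min_le) auto
      then show ?thesis using False by simp
    qed
    have "m \<le> \<nu>" if "\<nu> \<in> A k" for \<nu>
    proof -
      have "N \<nu> \<noteq> 0" using that \<open>1 \<le> k\<close> by (auto simp: A_def)
      then have "{x \<in> P. v x \<le> \<nu>} \<noteq> {}" unfolding N_def by (metis card.empty)
      then show ?thesis using m by force
    qed
    then show ?thesis by (rule bdd_belowI)
  qed
  have k_le: "k \<le> N (l k)" if k: "1 \<le> k" for k
  proof -
    \<comment> \<open>The minimum of \<open>B\<close> is the next value of \<open>v\<close> above
      \<open>l k\<close>, or \<open>l k + 1\<close> if there is none up to there; the counting
      function is constant in between.\<close>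
    define B where "B = insert (l k + 1) (v ` {x \<in> P. v x \<le> l k + 1 \<and> l k < v x})"
    have "finite B" unfolding B_def
      by (intro finite.insertI finite_imageI finite_subset[OF _ fin[of "l k + 1"]]) auto
    then have "Min B \<in> B" by (intro Min_in) (auto simp: B_def)
    then have "l k < Min B" by (auto simp: B_def)
    then obtain \<nu> where \<nu>: "\<nu> \<in> A k" "\<nu> < Min B"
      using cInf_lessD[OF A_ne] unfolding l_def by blast
    have "{x \<in> P. v x \<le> \<nu>} \<subseteq> {x \<in> P. v x \<le> l k}"
    proof safe
      fix x assume x: "x \<in> P" "v x \<le> \<nu>"
      show "v x \<le> l k"
      proof (rule ccontr)
        assume "\<not> v x \<le> l k"
        moreover have "Min B \<le> l k + 1" using \<open>finite B\<close> by (intro Min_le) (auto simp: B_def)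
        ultimately have "v x \<in> B" using x \<nu>(2) by (auto simp: B_def)
        then have "Min B \<le> v x" using \<open>finite B\<close> by (intro Min_le)
        then show False using x \<nu>(2) by simp
      qed
    qed
    then have "N \<nu> \<le> N (l k)" unfolding N_def by (rule card_mono[OF fin])
    then show ?thesis using \<nu>(1) by (simp add: A_def)
  qed
  have le_iff: "l k \<le> \<nu> \<longleftrightarrow> k \<le> N \<nu>" if k: "1 \<le> k" for k \<nu>
  proof
    assume "l k \<le> \<nu>" then show "k \<le> N \<nu>" using k_le[OF k] Nmono le_trans by blast
  next
    assume "k \<le> N \<nu>" then show "l k \<le> \<nu>" unfolding l_def
      by (intro cInf_lower A_bdd[OF k]) (simp add: A_def)
  qed
  have less_iff: "l k < \<nu> \<longleftrightarrow> k \<le> card {x \<in> P. v x < \<nu>}" if k: "1 \<le> k" for k \<nu>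
  proof
    assume "l k < \<nu>"
    have "k \<le> N (l k)" by (rule k_le[OF k])
    also have "\<dots> \<le> card {x \<in> P. v x < \<nu>}" unfolding N_def
      by (rule card_mono[OF fin_less]) (use \<open>l k < \<nu>\<close> in auto)
    finally show "k \<le> card {x \<in> P. v x < \<nu>}" .
  next
    assume *: "k \<le> card {x \<in> P. v x < \<nu>}"
    let ?F = "v ` {x \<in> P. v x < \<nu>}"
    have "{x \<in> P. v x < \<nu>} \<noteq> {}" using * k by (metis card.empty not_one_le_zero le_trans)
    then have F: "finite ?F" "?F \<noteq> {}" using fin_less by auto
    have "{x \<in> P. v x < \<nu>} \<subseteq> {x \<in> P. v x \<le> Max ?F}" using Max_ge[OF F(1)] by auto
    from le_trans[OF * card_mono[OF fin this]] have "k \<le> N (Max ?F)" unfolding N_def .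
    then have "l k \<le> Max ?F" using le_iff[OF k] by simp
    also have "Max ?F < \<nu>" using Max_in[OF F] by auto
    finally show "l k < \<nu>" .
  qed
  have eq: "{k. 1 \<le> k \<and> l k = \<mu>} = {card {x \<in> P. v x < \<mu>}<..N \<mu>}" for \<mu>
  proof -
    have "k \<in> {k. 1 \<le> k \<and> l k = \<mu>} \<longleftrightarrow> k \<in> {card {x \<in> P. v x < \<mu>}<..N \<mu>}" for k
    proof (cases "1 \<le> k")
      case True
      have "l k = \<mu> \<longleftrightarrow> l k \<le> \<mu> \<and> \<not> l k < \<mu>" by auto
      then show ?thesis using le_iff[OF True, of \<mu>] less_iff[OF True, of \<mu>] True by auto
    qed auto
    then show ?thesis by blast
  qed
  have card: "card {k. 1 \<le> k \<and> l k = \<mu>} = card {x \<in> P. v x = \<mu>}" for \<mu>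
  proof -
    have "{x \<in> P. v x \<le> \<mu>} = {x \<in> P. v x < \<mu>} \<union> {x \<in> P. v x = \<mu>}" by auto
    then have "N \<mu> = card {x \<in> P. v x < \<mu>} + card {x \<in> P. v x = \<mu>}"
      unfolding N_def by (simp add: card_Un_disjoint fin_less fin_eq disjoint_iff)
    then show ?thesis unfolding eq by simp
  qed
  have "mono_on {1..} l"
  proof (rule mono_onI)
    fix r s :: nat assume "r \<in> {1..}" "s \<in> {1..}" "r \<le> s"
    then show "l r \<le> l s" using le_iff[of r "l s"] k_le[of s] by auto
  qed
  then show ?thesis using card eq by (intro exI[of _ l]) auto
qed

end

section \<open>Differential equation, orthogonality and norm of the modes\<close>

definition dmode :: "bool \<Rightarrow> real \<Rightarrow> real \<Rightarrow> real" where
  "dmode b \<mu> x = (if b then even_mode \<mu> x else - \<mu> * odd_mode \<mu> x)"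

lemma even_mode_deriv: "(even_mode \<mu> has_real_derivative - \<mu> * odd_mode \<mu> x) (at x)"
proof -
  consider "\<mu> > 0" | "\<mu> = 0" | "\<mu> < 0" by linarith
  then show ?thesis
  proof cases
    case 1
    then have *: "even_mode \<mu> = (\<lambda>x. cos (sqrt \<mu> * x))" "odd_mode \<mu> x = sin (sqrt \<mu> * x) / sqrt \<mu>"
      by (auto simp: even_mode_def odd_mode_def)
    have "\<mu> / sqrt \<mu> = sqrt \<mu>" using 1 by (simp add: real_div_sqrt)
    then have "\<mu> * (sin (sqrt \<mu> * x) / sqrt \<mu>) = sin (sqrt \<mu> * x) * sqrt \<mu>"
      by (metis mult.commute times_divide_eq_left times_divide_eq_right)
    then have "- \<mu> * (sin (sqrt \<mu> * x) / sqrt \<mu>) = - sin (sqrt \<mu> * x) * sqrt \<mu>" by simp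
    then show ?thesis unfolding * by (auto intro!: derivative_eq_intros)
  next
    case 2
    then show ?thesis by (simp add: even_mode_def[abs_def])
  next
    case 3
    then have *: "even_mode \<mu> = (\<lambda>x. cosh (sqrt (- \<mu>) * x))" "odd_mode \<mu> x = sinh (sqrt (- \<mu>) * x) / sqrt (- \<mu>)"
      by (auto simp: even_mode_def odd_mode_def)
    have "- \<mu> / sqrt (- \<mu>) = sqrt (- \<mu>)" using 3 by (intro real_div_sqrt) simp
    then have "- \<mu> * (sinh (sqrt (- \<mu>) * x) / sqrt (- \<mu>)) = sinh (sqrt (- \<mu>) * x) * sqrt (- \<mu>)"
      by (metis mult.commute times_divide_eq_left times_divide_eq_right)
    then show ?thesis unfolding * by (auto intro!: derivative_eq_intros)
  qed
qed

lemma odd_mode_deriv: "(odd_mode \<mu> has_real_derivative even_mode \<mu> x) (at x)"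
proof -
  consider "\<mu> > 0" | "\<mu> = 0" | "\<mu> < 0" by linarith
  then show ?thesis
  proof cases
    case 1
    then have *: "odd_mode \<mu> = (\<lambda>x. sin (sqrt \<mu> * x) / sqrt \<mu>)" "even_mode \<mu> x = cos (sqrt \<mu> * x)"
      by (auto simp: even_mode_def odd_mode_def)
    have "((\<lambda>x. sin (sqrt \<mu> * x) / sqrt \<mu>) has_real_derivative (cos (sqrt \<mu> * x) * sqrt \<mu>) / sqrt \<mu>) (at x)"
      by (intro DERIV_cdivide) (auto intro!: derivative_eq_intros)
    then show ?thesis unfolding * using 1 by simp
  next
    case 2
    then show ?thesis by (simp add: even_mode_def odd_mode_def[abs_def])
  next
    case 3
    then have *: "odd_mode \<mu> = (\<lambda>x. sinh (sqrt (- \<mu>) * x) / sqrt (- \<mu>))" "even_mode \<mu> x = cosh (sqrt (- \<mu>) * x)"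
      by (auto simp: even_mode_def odd_mode_def)
    have "((\<lambda>x. sinh (sqrt (- \<mu>) * x) / sqrt (- \<mu>)) has_real_derivative (cosh (sqrt (- \<mu>) * x) * sqrt (- \<mu>)) / sqrt (- \<mu>)) (at x)"
      by (intro DERIV_cdivide) (auto intro!: derivative_eq_intros)
    then show ?thesis unfolding * using 3 by simp
  qed
qed

lemma mode_deriv: "(mode b \<mu> has_real_derivative dmode b \<mu> x) (at x)"
  and dmode_deriv: "(dmode b \<mu> has_real_derivative - \<mu> * mode b \<mu> x) (at x)"
proof -
  show "(mode b \<mu> has_real_derivative dmode b \<mu> x) (at x)"
    using even_mode_deriv odd_mode_deriv by (cases b) (auto simp: mode_def dmode_def)
  have d: "dmode True \<mu> = even_mode \<mu>" "dmode False \<mu> = (\<lambda>x. - \<mu> * odd_mode \<mu> x)"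
    by (auto simp: dmode_def fun_eq_iff)
  show "(dmode b \<mu> has_real_derivative - \<mu> * mode b \<mu> x) (at x)"
  proof (cases b)
    case True
    then show ?thesis using even_mode_deriv by (simp add: d mode_def)
  next
    case False
    show ?thesis using DERIV_cmult[OF odd_mode_deriv, of "- \<mu>"] False by (simp add: d mode_def)
  qed
qed

lemma mode_minus: "even_mode \<mu> (- x) = even_mode \<mu> x" "odd_mode \<mu> (- x) = - odd_mode \<mu> x"
  by (auto simp: even_mode_def odd_mode_def)

lemma robin_mode_mode: "robin_root t b \<mu> \<Longrightarrow> robin_mode t \<mu> (mode b \<mu>) (dmode b \<mu>)"
  unfolding robin_mode_def
  by (intro conjI allI mode_deriv dmode_deriv)
     (cases b; simp add: mode_def dmode_def robin_root_def mode_minus)+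

lemma continuous_on_mode: "continuous_on A (mode b \<mu>)"
  by (meson DERIV_continuous mode_deriv continuous_at_imp_continuous_on)

lemma integrable_modes: "integrable side_measure (\<lambda>x. mode b \<mu> x * mode c \<nu> x)"
  by (intro integrable_side_continuous continuous_intros continuous_on_mode)

text \<open>For different eigenvalues the integrand is a multiple of the derivative of the
  Wronskian, which vanishes at both ends. For equal eigenvalues the parities differ, and the product
  is the derivative of half the squared odd mode, whose end values coincide.\<close>

lemma mode_orthogonal:
  assumes "robin_root t b \<mu>" "robin_root t c \<nu>" "(b, \<mu>) \<noteq> (c, \<nu>)"
  shows "(LINT x|side_measure. mode b \<mu> x * mode c \<nu> x) = 0"
proof (cases "\<mu> = \<nu>")
  case False
  note X = robin_modeD[OF robin_mode_mode[OF assms(1)]] and Y = robin_modeD[OF robin_mode_mode[OF assms(2)]]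
  have "(LINT x|side_measure. (\<nu> - \<mu>) * (mode b \<mu> x * mode c \<nu> x)) =
    (\<lambda>x. dmode b \<mu> x * mode c \<nu> x - mode b \<mu> x * dmode c \<nu> x) (pi/2) -
    (\<lambda>x. dmode b \<mu> x * mode c \<nu> x - mode b \<mu> x * dmode c \<nu> x) (- (pi/2))"
  proof (rule integral_side_FTC)
    show "continuous_on UNIV (\<lambda>x. (\<nu> - \<mu>) * (mode b \<mu> x * mode c \<nu> x))"
      by (intro continuous_intros continuous_on_mode)
    show "((\<lambda>x. dmode b \<mu> x * mode c \<nu> x - mode b \<mu> x * dmode c \<nu> x) has_real_derivative
       (\<nu> - \<mu>) * (mode b \<mu> x * mode c \<nu> x)) (at x)" for x
      by (rule derivative_eq_intros mode_deriv dmode_deriv refl)+ (simp add: algebra_simps)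
  qed
  also have "\<dots> = 0" by (simp add: X Y)
  finally show ?thesis using False by simp
next
  case True
  have eo: "(LINT x|side_measure. even_mode \<mu> x * odd_mode \<mu> x) = 0"
  proof -
    have "(LINT x|side_measure. even_mode \<mu> x * odd_mode \<mu> x) =
       (odd_mode \<mu> (pi/2))\<^sup>2 / 2 - (odd_mode \<mu> (- (pi/2)))\<^sup>2 / 2"
    proof (rule integral_side_FTC)
      show "continuous_on UNIV (\<lambda>x. even_mode \<mu> x * odd_mode \<mu> x)"
        using continuous_on_mode[of UNIV True \<mu>] continuous_on_mode[of UNIV False \<mu>]
        by (auto simp: mode_def intro!: continuous_intros)
      show "((\<lambda>x. (odd_mode \<mu> x)\<^sup>2 / 2) has_real_derivative even_mode \<mu> x * odd_mode \<mu> x) (at x)" for x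
      proof -
        have "((\<lambda>x. (odd_mode \<mu> x)\<^sup>2) has_real_derivative 2 * (even_mode \<mu> x * odd_mode \<mu> x)) (at x)"
          by (rule derivative_eq_intros odd_mode_deriv refl)+ simp
        from DERIV_cdivide[OF this, of 2] show ?thesis by simp
      qed
    qed
    then show ?thesis by (simp add: mode_minus)
  qed
  show ?thesis using eo True assms(3) by (cases b; cases c) (auto simp: mode_def mult.commute)
qed

lemma AE_zero_open_continuous:
  fixes f :: "'a::euclidean_space \<Rightarrow> real"
  assumes "open S" "continuous_on S f" "AE x in restrict_space lborel S. f x = 0" "x \<in> S"
  shows "f x = 0"
proof (rule ccontr)
  assume "f x \<noteq> 0"
  have "open (S \<inter> f -` (- {0}))" using continuous_open_preimage[OF assms(2,1)] by auto
  moreover have "x \<in> S \<inter> f -` (- {0})" using \<open>f x \<noteq> 0\<close> assms(4) by auto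
  moreover have "AE x in lborel. x \<notin> S \<inter> f -` (- {0})"
    using assms(3) assms(1) by (subst (asm) AE_restrict_space_iff) (auto elim!: eventually_mono)
  then have "S \<inter> f -` (- {0}) \<in> null_sets lborel"
    using \<open>open (S \<inter> f -` (- {0}))\<close> by (subst AE_iff_null_sets) auto
  then have "negligible (S \<inter> f -` (- {0}))"
    unfolding negligible_iff_null_sets by (rule null_sets_completionI)
  ultimately show False using open_not_negligible by blast
qed

text \<open>Otherwise the mode and its derivative would both vanish at the origin, against the
  initial values.\<close>

lemma mode_norm_pos: "(LINT x|side_measure. mode b \<mu> x * mode b \<mu> x) > 0"
proof -
  let ?J = "{- (pi/2)<..<pi/2} :: real set"
  have "(LINT x|side_measure. mode b \<mu> x * mode b \<mu> x) \<noteq> 0"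
  proof
    assume "(LINT x|side_measure. mode b \<mu> x * mode b \<mu> x) = 0"
    then have "AE x in side_measure. mode b \<mu> x * mode b \<mu> x = 0"
      by (subst (asm) integral_nonneg_eq_0_iff_AE) (auto intro: integrable_modes)
    then have "mode b \<mu> x * mode b \<mu> x = 0" if "x \<in> ?J" for x
      using that by (intro AE_zero_open_continuous[of ?J "\<lambda>x. mode b \<mu> x * mode b \<mu> x"] continuous_intros continuous_on_mode) auto
    then have z: "mode b \<mu> x = 0" if "x \<in> ?J" for x using that by auto
    have "((\<lambda>x. 0) has_real_derivative dmode b \<mu> 0) (at 0)"
      by (rule has_field_derivative_transform_within_open[OF mode_deriv, where S = ?J]) (auto simp: z)
    then have "dmode b \<mu> 0 = 0" using DERIV_const DERIV_unique by blast
    moreover have "mode b \<mu> 0 = 0" by (rule z) simp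
    ultimately show False by (cases b) (auto simp: mode_def dmode_def even_mode_def split: if_splits)
  qed
  moreover have "(LINT x|side_measure. mode b \<mu> x * mode b \<mu> x) \<ge> 0" by simp
  ultimately show ?thesis by linarith
qed

section \<open>Products of modes\<close>

type_synonym mode_index = "bool \<times> real"

definition roots :: "real \<Rightarrow> mode_index set" where
  "roots t = {p. robin_root t (fst p) (snd p)}"

definition product_mode :: "mode_index \<times> mode_index \<Rightarrow> real \<times> real \<Rightarrow> real" where
  "product_mode p = tensor (mode (fst (fst p)) (snd (fst p))) (mode (fst (snd p)) (snd (snd p)))"

definition product_value :: "mode_index \<times> mode_index \<Rightarrow> real" where
  "product_value p = snd (fst p) + snd (snd p)"

lemma continuous_on_product_mode: "continuous_on A (product_mode p)"
  unfolding product_mode_def by (intro continuous_on_tensor continuous_on_mode)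

lemma product_mode_solution:
  assumes "p \<in> roots t \<times> roots t"
  shows "robin_solution (- t) (product_value p) (product_mode p)"
  using assms unfolding product_mode_def product_value_def
  by (intro robin_solution_mode[OF robin_mode_mode robin_mode_mode]) (auto simp: roots_def)

lemma solution_orthogonal_product_mode:
  assumes "p \<in> roots t \<times> roots t" "robin_solution (- t) \<kappa> u" "\<kappa> \<noteq> product_value p"
  shows "(LINT x|area. u x * product_mode p x) = 0"
  using assms unfolding product_mode_def product_value_def
  by (intro robin_solution_orthogonal_mode[OF robin_mode_mode robin_mode_mode]) (auto simp: roots_def)

lemma integral_tensor_mult:
  assumes "continuous_on UNIV X" "continuous_on UNIV Y" "continuous_on UNIV Z" "continuous_on UNIV W"
  shows "(LINT x|area. tensor X Y x * tensor Z W x) =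
     (LINT x|side_measure. X x * Z x) * (LINT y|side_measure. Y y * W y)"
proof -
  have "(LINT x|area. tensor X Y x * tensor Z W x) =
     (LINT x|side_measure. LINT y|side_measure. (X x * Z x) * (Y y * W y))"
  proof (subst integral_area_fst)
    show "integrable area (\<lambda>x. tensor X Y x * tensor Z W x)"
      by (intro integrable_area_continuous continuous_on_mult continuous_on_tensor assms)
  qed (simp add: tensor_def mult_ac)
  also have "\<dots> = (LINT x|side_measure. X x * Z x) * (LINT y|side_measure. Y y * W y)"
    by (simp only: integral_mult_right_zero integral_mult_left_zero)
  finally show ?thesis .
qed

lemma product_mode_orthogonal:
  assumes "p \<in> roots t \<times> roots t" "q \<in> roots t \<times> roots t" "p \<noteq> q"
  shows "(LINT x|area. product_mode p x * product_mode q x) = 0"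
  using assms mode_orthogonal[of t "fst (fst p)" "snd (fst p)" "fst (fst q)" "snd (fst q)"]
    mode_orthogonal[of t "fst (snd p)" "snd (snd p)" "fst (snd q)" "snd (snd q)"]
  unfolding product_mode_def
  by (subst integral_tensor_mult) (auto intro: continuous_on_mode simp: roots_def prod_eq_iff)

lemma product_mode_norm_pos: "(LINT x|area. product_mode p x * product_mode p x) > 0"
  unfolding product_mode_def
  by (subst integral_tensor_mult) (auto intro: continuous_on_mode mult_pos_pos mode_norm_pos)

lemma integrable_continuous_mult:
  fixes w \<phi> :: "real \<times> real \<Rightarrow> real"
  assumes "integrable area w" "continuous_on UNIV \<phi>"
  shows "integrable area (\<lambda>x. w x * \<phi> x)"
proof -
  obtain B where B: "B > 0" "\<And>x. x \<in> {- (pi/2)..pi/2} \<times> {- (pi/2)..pi/2} \<Longrightarrow> norm (\<phi> x) \<le> B"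
    using closed_square_bound[OF assms(2)] by blast
  have "integrable area (\<lambda>x. B * w x)" using assms by simp
  moreover have "(\<lambda>x. w x * \<phi> x) \<in> borel_measurable area"
    by (intro borel_measurable_times borel_measurable_integrable[OF assms(1)] measurable_area_continuous assms(2))
  moreover have "AE x in area. norm (w x * \<phi> x) \<le> norm (B * w x)"
  proof (rule AE_I2)
    fix x assume "x \<in> space area"
    then have "\<bar>\<phi> x\<bar> \<le> B" using B(2)[of x] by (auto simp: space_restrict_space square_def)
    then have "\<bar>w x\<bar> * \<bar>\<phi> x\<bar> \<le> \<bar>w x\<bar> * B" by (intro mult_left_mono) auto
    then show "norm (w x * \<phi> x) \<le> norm (B * w x)" using B(1) by (simp add: abs_mult mult.commute)
  qed
  ultimately show ?thesis by (rule Bochner_Integration.integrable_bound)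
qed

section \<open>Distribution of the one-dimensional eigenvalues\<close>

lemma char_zero_iff_root:
  "(if b then odd_char t (of_real \<mu>) else even_char t (of_real \<mu>)) = 0 \<longleftrightarrow> robin_root t b \<mu>"
  unfolding even_char_real odd_char_real robin_root_def
  by (auto simp del: of_real_mult of_real_add of_real_diff)

text \<open>For \<open>\<mu> = - p\<^sup>2\<close> the end conditions read p = t tanh (p pi/2) and p
  tanh (p pi/2) = t. If p exceeds 2t + 1, the value of tanh lies between 1/2 and 1, and both
  equations fail.\<close>

lemma root_lower_bound:
  assumes t: "t \<ge> 0" and r: "robin_root t b \<mu>"
  shows "\<mu> \<ge> - ((2 * t + 1)\<^sup>2)"
proof (rule ccontr)
  assume *: "\<not> - ((2 * t + 1)\<^sup>2) \<le> \<mu>"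
  define p where "p = sqrt (- \<mu>)"
  have m: "\<mu> < 0" using * zero_le_power2[of "2 * t + 1"] by linarith
  have p2: "p\<^sup>2 = - \<mu>" using m by (simp add: p_def)
  then have "(2 * t + 1)\<^sup>2 < p\<^sup>2" using * by simp
  then have p: "2 * t + 1 < p" by (rule power_less_imp_less_base) (use m in \<open>simp add: p_def\<close>)
  have pos: "p > 0" using p t by simp
  have "1 * 1 \<le> p * (pi/2)" using p t pi_gt3 by (intro mult_mono) auto
  then have ch: "cosh (p * (pi/2)) / 2 \<le> sinh (p * (pi/2))"
    using cosh_le_2_sinh[of "p * (pi/2)"] pos by simp
  show False
  proof (cases b)
    case True
    then have "cosh (p * (pi/2)) = t * (sinh (p * (pi/2)) / p)"
      using r m by (simp add: robin_root_def even_mode_def odd_mode_def p_def)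
    then have "p * cosh (p * (pi/2)) = t * sinh (p * (pi/2))" using pos by (simp add: field_simps)
    also have "\<dots> \<le> t * cosh (p * (pi/2))" using t sinh_less_cosh_real[of "p * (pi/2)"] by (intro mult_left_mono) auto
    finally have "p \<le> t" by (rule mult_right_le_imp_le) (rule cosh_real_pos)
    then show False using p t by simp
  next
    case False
    then have "p\<^sup>2 * (sinh (p * (pi/2)) / p) = t * cosh (p * (pi/2))"
      using r m p2 by (simp add: robin_root_def even_mode_def odd_mode_def p_def)
    then have "p * sinh (p * (pi/2)) = t * cosh (p * (pi/2))" using pos by (simp add: power2_eq_square)
    moreover have "p * (cosh (p * (pi/2)) / 2) \<le> p * sinh (p * (pi/2))" using ch pos by (intro mult_left_mono) auto
    ultimately have "p * cosh (p * (pi/2)) \<le> (2 * t) * cosh (p * (pi/2))" by simp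
    then have "p \<le> 2 * t" by (rule mult_right_le_imp_le) (rule cosh_real_pos)
    then show False using p by simp
  qed
qed

lemma root_square_iff:
  assumes "\<alpha> > 0"
  shows "robin_root t False (\<alpha>\<^sup>2) \<longleftrightarrow> \<alpha> * sin (\<alpha> * (pi/2)) + t * cos (\<alpha> * (pi/2)) = 0"
    and "robin_root t True (\<alpha>\<^sup>2) \<longleftrightarrow> \<alpha> * cos (\<alpha> * (pi/2)) = t * sin (\<alpha> * (pi/2))"
proof -
  have m: "even_mode (\<alpha>\<^sup>2) (pi/2) = cos (\<alpha> * (pi/2))" "odd_mode (\<alpha>\<^sup>2) (pi/2) = sin (\<alpha> * (pi/2)) / \<alpha>"
    using assms by (auto simp: even_mode_def odd_mode_def)
  have "- \<alpha>\<^sup>2 * (s / \<alpha>) = - (\<alpha> * s)" for s using assms by (simp add: power2_eq_square)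
  then show "robin_root t False (\<alpha>\<^sup>2) \<longleftrightarrow> \<alpha> * sin (\<alpha> * (pi/2)) + t * cos (\<alpha> * (pi/2)) = 0"
    unfolding robin_root_def m by auto
  show "robin_root t True (\<alpha>\<^sup>2) \<longleftrightarrow> \<alpha> * cos (\<alpha> * (pi/2)) = t * sin (\<alpha> * (pi/2))"
    unfolding robin_root_def m using assms by (simp add: field_simps)
qed

lemma IVT_sign_change:
  fixes f :: "real \<Rightarrow> real"
  assumes "a \<le> b" "continuous_on {a..b} f" "f a * f b \<le> 0"
  shows "\<exists>x\<in>{a..b}. f x = 0"
proof (cases "f a \<le> 0")
  case True
  show ?thesis
  proof (cases "f b \<ge> 0")
    case True
    with \<open>f a \<le> 0\<close> show ?thesis using IVT'[of f a 0 b] assms by auto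
  next
    case False
    then have "f a = 0" using assms(3) \<open>f a \<le> 0\<close> by (auto simp: mult_le_0_iff)
    then show ?thesis using assms(1) by auto
  qed
next
  case False
  then have "f b \<le> 0" using assms(3) by (auto simp: mult_le_0_iff)
  then show ?thesis using IVT2'[of f b 0 a] assms False by auto
qed

text \<open>At the odd integers the term with \<open>t\<close> drops out and the other one
  alternates in sign.\<close>

lemma ex_even_root: "\<exists>\<alpha>\<in>{2 * real n + 1..2 * real n + 3}. robin_root t False (\<alpha>\<^sup>2)"
proof -
  let ?f = "\<lambda>\<alpha>. \<alpha> * sin (\<alpha> * (pi/2)) + t * cos (\<alpha> * (pi/2))"
  have v: "?f (2 * real n + 1) = (2 * real n + 1) * (-1) ^ n" for n
  proof -
    have e: "(2 * real n + 1) * (pi/2) = real (Suc (2 * n)) * pi / 2" by simp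
    have s: "sin ((2 * real n + 1) * (pi/2)) = (-1) ^ n" unfolding e by (rule sin_cos_npi)
    have "(sin ((2 * real n + 1) * (pi/2)))\<^sup>2 = 1" unfolding s by (simp flip: power_mult)
    then have "cos ((2 * real n + 1) * (pi/2)) = 0" by (simp add: sin_squared_eq)
    with s show ?thesis by simp
  qed
  have "2 * real n + 3 = 2 * real (Suc n) + 1" by simp
  then have v': "?f (2 * real n + 3) = (2 * real n + 3) * (-1) ^ Suc n" by (simp only: v)
  have "\<exists>x\<in>{2 * real n + 1..2 * real n + 3}. ?f x = 0"
  proof (rule IVT_sign_change)
    have "?f (2 * real n + 1) * ?f (2 * real n + 3) = - ((2 * real n + 1) * (2 * real n + 3) * ((-1) ^ n * (-1) ^ n))"
      unfolding v v' by simp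
    also have "\<dots> \<le> 0" by (simp flip: power_mult_distrib)
    finally show "?f (2 * real n + 1) * ?f (2 * real n + 3) \<le> 0" .
  qed (auto intro!: continuous_intros)
  then show ?thesis using root_square_iff(1)[of _ t] by fastforce
qed

lemma ex_odd_root:
  assumes "n \<ge> 1"
  shows "\<exists>\<alpha>\<in>{2 * real n..2 * real n + 2}. robin_root t True (\<alpha>\<^sup>2)"
proof -
  let ?f = "\<lambda>\<alpha>. \<alpha> * cos (\<alpha> * (pi/2)) - t * sin (\<alpha> * (pi/2))"
  have v: "?f (2 * real n) = 2 * real n * (-1) ^ n" for n
  proof -
    have e: "2 * real n * (pi/2) = real n * pi" by simp
    show ?thesis unfolding e by (simp only: cos_npi sin_npi)
  qed
  have "2 * real n + 2 = 2 * real (Suc n)" by simp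
  then have v': "?f (2 * real n + 2) = (2 * real n + 2) * (-1) ^ Suc n" by (simp only: v)
  have "\<exists>x\<in>{2 * real n..2 * real n + 2}. ?f x = 0"
  proof (rule IVT_sign_change)
    have "?f (2 * real n) * ?f (2 * real n + 2) = - ((2 * real n) * (2 * real n + 2) * ((-1) ^ n * (-1) ^ n))"
      unfolding v v' by simp
    also have "\<dots> \<le> 0" by (simp flip: power_mult_distrib)
    finally show "?f (2 * real n) * ?f (2 * real n + 2) \<le> 0" .
  qed (auto intro!: continuous_intros)
  then obtain x where "2 * real n \<le> x" "x \<le> 2 * real n + 2" "?f x = 0" by auto
  then show ?thesis using root_square_iff(2)[of x t] assms by auto
qed

lemma infinite_roots: "infinite (roots t)"
proof
  assume f: "finite (roots t)"
  then have fin: "finite (snd ` roots t)" by simp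
  obtain n where n: "Max (insert 0 (snd ` roots t)) < real n" using reals_Archimedean2 by blast
  obtain \<alpha> where a: "2 * real n + 1 \<le> \<alpha>" "robin_root t False (\<alpha>\<^sup>2)" using ex_even_root[of n t] by auto
  then have "(False, \<alpha>\<^sup>2) \<in> roots t" by (simp add: roots_def)
  then have "\<alpha>\<^sup>2 \<in> snd ` roots t" by force
  then have "\<alpha>\<^sup>2 \<le> Max (insert 0 (snd ` roots t))" using fin by (intro Max_ge) auto
  moreover have "real n \<le> \<alpha>\<^sup>2"
  proof -
    have "1 * \<alpha> \<le> \<alpha> * \<alpha>" using a(1) by (intro mult_right_mono) auto
    then show ?thesis using a(1) unfolding power2_eq_square by linarith
  qed
  ultimately show False using n by simp
qed

text \<open>By \<open>root_lower_bound\<close> these roots lie in a compact segment, where a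
  nonconstant entire function has finitely many zeros. The characteristic functions are not
  constant, since they have zeros and all of them are simple.\<close>

lemma finite_roots_le:
  assumes t: "t \<ge> 0"
  shows "finite {p \<in> roots t. snd p \<le> B}"
proof -
  define m where "m = - ((2 * t + 1)\<^sup>2)"
  define K where "K = complex_of_real ` {m..B}"
  have K: "compact K" unfolding K_def by (intro compact_continuous_image continuous_intros) simp
  have nc: "\<not> even_char t constant_on UNIV" "\<not> odd_char t constant_on UNIV"
  proof -
    have nc: "\<not> f constant_on UNIV" if z: "f z0 = 0" and f: "\<And>z. f z = 0 \<Longrightarrow> deriv f z \<noteq> 0"
      for f :: "complex \<Rightarrow> complex" and z0
    proof
      assume "f constant_on UNIV"
      then have "f = (\<lambda>_. 0)" using z by (auto simp: constant_on_def)
      then show False using f[of 0] by simp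
    qed
    obtain \<mu> \<nu> where "robin_root t False \<mu>" "robin_root t True \<nu>"
      using ex_even_root[of 0 t] ex_odd_root[of 1 t] by auto
    then have "even_char t (of_real \<mu>) = 0" "odd_char t (of_real \<nu>) = 0"
      using char_zero_iff_root[of False t \<mu>] char_zero_iff_root[of True t \<nu>] by auto
    then show "\<not> even_char t constant_on UNIV" "\<not> odd_char t constant_on UNIV"
      using nc even_char_simple odd_char_simple by blast+
  qed
  have "finite {z \<in> K. even_char t z = 0}" "finite {z \<in> K. odd_char t z = 0}"
    by (rule holomorphic_compact_finite_zeros[OF holomorphic_chars(1) open_UNIV connected_UNIV K _ nc(1)], simp)
       (rule holomorphic_compact_finite_zeros[OF holomorphic_chars(2) open_UNIV connected_UNIV K _ nc(2)], simp)
  then have fin: "finite ({True, False} \<times> (Re ` ({z \<in> K. even_char t z = 0} \<union> {z \<in> K. odd_char t z = 0})))"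
    by blast
  show ?thesis
  proof (rule finite_subset[OF _ fin], rule subsetI)
    fix p assume "p \<in> {p \<in> roots t. snd p \<le> B}"
    then obtain b \<mu> where p: "p = (b, \<mu>)" "robin_root t b \<mu>" "\<mu> \<le> B" by (cases p) (auto simp: roots_def)
    have "m \<le> \<mu>" unfolding m_def by (rule root_lower_bound[OF t p(2)])
    then have "complex_of_real \<mu> \<in> K" using p(3) by (auto simp: K_def)
    then have "complex_of_real \<mu> \<in> {z \<in> K. even_char t z = 0} \<union> {z \<in> K. odd_char t z = 0}"
      using p(2) char_zero_iff_root[of b t \<mu>] by (auto split: if_splits)
    then have "\<mu> \<in> Re ` ({z \<in> K. even_char t z = 0} \<union> {z \<in> K. odd_char t z = 0})"
      by (rule rev_image_eqI) simp
    then show "p \<in> {True, False} \<times> (Re ` ({z \<in> K. even_char t z = 0} \<union> {z \<in> K. odd_char t z = 0}))"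
      using p(1) by auto
  qed
qed

text \<open>Completeness in dimension one is used twice: in \<open>y\<close> for the partial
  transforms \<open>g p\<close>, then in \<open>x\<close> on almost every horizontal line. The
  exceptional sets can be united because there are only countably many roots.\<close>

theorem product_modes_complete:
  assumes t: "t \<ge> 0" and w: "integrable area w"
    and orth: "\<And>p. p \<in> roots t \<times> roots t \<Longrightarrow> (LINT x|area. w x * product_mode p x) = 0"
  shows "AE x in area. w x = 0"
proof -
  have "countable (\<Union>n::nat. {p \<in> roots t. snd p \<le> real n})"
    by (rule countable_UN[OF _ countable_finite[OF finite_roots_le[OF t]]]) simp
  moreover have "(\<Union>n::nat. {p \<in> roots t. snd p \<le> real n}) = roots t"
    using real_arch_simple by auto
  ultimately have cnt: "countable (roots t)" by simp
  define g where "g = (\<lambda>p y. LINT x|side_measure. w (x, y) * mode (fst p) (snd p) x)"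
  have cm: "continuous_on UNIV (\<lambda>x. mode b \<mu> (fst x))" "continuous_on UNIV (\<lambda>x. mode b \<mu> (snd x))" for b \<mu>
    by (rule continuous_on_compose2[OF continuous_on_mode[of UNIV]]; auto intro: continuous_intros)+
  have g: "AE y in side_measure. g p y = 0" if p: "p \<in> roots t" for p
  proof (rule modes_complete[OF _ t])
    have i: "integrable area (\<lambda>x. w x * mode (fst p) (snd p) (fst x))"
      by (rule integrable_continuous_mult[OF w cm(1)])
    have "integrable (side_measure \<Otimes>\<^sub>M side_measure) (\<lambda>(x, y). w (x, y) * mode (fst p) (snd p) x)"
      using i unfolding area_eq_pair case_prod_beta' prod.collapse fst_conv snd_conv .
    from JJ.integrable_snd[OF this] show "integrable side_measure (g p)" by (simp add: g_def)
    fix b \<mu> assume r: "robin_root t b \<mu>"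
    have "(LINT y|side_measure. g p y * mode b \<mu> y) = (LINT y|side_measure. LINT x|side_measure. w (x, y) * mode (fst p) (snd p) x * mode b \<mu> y)"
      unfolding g_def by simp
    also have "\<dots> = (LINT x|area. w x * product_mode (p, (b, \<mu>)) x)"
      unfolding integral_area_snd[OF integrable_continuous_mult[OF w continuous_on_product_mode]]
      by (simp add: product_mode_def tensor_def mult_ac)
    also have "\<dots> = 0" by (rule orth) (use p r in \<open>auto simp: roots_def\<close>)
    finally show "(LINT y|side_measure. g p y * mode b \<mu> y) = 0" .
  qed
  have "AE y in side_measure. \<forall>p\<in>roots t. g p y = 0"
    using g by (subst AE_ball_countable[OF cnt]) auto
  moreover have "AE y in side_measure. integrable side_measure (\<lambda>x. w (x, y))"
    using JJ.AE_integrable_snd[of "\<lambda>x y. w (x, y)"] w unfolding area_eq_pair by simp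
  ultimately have "AE y in side_measure. (LINT x|side_measure. \<bar>w (x, y)\<bar>) = 0"
  proof eventually_elim
    case (elim y)
    have "AE x in side_measure. w (x, y) = 0"
    proof (rule modes_complete[OF elim(2) t])
      fix b \<mu> assume "robin_root t b \<mu>"
      then have "g (b, \<mu>) y = 0" using elim(1) by (auto simp: roots_def)
      then show "(LINT x|side_measure. w (x, y) * mode b \<mu> x) = 0" by (simp add: g_def)
    qed
    then show ?case by (intro integral_eq_zero_AE) (auto elim!: eventually_mono)
  qed
  then have "(LINT y|side_measure. LINT x|side_measure. \<bar>w (x, y)\<bar>) = 0"
    by (rule integral_eq_zero_AE)
  then have "(LINT x|area. \<bar>w x\<bar>) = 0"
    by (subst integral_area_snd) (use w in auto)
  then have "AE x in area. \<bar>w x\<bar> = 0"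
    by (subst (asm) integral_nonneg_eq_0_iff_AE) (use w in auto)
  then show ?thesis by simp
qed

lemma finite_product_values_le:
  assumes "t \<ge> 0"
  shows "finite {p \<in> roots t \<times> roots t. product_value p \<le> \<nu>}"
proof -
  define A where "A = {p \<in> roots t. snd p \<le> \<nu> + (2 * t + 1)\<^sup>2}"
  have "finite (A \<times> A)" unfolding A_def using finite_roots_le[OF assms] by blast
  moreover have "{p \<in> roots t \<times> roots t. product_value p \<le> \<nu>} \<subseteq> A \<times> A"
  proof
    fix p assume p: "p \<in> {p \<in> roots t \<times> roots t. product_value p \<le> \<nu>}"
    then have "snd (fst p) \<ge> - ((2 * t + 1)\<^sup>2)" "snd (snd p) \<ge> - ((2 * t + 1)\<^sup>2)"
      by (auto simp: roots_def intro: root_lower_bound[OF assms])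
    with p show "p \<in> A \<times> A" by (cases p) (auto simp: A_def product_value_def)
  qed
  ultimately show ?thesis by (rule finite_subset[rotated])
qed

section \<open>Solution spaces and their dimensions\<close>

definition product_indices :: "real \<Rightarrow> real \<Rightarrow> (mode_index \<times> mode_index) set" where
  "product_indices t \<kappa> = {p \<in> roots t \<times> roots t. product_value p = \<kappa>}"

lemma finite_product_indices: "t \<ge> 0 \<Longrightarrow> finite (product_indices t \<kappa>)"
  unfolding product_indices_def
  by (rule finite_subset[OF _ finite_product_values_le[of t \<kappa>]]) auto

lemma integral_sum_product_modes:
  assumes P: "finite P" "P \<subseteq> roots t \<times> roots t" and q: "q \<in> roots t \<times> roots t"
  shows "(LINT x|area. (\<Sum>p\<in>P. c p * product_mode p x) * product_mode q x) =
     (if q \<in> P then c q * (LINT x|area. product_mode q x * product_mode q x) else 0)"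
proof -
  have i: "integrable area (\<lambda>x. product_mode p x * product_mode q x)" for p
    by (intro integrable_area_continuous continuous_on_mult continuous_on_product_mode)
  have "(LINT x|area. (\<Sum>p\<in>P. c p * product_mode p x) * product_mode q x) =
      (LINT x|area. (\<Sum>p\<in>P. c p * (product_mode p x * product_mode q x)))"
    by (simp add: sum_distrib_right mult.assoc)
  also have "\<dots> = (\<Sum>p\<in>P. c p * (LINT x|area. product_mode p x * product_mode q x))"
    by (subst Bochner_Integration.integral_sum) (auto intro!: integrable_mult_right i)
  also have "\<dots> = (\<Sum>p\<in>P. if p = q then c p * (LINT x|area. product_mode p x * product_mode q x) else 0)"
  proof (rule sum.cong[OF refl])
    fix p assume "p \<in> P"
    then have "p \<in> roots t \<times> roots t" using P(2) by blast
    from product_mode_orthogonal[OF this q]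
    show "c p * (LINT x|area. product_mode p x * product_mode q x) =
       (if p = q then c p * (LINT x|area. product_mode p x * product_mode q x) else 0)"
      by (cases "p = q") simp_all
  qed
  also have "\<dots> = (if q \<in> P then c q * (LINT x|area. product_mode q x * product_mode q x) else 0)"
    using P(1) by (simp add: sum.delta)
  finally show ?thesis .
qed

text \<open>Subtract from \<open>u\<close> its projection onto the products with value
  \<open>\<kappa>\<close>. The remainder is orthogonal to these by construction and to all other
  products by Green's formula, so completeness makes it vanish.\<close>

lemma robin_solution_expansion:
  assumes t: "t \<ge> 0" and u: "robin_solution (- t) \<kappa> u"
  obtains c where "AE x in area. u x = (\<Sum>p\<in>product_indices t \<kappa>. c p * product_mode p x)"
proof -
  let ?P = "product_indices t \<kappa>"
  have P: "finite ?P" "?P \<subseteq> roots t \<times> roots t"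
    using finite_product_indices[OF t] by (auto simp: product_indices_def)
  have iu: "integrable area u" by (rule L2_integrable[OF finite_measure_area robin_solution_L2[OF u]])
  define c where "c = (\<lambda>p. (LINT x|area. u x * product_mode p x) / (LINT x|area. product_mode p x * product_mode p x))"
  define s where "s = (\<lambda>x. \<Sum>p\<in>?P. c p * product_mode p x)"
  have cs: "continuous_on UNIV s" unfolding s_def by (intro continuous_intros continuous_on_product_mode)
  have "AE x in area. u x - s x = 0"
  proof (rule product_modes_complete[OF t])
    show "integrable area (\<lambda>x. u x - s x)"
      by (intro Bochner_Integration.integrable_diff iu integrable_area_continuous cs)
    fix q assume q: "q \<in> roots t \<times> roots t"
    have "(LINT x|area. (u x - s x) * product_mode q x) =
       (LINT x|area. u x * product_mode q x) - (LINT x|area. s x * product_mode q x)"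
      unfolding left_diff_distrib
      by (intro Bochner_Integration.integral_diff integrable_continuous_mult iu integrable_area_continuous cs
          continuous_on_product_mode)
    also have "(LINT x|area. s x * product_mode q x) =
       (if q \<in> ?P then c q * (LINT x|area. product_mode q x * product_mode q x) else 0)"
      unfolding s_def by (rule integral_sum_product_modes[OF P q])
    also have "(LINT x|area. u x * product_mode q x) - \<dots> = 0"
    proof (cases "q \<in> ?P")
      case True
      then show ?thesis using product_mode_norm_pos[of q] by (simp add: c_def)
    next
      case False
      then have "(LINT x|area. u x * product_mode q x) = 0"
        using q by (intro solution_orthogonal_product_mode[OF q u]) (auto simp: product_indices_def)
      then show ?thesis using False by simp
    qed
    finally show "(LINT x|area. (u x - s x) * product_mode q x) = 0" .
  qed
  then have "AE x in area. u x = (\<Sum>p\<in>?P. c p * product_mode p x)" by (simp add: s_def)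
  then show thesis by (rule that)
qed

lemma robin_multiplicity_product_indices:
  assumes t: "t \<ge> 0"
  shows "robin_multiplicity (- t) \<kappa> (card (product_indices t \<kappa>))"
proof -
  let ?P = "product_indices t \<kappa>" let ?n = "card ?P"
  have P: "finite ?P" "?P \<subseteq> roots t \<times> roots t"
    using finite_product_indices[OF t] by (auto simp: product_indices_def)
  obtain f where "bij_betw f {0..<?n} ?P" using ex_bij_betw_nat_finite[OF P(1)] by blast
  then have f: "bij_betw f {..<?n} ?P" by (simp add: atLeast0LessThan)
  define e where "e = (\<lambda>i. product_mode (f i))"
  have reindex: "(\<Sum>i<?n. c (f i) * e i x) = (\<Sum>p\<in>?P. c p * product_mode p x)" for c x
    unfolding e_def using sum.reindex_bij_betw[OF f, of "\<lambda>p. c p * product_mode p x"] by simp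
  show ?thesis
    unfolding robin_multiplicity_def
  proof (intro exI[of _ e] conjI allI impI)
    fix i assume "i < ?n"
    then have "f i \<in> ?P" using f by (auto simp: bij_betw_def)
    then show "robin_solution (- t) \<kappa> (e i)"
      using product_mode_solution[of "f i" t] by (auto simp: e_def product_indices_def)
  next
    fix c :: "nat \<Rightarrow> real" and j assume c: "AE x in area. (\<Sum>i<?n. c i * e i x) = 0" and j: "j < ?n"
    define d where "d = (\<lambda>p. c (inv_into {..<?n} f p))"
    have d: "d (f i) = c i" if "i < ?n" for i
      unfolding d_def using f that by (simp add: bij_betw_def inv_into_f_f)
    have "(\<Sum>i<?n. c i * e i x) = (\<Sum>p\<in>?P. d p * product_mode p x)" for x
      unfolding reindex[symmetric] by (rule sum.cong) (auto simp: d)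
    with c have c: "AE x in area. (\<Sum>p\<in>?P. d p * product_mode p x) = 0" by simp
    have fj: "f j \<in> ?P" using f j by (auto simp: bij_betw_def)
    then have "(LINT x|area. (\<Sum>p\<in>?P. d p * product_mode p x) * product_mode (f j) x) =
       d (f j) * (LINT x|area. product_mode (f j) x * product_mode (f j) x)"
      using integral_sum_product_modes[OF P, of "f j" d] P(2) by auto
    moreover have "(LINT x|area. (\<Sum>p\<in>?P. d p * product_mode p x) * product_mode (f j) x) = 0"
      by (rule integral_eq_zero_AE) (use c in \<open>auto elim!: eventually_mono\<close>)
    ultimately show "c j = 0" using product_mode_norm_pos[of "f j"] d[OF j] by simp
  next
    fix u assume "robin_solution (- t) \<kappa> u"
    then obtain c where c: "AE x in area. u x = (\<Sum>p\<in>?P. c p * product_mode p x)"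
      by (rule robin_solution_expansion[OF t])
    then show "\<exists>c::nat \<Rightarrow> real. AE x in area. u x = (\<Sum>i<?n. c i * e i x)"
      by (intro exI[of _ "\<lambda>i. c (f i)"]) (simp add: reindex)
  qed
qed

text \<open>Used in both directions, so that the multiplicity is unique: independent solutions
  cannot outnumber the functions in which all solutions can be expanded.\<close>

lemma robin_multiplicity_not_less:
  assumes "robin_multiplicity h \<kappa> n" "robin_multiplicity h \<kappa> m"
  shows "\<not> n < m"
proof
  assume nm: "n < m"
  obtain e where e: "\<And>u. robin_solution h \<kappa> u \<Longrightarrow> \<exists>c::nat \<Rightarrow> real. AE x in area. u x = (\<Sum>i<n. c i * e i x)"
    using assms(1) unfolding robin_multiplicity_def by blast
  obtain e' where e': "\<And>j. j < m \<Longrightarrow> robin_solution h \<kappa> (e' j)"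
     "\<And>c::nat \<Rightarrow> real. AE x in area. (\<Sum>i<m. c i * e' i x) = 0 \<Longrightarrow> \<forall>i<m. c i = 0"
    using assms(2) unfolding robin_multiplicity_def by blast
  have "\<forall>j\<in>{..<m}. \<exists>c::nat \<Rightarrow> real. AE x in area. e' j x = (\<Sum>i<n. c i * e i x)" using e e' by auto
  then obtain a :: "nat \<Rightarrow> nat \<Rightarrow> real" where a: "\<And>j. j \<in> {..<m} \<Longrightarrow> AE x in area. e' j x = (\<Sum>i<n. a j i * e i x)"
    by metis
  obtain d where d: "\<exists>j\<in>{..<m}. d j \<noteq> 0" "\<And>i. i < n \<Longrightarrow> (\<Sum>j<m. d j * a j i) = 0"
    using nontrivial_linear_relation[of "{..<m}" n a] nm by auto
  have "AE x in area. \<forall>j\<in>{..<m}. e' j x = (\<Sum>i<n. a j i * e i x)"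
    using a by (subst AE_ball_countable) auto
  then have "AE x in area. (\<Sum>j<m. d j * e' j x) = 0"
  proof eventually_elim
    case (elim x)
    have "(\<Sum>j<m. d j * e' j x) = (\<Sum>j<m. \<Sum>i<n. d j * a j i * e i x)"
      using elim by (intro sum.cong) (auto simp: sum_distrib_left mult_ac)
    also have "\<dots> = (\<Sum>i<n. (\<Sum>j<m. d j * a j i) * e i x)"
      by (subst sum.swap) (simp add: sum_distrib_right)
    also have "\<dots> = 0" using d(2) by simp
    finally show ?case .
  qed
  then show False using e'(2) d(1) by auto
qed

lemma robin_eigenvalue_list_iff:
  assumes "t \<ge> 0"
  shows "robin_eigenvalue_list (- t) l \<longleftrightarrow> mono_on {1..} l \<and>
    (\<forall>\<mu>. finite {k. 1 \<le> k \<and> l k = \<mu>} \<and> card {k. 1 \<le> k \<and> l k = \<mu>} = card {p \<in> roots t \<times> roots t. product_value p = \<mu>})"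
proof -
  have "robin_multiplicity (- t) \<mu> n \<longleftrightarrow> n = card {p \<in> roots t \<times> roots t. product_value p = \<mu>}" for \<mu> n
  proof
    assume n: "robin_multiplicity (- t) \<mu> n"
    note c = robin_multiplicity_product_indices[OF assms, of \<mu>, unfolded product_indices_def]
    show "n = card {p \<in> roots t \<times> roots t. product_value p = \<mu>}"
      using robin_multiplicity_not_less[OF n c] robin_multiplicity_not_less[OF c n] by simp
  qed (simp add: robin_multiplicity_product_indices[OF assms, unfolded product_indices_def])
  then show ?thesis unfolding robin_eigenvalue_list_def by simp
qed

text \<open>The definite description needs two things: every admissible list has
  \<open>\<kappa>\<close> at place \<open>k\<close>, and there is an admissible list at all. The
  latter rests on \<open>infinite_roots\<close>.\<close>

theorem robin_eigenvalue_eqI: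
  assumes t: "t \<ge> 0" and k: "1 \<le> k"
    and le: "k \<le> card {p \<in> roots t \<times> roots t. product_value p \<le> \<kappa>}"
    and less: "card {p \<in> roots t \<times> roots t. product_value p < \<kappa>} < k"
  shows "robin_eigenvalue k (- t) = \<kappa>"
proof -
  note fin = finite_product_values_le[OF t]
  have "l k = \<kappa>" if l: "robin_eigenvalue_list (- t) l" for l
  proof -
    have l': "mono_on {1..} l" "\<And>\<mu>. finite {k. 1 \<le> k \<and> l k = \<mu>}"
      "\<And>\<mu>. card {k. 1 \<le> k \<and> l k = \<mu>} = card {p \<in> roots t \<times> roots t. product_value p = \<mu>}"
      using l unfolding robin_eigenvalue_list_iff[OF t] by auto
    note iff = list_le_iff_count[OF fin l' k]
    have "l k \<le> \<kappa>" using iff le by simp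
    moreover have "\<not> l k < \<kappa>"
    proof
      assume "l k < \<kappa>"
      have "k \<le> card {p \<in> roots t \<times> roots t. product_value p \<le> l k}" using iff by blast
      also have "\<dots> \<le> card {p \<in> roots t \<times> roots t. product_value p < \<kappa>}"
        by (rule card_mono[OF finite_subset[OF _ fin[of \<kappa>]]]) (use \<open>l k < \<kappa>\<close> in auto)
      finally show False using less by simp
    qed
    ultimately show ?thesis by simp
  qed
  moreover have "infinite (roots t \<times> roots t)"
    using infinite_roots[of t] by (metis finite_cartesian_productD1 infinite_imp_nonempty)
  then obtain l where "robin_eigenvalue_list (- t) l"
    using ex_list_with_counts[OF fin] robin_eigenvalue_list_iff[OF t] by blast
  ultimately show ?thesis unfolding robin_eigenvalue_def by (intro the_equality) auto
qed

section \<open>The first four one-dimensional eigenvalues\<close>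

text \<open>Modes of distinct eigenvalues are orthogonal, which is impossible if their product never
  changes sign and is not identically zero.\<close>

lemma same_sign_root_unique:
  assumes r: "robin_root t b \<mu>" "robin_root t b \<nu>"
    and pos: "\<And>x. x \<in> {- (pi/2)<..<pi/2} \<Longrightarrow> mode b \<mu> x * mode b \<nu> x \<ge> 0"
    and x: "x0 \<in> {- (pi/2)<..<pi/2}" "mode b \<mu> x0 * mode b \<nu> x0 \<noteq> 0"
  shows "\<mu> = \<nu>"
proof (rule ccontr)
  assume "\<mu> \<noteq> \<nu>"
  then have "(LINT x|side_measure. mode b \<mu> x * mode b \<nu> x) = 0"
    using mode_orthogonal[OF r] by simp
  moreover have "AE x in side_measure. 0 \<le> mode b \<mu> x * mode b \<nu> x"
    by (rule AE_I2) (use pos in \<open>auto simp: space_restrict_space\<close>)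
  ultimately have "AE x in side_measure. mode b \<mu> x * mode b \<nu> x = 0"
    using integral_nonneg_eq_0_iff_AE[OF integrable_modes] by blast
  then have "mode b \<mu> x0 * mode b \<nu> x0 = 0"
    by (intro AE_zero_open_continuous[of "{- (pi/2)<..<pi/2}" "\<lambda>x. mode b \<mu> x * mode b \<nu> x"] x
        continuous_intros continuous_on_mode) auto
  then show False using x by simp
qed

lemma abs_mult_sqrt_less:
  assumes "\<mu> \<le> 1" "0 \<le> \<mu>" "\<bar>x\<bar> < pi/2"
  shows "\<bar>sqrt \<mu> * x\<bar> < pi/2"
proof -
  have "\<bar>sqrt \<mu> * x\<bar> \<le> 1 * \<bar>x\<bar>" unfolding abs_mult using assms by (intro mult_right_mono) auto
  then show ?thesis using assms by simp
qed

lemma even_mode_pos: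
  assumes "\<mu> \<le> 1" "\<bar>x\<bar> < pi/2"
  shows "even_mode \<mu> x > 0"
proof (cases "\<mu> \<ge> 0")
  case True
  then show ?thesis using abs_mult_sqrt_less[OF assms(1) True assms(2)]
    by (auto simp: even_mode_def intro!: cos_gt_zero_pi)
qed (simp add: even_mode_def cosh_real_pos)

lemma odd_mode_pos:
  assumes "\<mu> \<le> 1" "0 < x" "x < pi/2"
  shows "odd_mode \<mu> x > 0"
proof -
  consider "\<mu> > 0" | "\<mu> = 0" | "\<mu> < 0" by linarith
  then show ?thesis
  proof cases
    case 1
    then have "sqrt \<mu> * x < pi" using abs_mult_sqrt_less[of \<mu> x] assms by auto
    then show ?thesis using 1 assms by (auto simp: odd_mode_def intro!: divide_pos_pos sin_gt_zero)
  qed (use assms in \<open>auto simp: odd_mode_def intro!: divide_pos_pos\<close>)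
qed

text \<open>Up to the value 1 the even mode has no zero in the interval and the odd mode vanishes
  only at the origin, so any two of the same parity agree in sign.\<close>

lemma low_root_unique:
  assumes "robin_root t b \<mu>" "robin_root t b \<nu>" "\<mu> \<le> 1" "\<nu> \<le> 1"
  shows "\<mu> = \<nu>"
proof (rule same_sign_root_unique[OF assms(1,2), of 1])
  show "(1::real) \<in> {- (pi/2)<..<pi/2}" using pi_gt3 by simp
  show "mode b \<mu> 1 * mode b \<nu> 1 \<noteq> 0"
    using even_mode_pos[of \<mu> 1] even_mode_pos[of \<nu> 1] odd_mode_pos[of \<mu> 1] odd_mode_pos[of \<nu> 1] assms pi_gt3
    by (cases b) (auto simp: mode_def)
  fix x assume x: "x \<in> {- (pi/2)<..<pi/2}"
  show "mode b \<mu> x * mode b \<nu> x \<ge> 0"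
  proof (cases b)
    case False
    have "\<bar>x\<bar> < pi/2" using x by auto
    then show ?thesis using even_mode_pos[of \<mu> x] even_mode_pos[of \<nu> x] False assms by (simp add: mode_def)
  next
    case True
    consider "x > 0" | "x = 0" | "x < 0" by linarith
    then show ?thesis
    proof cases
      case 1
      then show ?thesis using odd_mode_pos[of \<mu> x] odd_mode_pos[of \<nu> x] x assms True by (auto simp: mode_def)
    next
      case 2
      then show ?thesis using mode_minus(2)[of \<mu> 0] True by (simp add: mode_def)
    next
      case 3
      then have "odd_mode \<mu> (- x) * odd_mode \<nu> (- x) \<ge> 0"
        using odd_mode_pos[of \<mu> "- x"] odd_mode_pos[of \<nu> "- x"] x assms by auto
      then show ?thesis using True by (simp add: mode_def mode_minus)
    qed
  qed
qed

section \<open>Existence of the four lowest roots\<close>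

lemma continuous_on_char_real:
  "continuous_on A (\<lambda>\<mu>. \<mu> * odd_mode \<mu> (pi/2) + t * even_mode \<mu> (pi/2))"
  "continuous_on A (\<lambda>\<mu>. even_mode \<mu> (pi/2) - t * odd_mode \<mu> (pi/2))"
proof -
  have "continuous_on A (\<lambda>\<mu>. Re (even_char t (of_real \<mu>)))" "continuous_on A (\<lambda>\<mu>. Re (odd_char t (of_real \<mu>)))"
    by (intro continuous_intros continuous_on_compose2[OF holomorphic_on_imp_continuous_on[OF holomorphic_chars(1)[of t UNIV]]]
      continuous_on_compose2[OF holomorphic_on_imp_continuous_on[OF holomorphic_chars(2)[of t UNIV]]]; simp)+
  then show "continuous_on A (\<lambda>\<mu>. \<mu> * odd_mode \<mu> (pi/2) + t * even_mode \<mu> (pi/2))"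
    "continuous_on A (\<lambda>\<mu>. even_mode \<mu> (pi/2) - t * odd_mode \<mu> (pi/2))"
    unfolding even_char_real odd_char_real Re_complex_of_real .
qed

lemma modes_at_negative_square:
  assumes "p > 0"
  shows "even_mode (- (p\<^sup>2)) x = cosh (p * x)" "odd_mode (- (p\<^sup>2)) x = sinh (p * x) / p"
  using assms by (auto simp: even_mode_def odd_mode_def)

lemma ex_lowest_even_root:
  assumes t: "t \<ge> 0"
  obtains p where "p \<ge> 0" "robin_root t False (- (p\<^sup>2))" "p * sinh (p * (pi/2)) = t * cosh (p * (pi/2))"
proof -
  let ?f = "\<lambda>p. p * sinh (p * (pi/2)) - t * cosh (p * (pi/2))"
  have "\<exists>p\<in>{0..2 * t + 1}. ?f p = 0"
  proof (rule IVT_sign_change)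
    let ?q = "2 * t + 1"
    have "1 * 1 \<le> ?q * (pi/2)" using t pi_gt3 by (intro mult_mono) auto
    then have "cosh (?q * (pi/2)) / 2 \<le> sinh (?q * (pi/2))"
      using cosh_le_2_sinh[of "?q * (pi/2)"] t by simp
    then have "?q * (cosh (?q * (pi/2)) / 2) \<le> ?q * sinh (?q * (pi/2))"
      using t by (intro mult_left_mono) auto
    moreover have "?q * (cosh (?q * (pi/2)) / 2) = t * cosh (?q * (pi/2)) + cosh (?q * (pi/2)) / 2"
      by (simp add: field_simps)
    ultimately have "?f ?q \<ge> 0" using cosh_real_pos[of "?q * (pi/2)"] by linarith
    then show "?f 0 * ?f ?q \<le> 0" using t by (simp add: mult_nonneg_nonpos mult_nonpos_nonneg mult_le_0_iff)
  qed (use t in \<open>auto intro!: continuous_intros\<close>)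
  then obtain p where p: "p \<ge> 0" "?f p = 0" by auto
  have "robin_root t False (- (p\<^sup>2))"
  proof (cases "p = 0")
    case True
    then show ?thesis using p by (simp add: robin_root_def even_mode_def)
  next
    case False
    then show ?thesis using p modes_at_negative_square[of p] by (simp add: robin_root_def power2_eq_square)
  qed
  then show thesis using that p by simp
qed

lemma ex_low_odd_root:
  assumes t: "t \<ge> 0"
  obtains \<mu> where "\<mu> \<le> 1" "robin_root t True \<mu>"
proof -
  let ?g = "\<lambda>\<mu>. even_mode \<mu> (pi/2) - t * odd_mode \<mu> (pi/2)"
  \<comment> \<open>At the left end cosh outweighs sinh times t / (t + 1); at 1 the cosine vanishes
    and \<open>- t\<close> remains.\<close>
  have "\<exists>\<mu>\<in>{- ((t+1)\<^sup>2)..1}. ?g \<mu> = 0"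
  proof (rule IVT_sign_change)
    show "- ((t+1)\<^sup>2) \<le> 1" using zero_le_power2[of "t+1"] by linarith
    have m: "even_mode (- ((t+1)\<^sup>2)) (pi/2) = cosh ((t+1) * (pi/2))"
      "odd_mode (- ((t+1)\<^sup>2)) (pi/2) = sinh ((t+1) * (pi/2)) / (t+1)"
      using t by (intro modes_at_negative_square; simp)+
    have "t / (t+1) * sinh ((t+1) * (pi/2)) \<le> 1 * sinh ((t+1) * (pi/2))"
      using t by (intro mult_right_mono) auto
    then have "?g (- ((t+1)\<^sup>2)) \<ge> 0"
      unfolding m using sinh_less_cosh_real[of "(t+1) * (pi/2)"] by simp
    moreover have "?g 1 \<le> 0" using t by (simp add: even_mode_def odd_mode_def)
    ultimately show "?g (- ((t+1)\<^sup>2)) * ?g 1 \<le> 0" by (rule mult_nonneg_nonpos)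
  qed (rule continuous_on_char_real)
  then show thesis using that by (auto simp: robin_root_def)
qed

lemma trig_signs:
  assumes "1 < a" "a \<le> (2::real)"
  shows "cos (a * (pi/2)) < 0" "sin (a * (pi/2)) \<ge> 0"
proof -
  have b: "pi/2 < a * (pi/2)" "a * (pi/2) \<le> pi" using assms by (auto simp: field_simps)
  have "cos (a * (pi/2)) < cos (pi/2)" by (rule cos_monotone_0_pi) (use b in auto)
  then show "cos (a * (pi/2)) < 0" by simp
  show "sin (a * (pi/2)) \<ge> 0" by (rule sin_ge_zero) (use b in auto)
qed

lemma trig_signs':
  assumes "2 < a" "a \<le> (3::real)"
  shows "cos (a * (pi/2)) \<le> 0" "sin (a * (pi/2)) < 0"
proof -
  have b: "0 < (a - 2) * (pi/2)" "(a - 2) * (pi/2) \<le> pi/2" using assms by (auto simp: field_simps)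
  have e: "a * (pi/2) = (a - 2) * (pi/2) + pi" by (simp add: field_simps)
  show "sin (a * (pi/2)) < 0" unfolding e sin_periodic_pi using b sin_gt_zero[of "(a - 2) * (pi/2)"] by simp
  show "cos (a * (pi/2)) \<le> 0" unfolding e cos_periodic_pi using b cos_ge_zero[of "(a - 2) * (pi/2)"] by simp
qed

lemma DERIV_mult_tan:
  assumes "cos (a * c) \<noteq> 0"
  shows "((\<lambda>a. a * (sin (a * c) / cos (a * c))) has_real_derivative
    (sin (a * c) * cos (a * c) + a * c) / (cos (a * c))\<^sup>2) (at a)"
proof -
  have "((\<lambda>a. a * (sin (a * c) / cos (a * c))) has_real_derivative
     1 * (sin (a * c) / cos (a * c)) + (cos (a * c) * c * cos (a * c) - sin (a * c) * (- sin (a * c) * c)) / (cos (a * c) * cos (a * c)) * a) (at a)"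
    by (intro DERIV_mult DERIV_divide DERIV_ident assms) (auto intro!: derivative_eq_intros)
  moreover have "cos (a * c) * c * cos (a * c) - sin (a * c) * (- sin (a * c) * c) = c"
  proof -
    have "cos (a * c) * c * cos (a * c) - sin (a * c) * (- sin (a * c) * c) = c * ((sin (a * c))\<^sup>2 + (cos (a * c))\<^sup>2)"
      by (simp only: power2_eq_square algebra_simps)
    then show ?thesis by (simp only: sin_cos_squared_add mult_1_right)
  qed
  moreover have "1 * (s / k) + c / (k * k) * a = (s * k + a * c) / k\<^sup>2" if "k \<noteq> 0" for s k :: real
    using that by (simp add: field_simps power2_eq_square)
  ultimately show ?thesis using assms by (simp only: not_False_eq_True)
qed

lemma DERIV_mult_cot:
  assumes "sin (a * c) \<noteq> 0"
  shows "((\<lambda>a. a * (cos (a * c) / sin (a * c))) has_real_derivative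
    (sin (a * c) * cos (a * c) - a * c) / (sin (a * c))\<^sup>2) (at a)"
proof -
  have "((\<lambda>a. a * (cos (a * c) / sin (a * c))) has_real_derivative
     1 * (cos (a * c) / sin (a * c)) + (- sin (a * c) * c * sin (a * c) - cos (a * c) * (cos (a * c) * c)) / (sin (a * c) * sin (a * c)) * a) (at a)"
    by (intro DERIV_mult DERIV_divide DERIV_ident assms) (auto intro!: derivative_eq_intros)
  moreover have "- sin (a * c) * c * sin (a * c) - cos (a * c) * (cos (a * c) * c) = - c"
  proof -
    have "- sin (a * c) * c * sin (a * c) - cos (a * c) * (cos (a * c) * c) = - (c * ((sin (a * c))\<^sup>2 + (cos (a * c))\<^sup>2))"
      by (simp only: power2_eq_square algebra_simps)
    then show ?thesis by (simp only: sin_cos_squared_add mult_1_right)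
  qed
  moreover have "1 * (k / s) + - c / (s * s) * a = (s * k - a * c) / s\<^sup>2" if "s \<noteq> 0" for s k :: real
    using that by (simp add: field_simps power2_eq_square)
  ultimately show ?thesis using assms by (simp only: not_False_eq_True)
qed

lemma mult_tan_strict_mono:
  assumes "1 < a" "a < b" "b \<le> (2::real)"
  shows "a * (sin (a * (pi/2)) / cos (a * (pi/2))) < b * (sin (b * (pi/2)) / cos (b * (pi/2)))"
proof (rule DERIV_pos_imp_increasing[OF assms(2)])
  fix x assume x: "a \<le> x" "x \<le> b"
  then have c: "cos (x * (pi/2)) < 0" using trig_signs[of x] assms by simp
  have "\<bar>sin (x * (pi/2)) * cos (x * (pi/2))\<bar> < \<bar>x * (pi/2)\<bar>"
    by (rule abs_sin_cos_less) (use x assms in auto)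
  then have "(sin (x * (pi/2)) * cos (x * (pi/2)) + x * (pi/2)) / (cos (x * (pi/2)))\<^sup>2 > 0"
    using c x assms by (intro divide_pos_pos) auto
  then show "\<exists>y. ((\<lambda>a. a * (sin (a * (pi/2)) / cos (a * (pi/2)))) has_real_derivative y) (at x) \<and> 0 < y"
    using DERIV_mult_tan[of x "pi/2"] c by auto
qed

lemma mult_cot_strict_antimono:
  assumes "2 < a" "a < b" "b \<le> (3::real)"
  shows "b * (cos (b * (pi/2)) / sin (b * (pi/2))) < a * (cos (a * (pi/2)) / sin (a * (pi/2)))"
proof (rule DERIV_neg_imp_decreasing[OF assms(2)])
  fix x assume x: "a \<le> x" "x \<le> b"
  then have c: "sin (x * (pi/2)) < 0" using trig_signs'[of x] assms by simp
  have "\<bar>sin (x * (pi/2)) * cos (x * (pi/2))\<bar> < \<bar>x * (pi/2)\<bar>"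
    by (rule abs_sin_cos_less) (use x assms in auto)
  then have "(sin (x * (pi/2)) * cos (x * (pi/2)) - x * (pi/2)) / (sin (x * (pi/2)))\<^sup>2 < 0"
    using c x assms by (intro divide_neg_pos) auto
  then show "\<exists>y. ((\<lambda>a. a * (cos (a * (pi/2)) / sin (a * (pi/2)))) has_real_derivative y) (at x) \<and> y < 0"
    using DERIV_mult_cot[of x "pi/2"] c by auto
qed

lemma third_root_iff:
  assumes "1 < a" "a \<le> 2"
  shows "robin_root t False (a\<^sup>2) \<longleftrightarrow> a * (sin (a * (pi/2)) / cos (a * (pi/2))) = - t"
proof -
  have c: "cos (a * (pi/2)) \<noteq> 0" using trig_signs[of a] assms by simp
  show ?thesis using assms c by (subst root_square_iff) (auto simp: field_simps)
qed

lemma fourth_root_iff: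
  assumes "2 < b" "b \<le> 3"
  shows "robin_root t True (b\<^sup>2) \<longleftrightarrow> b * (cos (b * (pi/2)) / sin (b * (pi/2))) = t"
proof -
  have c: "sin (b * (pi/2)) \<noteq> 0" using trig_signs'[of b] assms by simp
  show ?thesis using assms c by (subst root_square_iff) (auto simp: field_simps)
qed

lemma ex_third_root:
  assumes t: "t \<ge> 0"
  obtains a where "1 < a" "a \<le> 2" "robin_root t False (a\<^sup>2)"
proof -
  let ?f = "\<lambda>\<alpha>. \<alpha> * sin (\<alpha> * (pi/2)) + t * cos (\<alpha> * (pi/2))"
  have "\<exists>a\<in>{1..2}. ?f a = 0"
  proof (rule IVT_sign_change)
    show "?f 1 * ?f 2 \<le> 0" using t by simp
  qed (auto intro!: continuous_intros)
  then obtain a where a: "1 \<le> a" "a \<le> 2" "?f a = 0" by auto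
  then have "a \<noteq> 1" by auto
  then show thesis using that[of a] a root_square_iff(1)[of a t] by simp
qed

lemma ex_fourth_root:
  assumes t: "t \<ge> 0"
  obtains b where "2 < b" "b \<le> 3" "robin_root t True (b\<^sup>2)"
proof -
  let ?f = "\<lambda>\<alpha>. \<alpha> * cos (\<alpha> * (pi/2)) - t * sin (\<alpha> * (pi/2))"
  have "\<exists>a\<in>{2..3}. ?f a = 0"
  proof (rule IVT_sign_change)
    have "3 * (pi/2) = pi/2 + pi" by simp
    then have "sin (3 * (pi/2)) = -1" "cos (3 * (pi/2)) = 0"
      by (simp_all only: sin_periodic_pi cos_periodic_pi sin_pi_half cos_pi_half minus_zero)
    then show "?f 2 * ?f 3 \<le> 0" using t by simp
  qed (auto intro!: continuous_intros)
  then obtain b where b: "2 \<le> b" "b \<le> 3" "?f b = 0" by auto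
  then have "b \<noteq> 2" by auto
  then show thesis using that[of b] b root_square_iff(2)[of b t] by simp
qed

text \<open>Put \<mu> = x^2 above 1. Signs of sine and cosine exclude odd modes for 1 < x \<le> 2
  and even modes for 2 < x \<le> 3; for the other parity monotonicity leaves one root. Roots with x
  > 3 lie beyond the fourth.\<close>

lemma root_classification:
  assumes t: "t \<ge> 0"
    and m1: "robin_root t False \<mu>1" "\<mu>1 \<le> 1" and m2: "robin_root t True \<mu>2" "\<mu>2 \<le> 1"
    and a: "1 < a" "a \<le> 2" "robin_root t False (a\<^sup>2)" and b: "2 < b" "b \<le> 3" "robin_root t True (b\<^sup>2)"
    and r: "robin_root t c \<mu>"
  shows "(c, \<mu>) \<in> {(False, \<mu>1), (True, \<mu>2), (False, a\<^sup>2), (True, b\<^sup>2)} \<or> b\<^sup>2 < \<mu>"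
proof (cases "\<mu> \<le> 1")
  case True
  then show ?thesis using low_root_unique[of t c \<mu>] m1 m2 r by (cases c) auto
next
  case False
  define x where "x = sqrt \<mu>"
  have x: "x > 1" "\<mu> = x\<^sup>2" using False by (auto simp: x_def real_less_rsqrt)
  show ?thesis
  proof (cases "x \<le> 3")
    case False
    then have "3\<^sup>2 < x\<^sup>2" by (intro power_strict_mono) auto
    moreover have "b\<^sup>2 \<le> 3\<^sup>2" using b by (intro power_mono) auto
    ultimately show ?thesis using x by linarith
  next
    case True
    show ?thesis
    proof (cases "x \<le> 2")
      case True
      note s = trig_signs[OF x(1) True]
      show ?thesis
      proof (cases c)
        case True
        then have "x * cos (x * (pi/2)) = t * sin (x * (pi/2))" using r x by (simp add: root_square_iff)
        moreover have "x * cos (x * (pi/2)) < 0" using s x by (simp add: mult_pos_neg)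
        moreover have "t * sin (x * (pi/2)) \<ge> 0" using s t by simp
        ultimately show ?thesis by linarith
      next
        case False
        then have "x * (sin (x * (pi/2)) / cos (x * (pi/2))) = - t"
          using r x third_root_iff[OF x(1) \<open>x \<le> 2\<close>] by simp
        moreover have "a * (sin (a * (pi/2)) / cos (a * (pi/2))) = - t"
          using a third_root_iff[OF a(1,2)] by simp
        ultimately have "x = a" using mult_tan_strict_mono[of a x] mult_tan_strict_mono[of x a] a x \<open>x \<le> 2\<close>
          by (cases x a rule: linorder_cases) auto
        then show ?thesis using False x by simp
      qed
    next
      case False
      then have x2: "2 < x" by simp
      note s = trig_signs'[OF x2 True]
      show ?thesis
      proof (cases c)
        case False
        then have "x * sin (x * (pi/2)) + t * cos (x * (pi/2)) = 0" using r x by (simp add: root_square_iff)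
        moreover have "x * sin (x * (pi/2)) < 0" using s x by (simp add: mult_pos_neg)
        moreover have "t * cos (x * (pi/2)) \<le> 0" using s t by (simp add: mult_nonneg_nonpos)
        ultimately show ?thesis by linarith
      next
        case True
        then have "x * (cos (x * (pi/2)) / sin (x * (pi/2))) = t"
          using r x fourth_root_iff[OF x2 \<open>x \<le> 3\<close>] by simp
        moreover have "b * (cos (b * (pi/2)) / sin (b * (pi/2))) = t"
          using b fourth_root_iff[OF b(1,2)] by simp
        ultimately have "x = b" using mult_cot_strict_antimono[of b x] mult_cot_strict_antimono[of x b] b x2 \<open>x \<le> 3\<close>
          by (cases x b rule: linorder_cases) auto
        then show ?thesis using True x by simp
      qed
    qed
  qed
qed

text \<open>Since \<open>cot (s pi/2) = - tan ((s-1) pi/2)\<close>, the equations for \<open>b - 1\<close> and \<open>a\<close> differ only in the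
  prefactor.\<close>

lemma third_fourth_gap:
  assumes t: "t \<ge> 0" and a: "1 < a" "a \<le> 2" "robin_root t False (a\<^sup>2)"
    and b: "2 < b" "b \<le> 3" "robin_root t True (b\<^sup>2)"
  shows "a + 1 \<le> b"
proof (rule ccontr)
  assume "\<not> a + 1 \<le> b"
  then have c: "b - 1 < a" "1 < b - 1" using b by auto
  let ?T = "\<lambda>x. - (sin (x * (pi/2)) / cos (x * (pi/2)))"
  have e: "b * (pi/2) = (b - 1) * (pi/2) + pi/2" by (simp add: field_simps)
  have "b * ?T (b - 1) = t"
    using b(3) unfolding fourth_root_iff[OF b(1,2)] unfolding e sin_add cos_add by simp
  moreover have "a * ?T a = t" using a(3) unfolding third_root_iff[OF a(1,2)] by simp
  moreover have "a * ?T a < (b - 1) * ?T (b - 1)"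
    using mult_tan_strict_mono[OF c(2,1) a(2)] by simp
  moreover have "(b - 1) * ?T (b - 1) \<le> b * ?T (b - 1)"
  proof (rule mult_right_mono)
    have "cos ((b - 1) * (pi/2)) < 0" "sin ((b - 1) * (pi/2)) \<ge> 0" using trig_signs[of "b - 1"] c a by auto
    then show "0 \<le> ?T (b - 1)" by (simp add: divide_nonneg_neg)
  qed simp
  ultimately show False by linarith
qed

lemma mult_cos_le_sin: "0 \<le> y \<Longrightarrow> y \<le> pi/2 \<Longrightarrow> y * cos y \<le> sin y"
proof -
  assume y: "0 \<le> y" "y \<le> pi/2"
  have "sin 0 - 0 * cos 0 \<le> sin y - y * cos y"
  proof (rule DERIV_nonneg_imp_nondecreasing[OF y(1)])
    fix x assume x: "0 \<le> x" "x \<le> y"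
    have "((\<lambda>y. sin y - y * cos y) has_real_derivative x * sin x) (at x)"
      by (auto intro!: derivative_eq_intros)
    moreover have "x * sin x \<ge> 0" using x y by (intro mult_nonneg_nonneg sin_ge_zero) auto
    ultimately show "\<exists>z. ((\<lambda>y. sin y - y * cos y) has_real_derivative z) (at x) \<and> 0 \<le> z" by blast
  qed
  then show ?thesis by simp
qed

text \<open>For \<mu> = - q^2 < 0 compare both with t: q = t tanh (q pi/2) and t = p tanh (p pi/2)
  give q < t \<le> p, and the identities for p^2 - t^2 = p^2 / cosh^2 and t^2 - q^2 = q^2 / sinh^2
  bound both differences by 1. For \<mu> \<ge> 0 the parameter is below 0.7, so that p < 1.4. The
  bound 3 is what the gap between the third and fourth eigenvalues can absorb.\<close>

lemma first_second_gap:
  assumes t: "t \<ge> 0" and p: "p \<ge> 0" "p * sinh (p * (pi/2)) = t * cosh (p * (pi/2))"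
    and m: "robin_root t True \<mu>" "\<mu> \<le> 1"
  shows "- (p\<^sup>2) < \<mu>" "\<mu> + p\<^sup>2 < 3"
proof -
  have *: "- (p\<^sup>2) < \<mu> \<and> \<mu> + p\<^sup>2 < 3"
  proof (cases "\<mu> \<ge> 0")
    case True
    \<comment> \<open>If the second eigenvalue is \<alpha>^2 > 0, then t = \<alpha> cot (\<alpha>
      pi/2), and y cot y \<le> 1.\<close>
    have "t * (pi/2) \<le> 1"
    proof (cases "\<mu> = 0")
      case True
      then show ?thesis using m by (simp add: robin_root_def even_mode_def odd_mode_def)
    next
      case False
      define \<alpha> where "\<alpha> = sqrt \<mu>"
      have \<alpha>: "0 < \<alpha>" "\<alpha> \<le> 1" "\<mu> = \<alpha>\<^sup>2" using True False m by (auto simp: \<alpha>_def)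
      have e: "\<alpha> * cos (\<alpha> * (pi/2)) = t * sin (\<alpha> * (pi/2))" using m \<alpha> by (simp add: root_square_iff)
      have s: "sin (\<alpha> * (pi/2)) > 0" using \<alpha> by (intro sin_gt_zero) (auto intro: le_less_trans[of _ "1 * (pi/2)"])
      have "(\<alpha> * (pi/2)) * cos (\<alpha> * (pi/2)) \<le> sin (\<alpha> * (pi/2))"
        using \<alpha> mult_right_mono[of \<alpha> 1 "pi/2"] by (intro mult_cos_le_sin) auto
      then have "(t * (pi/2)) * sin (\<alpha> * (pi/2)) \<le> 1 * sin (\<alpha> * (pi/2))" using e by (simp add: mult_ac)
      then show ?thesis using s by (rule mult_right_le_imp_le)
    qed
    then have t2: "t < 7/10" using pi_gt3 mult_left_mono[of 3 pi t] t by simp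
    have "p < 14/10"
    proof (rule ccontr)
      assume "\<not> p < 14/10"
      then have p': "p \<ge> 14/10" by simp
      have "1 * 1 \<le> p * (pi/2)" using p' pi_gt3 by (intro mult_mono) auto
      then have "cosh (p * (pi/2)) / 2 \<le> sinh (p * (pi/2))" using cosh_le_2_sinh[of "p * (pi/2)"] p by simp
      then have "14/10 * (cosh (p * (pi/2)) / 2) \<le> p * sinh (p * (pi/2))"
        using p' cosh_real_pos[of "p * (pi/2)"] by (intro mult_mono) auto
      then have "7/10 * cosh (p * (pi/2)) \<le> t * cosh (p * (pi/2))" using p(2) by simp
      then have "7/10 \<le> t" by (rule mult_right_le_imp_le) (rule cosh_real_pos)
      then show False using t2 by simp
    qed
    then have "p\<^sup>2 \<le> (14/10)\<^sup>2" using p by (intro power_mono) auto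
    then have p2: "p\<^sup>2 \<le> 196/100" by (simp add: power2_eq_square)
    have "- (p\<^sup>2) < \<mu>"
    proof (cases "\<mu> = 0")
      case True
      then have "t \<noteq> 0" using m by (auto simp: robin_root_def even_mode_def odd_mode_def)
      then have "p \<noteq> 0" using p(2) by auto
      then show ?thesis using True by simp
    next
      case False
      then show ?thesis using True zero_le_power2[of p] by linarith
    qed
    then show ?thesis using p2 m by linarith
  next
    case False
    define q where "q = sqrt (- \<mu>)"
    have q: "q > 0" "\<mu> = - (q\<^sup>2)" using False by (auto simp: q_def)
    define P where "P = p * (pi/2)"
    define R where "R = q * (pi/2)"
    have R: "R > 0" "R \<le> sinh R" using q sinh_gt_self[of R] by (auto simp: R_def)
    have e: "q * cosh R = t * sinh R"
      using m q(1) unfolding q(2) robin_root_def R_def by (simp add: modes_at_negative_square[OF q(1)] field_simps)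
    have p: "p \<ge> 0" "p * sinh P = t * cosh P" using p by (simp_all add: P_def)
    have PP: "P\<^sup>2 \<le> (sinh P)\<^sup>2" using sinh_gt_self[of P] p by (cases "P = 0") (auto simp: P_def intro!: power_mono)
    have "q * cosh R > q * sinh R" using q sinh_less_cosh_real[of R] by simp
    then have "q < t" using e R by (simp add: mult_less_cancel_right)
    have "t * cosh P \<le> p * cosh P" using p sinh_less_cosh_real[of P] by (metis less_imp_le mult_left_mono)
    then have "t \<le> p" by (rule mult_right_le_imp_le) (rule cosh_real_pos)
    have "q\<^sup>2 < p\<^sup>2" using \<open>q < t\<close> \<open>t \<le> p\<close> q by (intro power_strict_mono) auto
    moreover have "p\<^sup>2 - t\<^sup>2 < 1"
    proof -
      have "(p\<^sup>2 - t\<^sup>2) * (cosh P)\<^sup>2 = p\<^sup>2 * (cosh P)\<^sup>2 - (t * cosh P)\<^sup>2" by (simp add: algebra_simps power_mult_distrib)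
      also have "\<dots> = p\<^sup>2" unfolding p(2)[symmetric] power_mult_distrib cosh_square_eq by (simp add: algebra_simps)
      also have "p\<^sup>2 \<le> P\<^sup>2"
        using p mult_left_mono[of 1 "pi/2" p] pi_gt3 by (intro power_mono) (auto simp: P_def)
      also have "\<dots> < (cosh P)\<^sup>2" using PP by (simp add: cosh_square_eq)
      finally have "(p\<^sup>2 - t\<^sup>2) * (cosh P)\<^sup>2 < 1 * (cosh P)\<^sup>2" by simp
      then show ?thesis by (rule mult_right_less_imp_less) simp
    qed
    moreover have "t\<^sup>2 - q\<^sup>2 \<le> 1"
    proof -
      have "(t\<^sup>2 - q\<^sup>2) * (sinh R)\<^sup>2 = (t * sinh R)\<^sup>2 - q\<^sup>2 * (sinh R)\<^sup>2" by (simp add: algebra_simps power_mult_distrib)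
      also have "\<dots> = q\<^sup>2" unfolding e[symmetric] power_mult_distrib cosh_square_eq by (simp add: algebra_simps)
      also have "q\<^sup>2 \<le> R\<^sup>2"
        using q mult_left_mono[of 1 "pi/2" q] pi_gt3 by (intro power_mono) (auto simp: R_def)
      also have "\<dots> \<le> (sinh R)\<^sup>2" using R by (intro power_mono) auto
      finally have "(t\<^sup>2 - q\<^sup>2) * (sinh R)\<^sup>2 \<le> 1 * (sinh R)\<^sup>2" by simp
      then show ?thesis by (rule mult_right_le_imp_le) (use R in auto)
    qed
    ultimately show ?thesis using q by simp
  qed
  then show "- (p\<^sup>2) < \<mu>" "\<mu> + p\<^sup>2 < 3" by auto
qed

section \<open>Numerical bounds\<close>

definition sin_taylor :: "real \<Rightarrow> real" where
  "sin_taylor x = x - x ^ 3 / 6 + x ^ 5 / 120 - x ^ 7 / 5040 + x ^ 9 / 362880"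

definition cos_taylor :: "real \<Rightarrow> real" where
  "cos_taylor x = 1 - x\<^sup>2 / 2 + x ^ 4 / 24 - x ^ 6 / 720 + x ^ 8 / 40320"

definition taylor_error :: "real \<Rightarrow> real" where
  "taylor_error x = x ^ 10 / 3628800"

lemma fact_values:
  "fact 3 = (6::real)" "fact 4 = (24::real)" "fact 5 = (120::real)" "fact 6 = (720::real)" "fact 7 = (5040::real)"
  "fact 8 = (40320::real)" "fact 9 = (362880::real)" "fact 10 = (3628800::real)"
  by (simp_all add: fact_numeral)

lemma sin_taylor_bound: "\<bar>sin x - sin_taylor x\<bar> \<le> taylor_error x"
proof -
  have s: "(\<Sum>m<10. sin_coeff m * x ^ m) = sin_taylor x"
    by (simp add: lessThan_nat_numeral lessThan_Suc sin_coeff_def sin_taylor_def fact_values del: fact_Suc)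
  then show ?thesis
    using Maclaurin_sin_bound[of x 10] unfolding s by (simp add: taylor_error_def fact_values)
qed

lemma cos_taylor_bound: "\<bar>cos x - cos_taylor x\<bar> \<le> taylor_error x"
proof -
  have s: "(\<Sum>m<10. cos_coeff m * x ^ m) = cos_taylor x"
    by (simp add: lessThan_nat_numeral lessThan_Suc cos_coeff_def cos_taylor_def fact_values del: fact_Suc)
  obtain t where "cos x = (\<Sum>m<10. cos_coeff m * x ^ m) + cos (t + 1/2 * real 10 * pi) / fact 10 * x ^ 10"
    using Maclaurin_cos_expansion[of x 10] by blast
  then have "\<bar>cos x - cos_taylor x\<bar> = \<bar>cos (t + 1/2 * real 10 * pi)\<bar> * (x ^ 10 / fact 10)"
    unfolding s by (simp add: abs_mult)
  also have "\<dots> \<le> 1 * (x ^ 10 / fact 10)" by (intro mult_right_mono) auto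
  finally show ?thesis by (simp add: taylor_error_def fact_values)
qed

text \<open>Sine equals 1/2 at \<open>pi/6\<close> and increases there; the Taylor polynomial
  separates its values at 0.5235987 and 0.5235988, which are then multiplied by six.\<close>

lemma pi_bounds: "31415922 / 10000000 < pi" "pi < 31415928 / 10000000"
proof -
  have s: "sin (pi/6) = 1/2" by (rule sin_30)
  have "sin_taylor (5235987/10000000) + taylor_error (5235987/10000000) < 1/2"
    by (simp add: sin_taylor_def taylor_error_def power_divide)
  then have c: "sin (5235987/10000000 :: real) < 1/2" using sin_taylor_bound[of "5235987/10000000"] by linarith
  show "31415922 / 10000000 < pi"
  proof (rule ccontr)
    assume "\<not> 31415922 / 10000000 < pi"
    then have "sin (pi/6) \<le> sin (5235987/10000000)" using pi_gt3 by (intro sin_monotone_2pi_le) linarith+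
    then show False using c s by simp
  qed
  have "1/2 < sin_taylor (5235988/10000000) - taylor_error (5235988/10000000)"
    by (simp add: sin_taylor_def taylor_error_def power_divide)
  then have c: "1/2 < sin (5235988/10000000 :: real)" using sin_taylor_bound[of "5235988/10000000"] by linarith
  show "pi < 31415928 / 10000000"
  proof (rule ccontr)
    assume "\<not> pi < 31415928 / 10000000"
    then have "sin (5235988/10000000) \<le> sin (pi/6)" using pi_gt3 by (intro sin_monotone_2pi_le) linarith+
    then show False using c s by simp
  qed
qed

text \<open>Reduces the claim to rational arithmetic: \<open>y\<close> rounds
  \<open>\<beta> * (pi/2)\<close> up, \<open>S\<close> bounds its sine from above and
  \<open>C\<close> its cosine from below. The condition \<open>y \<le> 3/2\<close> keeps
  \<open>y\<close> below \<open>pi/2\<close>, where both functions are monotone.\<close>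

lemma tan_upper:
  assumes "0 \<le> \<beta>" "\<beta> * (31415928 / 20000000) \<le> y" "y \<le> 3/2" "0 \<le> c" "0 \<le> t"
    and "sin_taylor y + taylor_error y \<le> S" "C \<le> cos_taylor y - taylor_error y" "c * S \<le> t * C"
  shows "c * sin (\<beta> * (pi/2)) \<le> t * cos (\<beta> * (pi/2))"
proof -
  have "\<beta> * (pi/2) \<le> \<beta> * (31415928 / 20000000)" using assms(1) pi_bounds by (intro mult_left_mono) auto
  from order_trans[OF this assms(2)] have b: "\<beta> * (pi/2) \<le> y" .
  have b': "0 \<le> \<beta> * (pi/2)" using assms(1) by simp
  have y: "y \<le> pi/2" using assms(3) pi_gt3 by simp
  have "sin (\<beta> * (pi/2)) \<le> sin y" using b b' y pi_gt3 by (intro sin_monotone_2pi_le) linarith+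
  then have "c * sin (\<beta> * (pi/2)) \<le> c * S"
    using sin_taylor_bound[of y] assms by (intro mult_left_mono) linarith+
  moreover have "cos y \<le> cos (\<beta> * (pi/2))" using b b' y pi_gt3 by (intro cos_monotone_0_pi_le) linarith+
  then have "t * C \<le> t * cos (\<beta> * (pi/2))"
    using cos_taylor_bound[of y] assms by (intro mult_left_mono) linarith+
  ultimately show ?thesis using assms by linarith
qed

lemma tan_lower:
  assumes "\<beta> \<le> 1" "0 \<le> y" "y \<le> \<beta> * (31415922 / 20000000)" "0 \<le> c" "0 \<le> t"
    and "cos_taylor y + taylor_error y \<le> C" "S \<le> sin_taylor y - taylor_error y" "t * C \<le> c * S"
  shows "t * cos (\<beta> * (pi/2)) \<le> c * sin (\<beta> * (pi/2))"
proof -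
  have "0 \<le> \<beta>" using assms(2,3) by (simp add: zero_le_mult_iff)
  then have "\<beta> * (31415922 / 20000000) \<le> \<beta> * (pi/2)" using pi_bounds by (intro mult_left_mono) auto
  then have b: "y \<le> \<beta> * (pi/2)" using assms by auto
  have y: "\<beta> * (pi/2) \<le> pi/2" using assms(1) by simp
  have "sin y \<le> sin (\<beta> * (pi/2))" using b y assms(2) pi_gt3 by (intro sin_monotone_2pi_le) linarith+
  then have "c * S \<le> c * sin (\<beta> * (pi/2))"
    using sin_taylor_bound[of y] assms by (intro mult_left_mono) linarith+
  moreover have "cos (\<beta> * (pi/2)) \<le> cos y" using b y assms(2) pi_gt3 by (intro cos_monotone_0_pi_le) linarith+
  then have "t * cos (\<beta> * (pi/2)) \<le> t * C"
    using cos_taylor_bound[of y] assms by (intro mult_left_mono) linarith+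
  ultimately show ?thesis using assms by linarith
qed

definition exp_taylor :: "real \<Rightarrow> real" where
  "exp_taylor x = 1 + x + x\<^sup>2 / 2 + x ^ 3 / 6 + x ^ 4 / 24 + x ^ 5 / 120 + x ^ 6 / 720"

text \<open>The Lagrange remainder has a factor of at most exp 1 \<le> 3 on the unit interval, and
  3/5040 = 1/1680.\<close>

lemma exp_taylor_bounds:
  assumes "0 \<le> x" "x \<le> 1"
  shows "exp_taylor x \<le> exp x" "exp x \<le> exp_taylor x + x ^ 7 / 1680"
proof -
  have s: "(\<Sum>m<7. x ^ m / fact m) = exp_taylor x"
    by (simp add: lessThan_nat_numeral lessThan_Suc exp_taylor_def fact_values del: fact_Suc)
  obtain t where t: "\<bar>t\<bar> \<le> \<bar>x\<bar>" "exp x = (\<Sum>m<7. x ^ m / fact m) + exp t / fact 7 * x ^ 7"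
    using Maclaurin_exp_le[of x 7] by blast
  have "exp t \<le> exp 1" using t(1) assms by simp
  then have "exp t \<le> 3" using exp_le by linarith
  then have "exp t / 5040 * x ^ 7 \<le> 3 / 5040 * x ^ 7" using assms by (intro mult_right_mono) auto
  moreover have "0 \<le> exp t / 5040 * x ^ 7" using assms by simp
  ultimately show "exp_taylor x \<le> exp x" "exp x \<le> exp_taylor x + x ^ 7 / 1680"
    using t(2) unfolding s fact_values by linarith+
qed

lemma sinh_cosh_le_iff: "t * cosh (y::real) \<le> p * sinh y \<longleftrightarrow> t + p \<le> (p - t) * exp (2 * y)"
proof -
  have *: "exp (2 * y) * exp (- y) = exp y" by (simp flip: exp_add)
  have "p * sinh y - t * cosh y = ((p - t) * exp y - (t + p) * exp (- y)) / 2"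
    by (simp add: cosh_field_def sinh_field_def field_simps)
  moreover have "A - B = (C - D) / 2 \<Longrightarrow> B \<le> A \<longleftrightarrow> D \<le> C" for A B C D :: real
    by auto
  ultimately have "t * cosh y \<le> p * sinh y \<longleftrightarrow> (t + p) * exp (- y) \<le> (p - t) * exp y" by blast
  also have "(p - t) * exp y = (p - t) * exp (2 * y) * exp (- y)" by (simp only: mult.assoc *)
  also have "(t + p) * exp (- y) \<le> \<dots> \<longleftrightarrow> t + p \<le> (p - t) * exp (2 * y)" by simp
  finally show ?thesis .
qed

text \<open>The exponential of \<open>p * pi\<close> is compared with the eighth power of
  \<open>exp x\<close>, where \<open>x\<close> is small enough for the Taylor polynomial.\<close>

lemma tanh_lower:
  assumes "0 \<le> x" "x \<le> 1" "8 * x \<le> p * (31415922 / 10000000)" "0 \<le> p" "t \<le> p"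
    and "0 \<le> e" "e \<le> exp_taylor x" "t + p \<le> (p - t) * e ^ 8"
  shows "t * cosh (p * (pi/2)) \<le> p * sinh (p * (pi/2))"
proof -
  have "p * (31415922 / 10000000) \<le> p * pi" using assms pi_bounds by (intro mult_left_mono) auto
  then have "8 * x \<le> 2 * (p * (pi/2))" using assms by simp
  have "e ^ 8 \<le> exp x ^ 8" using exp_taylor_bounds(1)[OF assms(1,2)] assms by (intro power_mono) linarith+
  also have "\<dots> = exp (8 * x)" by (simp flip: exp_of_nat_mult)
  also have "\<dots> \<le> exp (2 * (p * (pi/2)))" using \<open>8 * x \<le> 2 * (p * (pi/2))\<close> by simp
  finally have "(p - t) * e ^ 8 \<le> (p - t) * exp (2 * (p * (pi/2)))"
    using assms by (intro mult_left_mono) auto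
  then show ?thesis unfolding sinh_cosh_le_iff using assms by linarith
qed

lemma tanh_upper:
  assumes "0 \<le> x" "x \<le> 1" "p * (31415928 / 10000000) \<le> 8 * x" "0 \<le> p" "t \<le> p"
    and "exp_taylor x + x ^ 7 / 1680 \<le> e" "(p - t) * e ^ 8 < t + p"
  shows "p * sinh (p * (pi/2)) < t * cosh (p * (pi/2))"
proof -
  have "p * pi \<le> p * (31415928 / 10000000)" using assms pi_bounds by (intro mult_left_mono) auto
  then have "2 * (p * (pi/2)) \<le> 8 * x" using assms by simp
  then have "exp (2 * (p * (pi/2))) \<le> exp (8 * x)" by simp
  also have "\<dots> = exp x ^ 8" by (simp flip: exp_of_nat_mult)
  also have "\<dots> \<le> e ^ 8" using exp_taylor_bounds(2)[OF assms(1,2)] assms by (intro power_mono) (linarith, simp)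
  finally have "(p - t) * exp (2 * (p * (pi/2))) \<le> (p - t) * e ^ 8"
    using assms by (intro mult_left_mono) auto
  then have "\<not> t * cosh (p * (pi/2)) \<le> p * sinh (p * (pi/2))"
    unfolding sinh_cosh_le_iff using assms by linarith
  then show ?thesis by simp
qed

text \<open>Rational bounds for \<open>a\<close>, \<open>b\<close>, \<open>p\<close> at \<open>t = 0.9, 1.16, 1.38, 1.62925, 1.62935\<close> in this order, where the
  first three values subdivide the range of small \<open>t\<close> and the last two enclose the crossing. The equations
  for \<open>a\<close> and \<open>b\<close> are rewritten in terms of \<open>2 - a\<close> and \<open>3 - b\<close>, to keep the arguments small.\<close>

lemma numeric_a_1: "17/10 * sin (3/10 * (pi/2)) \<le> 9/10 * cos (3/10 * (pi/2))"
  by (rule tan_upper[where y = "59/125" and S = "4547/10000" and C = "4453/5000"])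
     (simp_all add: sin_taylor_def cos_taylor_def taylor_error_def power_divide)

lemma numeric_a_2: "161/100 * sin (39/100 * (pi/2)) \<le> 29/25 * cos (39/100 * (pi/2))"
  by (rule tan_upper[where y = "613/1000" and S = "2877/5000" and C = "8179/10000"])
     (simp_all add: sin_taylor_def cos_taylor_def taylor_error_def power_divide)

lemma numeric_a_3: "77/50 * sin (23/50 * (pi/2)) \<le> 69/50 * cos (23/50 * (pi/2))"
  by (rule tan_upper[where y = "723/1000" and S = "6617/10000" and C = "3749/5000"])
     (simp_all add: sin_taylor_def cos_taylor_def taylor_error_def power_divide)

lemma numeric_a_4: "293317/200000 * sin (106683/200000 * (pi/2)) \<le> 6517/4000 * cos (106683/200000 * (pi/2))"
  by (rule tan_upper[where y = "837887/1000000" and S = "929039/1250000" and C = "6690347/10000000"])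
     (simp_all add: sin_taylor_def cos_taylor_def taylor_error_def power_divide)

lemma numeric_a_5: "32587/20000 * cos (10669/20000 * (pi/2)) \<le> 29331/20000 * sin (10669/20000 * (pi/2))"
  by (rule tan_lower[where y = "837941/1000000" and S = "7432671/10000000" and C = "1672487/2500000"])
     (simp_all add: sin_taylor_def cos_taylor_def taylor_error_def power_divide)

lemma numeric_b_2: "29/25 * cos (13/50 * (pi/2)) \<le> 137/50 * sin (13/50 * (pi/2))"
  by (rule tan_lower[where y = "51/125" and S = "3967/10000" and C = "459/500"])
     (simp_all add: sin_taylor_def cos_taylor_def taylor_error_def power_divide)

lemma numeric_b_3: "69/50 * cos (31/100 * (pi/2)) \<le> 269/100 * sin (31/100 * (pi/2))"
  by (rule tan_lower[where y = "243/500" and S = "467/1000" and C = "8843/10000"])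
     (simp_all add: sin_taylor_def cos_taylor_def taylor_error_def power_divide)

lemma numeric_b_4: "6517/4000 * cos (7021/20000 * (pi/2)) \<le> 52979/20000 * sin (7021/20000 * (pi/2))"
  by (rule tan_lower[where y = "551427/1000000" and S = "654879/1250000" and C = "4258889/5000000"])
     (simp_all add: sin_taylor_def cos_taylor_def taylor_error_def power_divide)

lemma numeric_b_5: "165559/62500 * sin (21941/62500 * (pi/2)) \<le> 32587/20000 * cos (21941/62500 * (pi/2))"
  by (rule tan_upper[where y = "275719/500000" and S = "5239127/10000000" and C = "212943/250000"])
     (simp_all add: sin_taylor_def cos_taylor_def taylor_error_def power_divide)

lemma numeric_p_1: "9/10 * cosh (1 * (pi/2)) \<le> 1 * sinh (1 * (pi/2))"
  by (rule tanh_lower[where x = "49/125" and e = "1479/1000"])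
     (simp_all add: exp_taylor_def power_divide)

lemma numeric_p_2: "29/25 * cosh (13/10 * (pi/2)) \<le> 13/10 * sinh (13/10 * (pi/2))"
  by (rule tanh_lower[where x = "51/100" and e = "333/200"])
     (simp_all add: exp_taylor_def power_divide)

lemma numeric_p_3: "69/50 * cosh (71/50 * (pi/2)) \<le> 71/50 * sinh (71/50 * (pi/2))"
  by (rule tanh_lower[where x = "557/1000" and e = "349/200"])
     (simp_all add: exp_taylor_def power_divide)

lemma numeric_p_4: "6517/4000 * cosh (329553/200000 * (pi/2)) \<le> 329553/200000 * sinh (329553/200000 * (pi/2))"
  by (rule tanh_lower[where x = "64707/100000" and e = "11937/6250"])
     (simp_all add: exp_taylor_def power_divide)

lemma numeric_p_5: "329569/200000 * sinh (329569/200000 * (pi/2)) < 32587/20000 * cosh (329569/200000 * (pi/2))"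
  by (rule tanh_upper[where x = "64711/100000" and e = "47751/25000"])
     (simp_all add: exp_taylor_def power_divide)

text \<open>Bounds the tangent at 23/50 = 2 - 77/50 from below, and hence the squared cosine in
  \<open>third_slope\<close> from above.\<close>

lemma numeric_c: "22/25 * cos (23/50 * (pi/2)) \<le> 1 * sin (23/50 * (pi/2))"
  by (rule tan_lower[where y = "361/500" and S = "413/625" and C = "1501/2000"])
     (simp_all add: sin_taylor_def cos_taylor_def taylor_error_def power_divide)

section \<open>Comparison of \<open>2a\<^sup>2\<close> and \<open>b\<^sup>2 - p\<^sup>2\<close>\<close>

text \<open>The first, third and fourth eigenvalues in dimension one are \<open>-p\<^sup>2\<close>, \<open>a\<^sup>2\<close> and \<open>b\<^sup>2\<close>.\<close>

definition first_eq :: "real \<Rightarrow> real \<Rightarrow> bool" where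
  "first_eq t p \<longleftrightarrow> p \<ge> 0 \<and> p * sinh (p * (pi/2)) = t * cosh (p * (pi/2))"

definition third_fun :: "real \<Rightarrow> real" where
  "third_fun a = - (a * (sin (a * (pi/2)) / cos (a * (pi/2))))"

definition third_eq :: "real \<Rightarrow> real \<Rightarrow> bool" where
  "third_eq t a \<longleftrightarrow> 1 < a \<and> a \<le> 2 \<and> third_fun a = t"

definition fourth_fun :: "real \<Rightarrow> real" where
  "fourth_fun b = b * (cos (b * (pi/2)) / sin (b * (pi/2)))"

definition fourth_eq :: "real \<Rightarrow> real \<Rightarrow> bool" where
  "fourth_eq t b \<longleftrightarrow> 2 < b \<and> b \<le> 3 \<and> fourth_fun b = t"

section \<open>Monotone dependence of the roots on the parameter\<close>

lemma third_fun_le_iff: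
  assumes "1 < a" "a \<le> 2" "1 < b" "b \<le> 2"
  shows "third_fun a \<le> third_fun b \<longleftrightarrow> b \<le> a"
  using mult_tan_strict_mono[of a b] mult_tan_strict_mono[of b a] assms
  by (cases a b rule: linorder_cases) (auto simp: third_fun_def)

lemma fourth_fun_le_iff:
  assumes "2 < a" "a \<le> 3" "2 < b" "b \<le> 3"
  shows "fourth_fun a \<le> fourth_fun b \<longleftrightarrow> b \<le> a"
  using mult_cot_strict_antimono[of a b] mult_cot_strict_antimono[of b a] assms
  by (cases a b rule: linorder_cases) (auto simp: fourth_fun_def)

definition first_fun :: "real \<Rightarrow> real" where
  "first_fun p = p * (sinh (p * (pi/2)) / cosh (p * (pi/2)))"

lemma first_eq_iff: "first_eq t p \<longleftrightarrow> 0 \<le> p \<and> first_fun p = t"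
  using cosh_real_pos[of "p * (pi/2)"] by (auto simp: first_eq_def first_fun_def field_simps)

lemma DERIV_first_fun:
  "(first_fun has_real_derivative (sinh (p * (pi/2)) * cosh (p * (pi/2)) + p * (pi/2)) / (cosh (p * (pi/2)))\<^sup>2) (at p)"
proof -
  let ?y = "p * (pi/2)"
  have c: "cosh ?y \<noteq> 0" using cosh_real_pos[of ?y] by simp
  have "(first_fun has_real_derivative 1 * (sinh ?y / cosh ?y) +
     (cosh ?y * (pi/2) * cosh ?y - sinh ?y * (sinh ?y * (pi/2))) / (cosh ?y * cosh ?y) * p) (at p)"
    unfolding first_fun_def[abs_def]
    by (intro DERIV_mult DERIV_divide DERIV_ident c) (auto intro!: derivative_eq_intros)
  moreover have "cosh ?y * (pi/2) * cosh ?y - sinh ?y * (sinh ?y * (pi/2)) = (pi/2) * ((cosh ?y)\<^sup>2 - (sinh ?y)\<^sup>2)"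
    by (simp only: power2_eq_square algebra_simps)
  then have "cosh ?y * (pi/2) * cosh ?y - sinh ?y * (sinh ?y * (pi/2)) = pi/2"
    unfolding cosh_square_eq by simp
  moreover have "1 * (s / k) + pi/2 / (k * k) * p = (s * k + p * (pi/2)) / k\<^sup>2" if "k \<noteq> 0" for s k :: real
    using that by (simp add: field_simps power2_eq_square)
  ultimately show ?thesis using c by (simp only: not_False_eq_True)
qed

lemma first_fun_strict_mono:
  assumes "0 \<le> p" "p < q"
  shows "first_fun p < first_fun q"
proof -
  have "sinh y / cosh y = tanh y" for y :: real by (simp add: tanh_def)
  then have "first_fun p \<le> p * tanh (q * (pi/2))"
    unfolding first_fun_def using assms by (simp add: mult_left_mono)
  also have "\<dots> < q * tanh (q * (pi/2))" using assms by (intro mult_strict_right_mono) auto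
  finally show ?thesis by (simp add: first_fun_def tanh_def)
qed

lemma first_fun_le_iff: "0 \<le> p \<Longrightarrow> 0 \<le> q \<Longrightarrow> first_fun p \<le> first_fun q \<longleftrightarrow> p \<le> q"
  using first_fun_strict_mono[of p q] first_fun_strict_mono[of q p] by (cases p q rule: linorder_cases) auto

text \<open>As \<open>third_fun\<close> is decreasing, one check at the rational point
  \<open>a0\<close> for the parameter \<open>t0\<close> bounds the root for all larger parameters.
  The other bounds below work in the same way.\<close>

lemma third_le:
  assumes "third_eq t a" "1 < a0" "a0 < 2" "a0 * sin ((2 - a0) * (pi/2)) \<le> t0 * cos ((2 - a0) * (pi/2))" "t0 \<le> t"
  shows "a \<le> a0"
proof -
  have e: "(2 - a0) * (pi/2) = pi - a0 * (pi/2)" by (simp add: field_simps)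
  have s: "sin ((2 - a0) * (pi/2)) = sin (a0 * (pi/2))" "cos ((2 - a0) * (pi/2)) = - cos (a0 * (pi/2))"
    unfolding e by simp_all
  have c: "cos (a0 * (pi/2)) < 0" using trig_signs[of a0] assms by simp
  have "third_fun a0 \<le> t0" using assms(4) c unfolding s third_fun_def by (simp add: field_simps)
  then show ?thesis using third_fun_le_iff[of a0 a] assms by (simp add: third_eq_def)
qed

lemma third_ge:
  assumes "third_eq t a" "1 < a0" "a0 < 2" "t * cos ((2 - a0) * (pi/2)) \<le> a0 * sin ((2 - a0) * (pi/2))"
  shows "a0 \<le> a"
proof -
  have e: "(2 - a0) * (pi/2) = pi - a0 * (pi/2)" by (simp add: field_simps)
  have s: "sin ((2 - a0) * (pi/2)) = sin (a0 * (pi/2))" "cos ((2 - a0) * (pi/2)) = - cos (a0 * (pi/2))"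
    unfolding e by simp_all
  have c: "cos (a0 * (pi/2)) < 0" using trig_signs[of a0] assms by simp
  have "t \<le> third_fun a0" using assms(4) c unfolding s third_fun_def by (simp add: field_simps)
  then show ?thesis using third_fun_le_iff[of a a0] assms by (simp add: third_eq_def)
qed

lemma fourth_fun_complement:
  assumes "2 < b" "b < 3"
  shows "cos ((3 - b) * (pi/2)) > 0"
    "fourth_fun b = b * (sin ((3 - b) * (pi/2)) / cos ((3 - b) * (pi/2)))"
proof -
  have e: "b * (pi/2) = pi + (pi/2 - (3 - b) * (pi/2))" by (simp add: field_simps)
  have s: "sin (b * (pi/2)) = - cos ((3 - b) * (pi/2))" "cos (b * (pi/2)) = - sin ((3 - b) * (pi/2))"
    unfolding e sin_periodic_pi2 cos_periodic_pi2 by (simp_all add: sin_diff cos_diff)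
  show "cos ((3 - b) * (pi/2)) > 0" using trig_signs'[of b] assms s by simp
  then show "fourth_fun b = b * (sin ((3 - b) * (pi/2)) / cos ((3 - b) * (pi/2)))"
    unfolding fourth_fun_def s by simp
qed

lemma fourth_ge:
  assumes "fourth_eq t b" "2 < b0" "b0 < 3" "t0 * cos ((3 - b0) * (pi/2)) \<le> b0 * sin ((3 - b0) * (pi/2))" "t \<le> t0"
  shows "b0 \<le> b"
proof -
  have "t0 \<le> fourth_fun b0" using assms(4) fourth_fun_complement(1)[OF assms(2,3)]
    unfolding fourth_fun_complement(2)[OF assms(2,3)] by (simp add: pos_le_divide_eq)
  then show ?thesis using fourth_fun_le_iff[of b b0] assms by (simp add: fourth_eq_def)
qed

lemma fourth_le:
  assumes "fourth_eq t b" "2 < b0" "b0 < 3" "b0 * sin ((3 - b0) * (pi/2)) \<le> t * cos ((3 - b0) * (pi/2))"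
  shows "b \<le> b0"
proof -
  have "fourth_fun b0 \<le> t" using assms(4) fourth_fun_complement(1)[OF assms(2,3)]
    unfolding fourth_fun_complement(2)[OF assms(2,3)] by (simp add: pos_divide_le_eq)
  then show ?thesis using fourth_fun_le_iff[of b0 b] assms by (simp add: fourth_eq_def)
qed

lemma first_le:
  assumes "first_eq t p" "0 \<le> p0" "t0 * cosh (p0 * (pi/2)) \<le> p0 * sinh (p0 * (pi/2))" "t \<le> t0"
  shows "p \<le> p0"
proof -
  have "t0 \<le> first_fun p0" using assms(3) cosh_real_pos[of "p0 * (pi/2)"] unfolding first_fun_def by (simp add: field_simps)
  then show ?thesis using first_fun_le_iff[of p p0] assms by (simp add: first_eq_iff)
qed

lemma first_ge:
  assumes "first_eq t p" "0 \<le> p0" "p0 * sinh (p0 * (pi/2)) < t * cosh (p0 * (pi/2))"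
  shows "p0 \<le> p"
proof -
  have "first_fun p0 \<le> t" using assms(3) cosh_real_pos[of "p0 * (pi/2)"] unfolding first_fun_def by (simp add: field_simps)
  then show ?thesis using first_fun_le_iff[of p0 p] assms by (simp add: first_eq_iff)
qed

lemma first_ge_parameter:
  assumes "first_eq t p" "t \<ge> 0"
  shows "t \<le> p"
proof -
  have "p * tanh (p * (pi/2)) \<le> p * 1"
    using assms tanh_real_lt_1[of "p * (pi/2)"] by (intro mult_left_mono) (auto simp: first_eq_def)
  then show ?thesis using assms by (simp add: first_eq_iff first_fun_def tanh_def)
qed

text \<open>On a range of parameters \<open>a\<close> is largest at the left end, \<open>b\<close>
  smallest and \<open>p\<close> largest at the right end. So each range needs only bounds at its
  ends.\<close>

lemma comparison_small:
  assumes t: "0 \<le> t" "t \<le> 69/50" and p: "first_eq t p" and a: "third_eq t a" and b: "fourth_eq t b" and ab: "a + 1 \<le> b"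
  shows "2 * a\<^sup>2 \<le> b\<^sup>2 - p\<^sup>2"
proof -
  have p0: "p \<ge> 0" and a1: "1 < a" "a \<le> 2" and b2: "2 < b" using p a b by (auto simp: first_eq_def third_eq_def fourth_eq_def)
  have comb: "2 * a\<^sup>2 \<le> b\<^sup>2 - p\<^sup>2" if "a \<le> a0" "b0 \<le> b" "p \<le> p0'" "2 * a0\<^sup>2 \<le> b0\<^sup>2 - p0'\<^sup>2" "0 \<le> b0" for a0 b0 p0'
  proof -
    have "a\<^sup>2 \<le> a0\<^sup>2" "b0\<^sup>2 \<le> b\<^sup>2" "p\<^sup>2 \<le> p0'\<^sup>2" using that p0 a1 by (auto intro!: power_mono)
    then show ?thesis using that by linarith
  qed
  consider "t \<le> 9/10" | "9/10 \<le> t" "t \<le> 29/25" | "29/25 \<le> t" by linarith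
  then show ?thesis
  proof cases
    case 1
    \<comment> \<open>For these parameters p \<le> 1 and b \<ge> a + 1 suffice: (a + 1)^2 - 1 - 2a^2
      = 1 - (a - 1)^2 \<ge> 0.\<close>
    have "p \<le> 1" by (rule first_le[OF p _ numeric_p_1 1]) simp
    then have "p\<^sup>2 \<le> 1\<^sup>2" using p0 by (intro power_mono) auto
    moreover have "(a + 1)\<^sup>2 \<le> b\<^sup>2" using ab a1 by (intro power_mono) auto
    moreover have "(a - 1)\<^sup>2 \<le> 1\<^sup>2" using a1 by (intro power_mono) auto
    ultimately show ?thesis by (simp add: power2_eq_square algebra_simps)
  next
    case 2
    show ?thesis
    proof (rule comb)
      show "a \<le> 17/10" by (rule third_le[OF a _ _ _ 2(1)]) (use numeric_a_1 in simp_all)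
      show "137/50 \<le> b" by (rule fourth_ge[OF b _ _ _ 2(2)]) (use numeric_b_2 in simp_all)
      show "p \<le> 13/10" by (rule first_le[OF p _ numeric_p_2 2(2)]) simp
    qed (simp_all add: power2_eq_square)
  next
    case 3
    show ?thesis
    proof (rule comb)
      show "a \<le> 161/100" by (rule third_le[OF a _ _ _ 3]) (use numeric_a_2 in simp_all)
      show "269/100 \<le> b" by (rule fourth_ge[OF b _ _ _ t(2)]) (use numeric_b_3 in simp_all)
      show "p \<le> 71/50" by (rule first_le[OF p _ numeric_p_3 t(2)]) simp
    qed (simp_all add: power2_eq_square)
  qed
qed

text \<open>A bound on the rate of 2a^2 in t that avoids differentiating the inverse function: with
  t = \<open>third_fun a\<close> the sum 2a^2 + (43/20) t is nonincreasing in a. The restriction to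
  a \<le> 77/50 keeps the squared cosine in the denominator small.\<close>

lemma third_slope:
  assumes "1 < a" "a \<le> b" "b \<le> 77/50"
  shows "2 * b\<^sup>2 + 43/20 * third_fun b \<le> 2 * a\<^sup>2 + 43/20 * third_fun a"
proof (rule DERIV_nonpos_imp_nonincreasing[OF assms(2)])
  fix x assume "a \<le> x" "x \<le> b"
  then have x: "1 < x" "x \<le> 77/50" using assms by auto
  let ?y = "x * (pi/2)"
  have c: "cos ?y < 0" using trig_signs[of x] x by simp
  have "((\<lambda>x. 2 * x\<^sup>2 + 43/20 * third_fun x) has_real_derivative
     2 * (2 * x) + 43/20 * (- ((sin ?y * cos ?y + ?y) / (cos ?y)\<^sup>2))) (at x)"
    unfolding third_fun_def by (intro DERIV_add DERIV_cmult DERIV_minus DERIV_mult_tan)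
      (use c in \<open>auto intro!: derivative_eq_intros\<close>)
  moreover have "2 * (2 * x) + 43/20 * (- ((sin ?y * cos ?y + ?y) / (cos ?y)\<^sup>2)) \<le> 0"
  proof -
    have e: "(23/50 :: real) * (pi/2) \<le> (2 - x) * (pi/2)" using x by (intro mult_right_mono) auto
    have "(2 - x) * (pi/2) = pi - ?y" by (simp add: field_simps)
    then have "cos ((2 - x) * (pi/2)) = - cos ?y" by (simp only: cos_pi_minus)
    moreover have "cos ((2 - x) * (pi/2)) \<le> cos (23/50 * (pi/2))"
      by (rule cos_monotone_0_pi_le[OF _ e]) (use x in \<open>auto simp: field_simps\<close>)
    ultimately have "- cos ?y \<le> cos (23/50 * (pi/2))" by simp
    then have "(cos ?y)\<^sup>2 \<le> (cos (23/50 * (pi/2)))\<^sup>2"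
      using c power_mono[of "- cos ?y" "cos (23/50 * (pi/2))" 2] by simp
    \<comment> \<open>A tangent of at least 0.88 means a squared cosine of at most 1 / (1 + 0.88^2),
      which is about 0.56357.\<close>
    moreover have "(cos (23/50 * (pi/2)))\<^sup>2 \<le> 5637/10000"
    proof -
      have "(22/25 * cos (23/50 * (pi/2)))\<^sup>2 \<le> (sin (23/50 * (pi/2)))\<^sup>2"
        using numeric_c cos_ge_zero[of "23/50 * (pi/2)"] by (intro power_mono) auto
      then have "(22/25)\<^sup>2 * (cos (23/50 * (pi/2)))\<^sup>2 \<le> 1 - (cos (23/50 * (pi/2)))\<^sup>2"
        by (simp only: sin_squared_eq power_mult_distrib)
      moreover have "z \<le> 5637/10000" if "(22/25)\<^sup>2 * z \<le> 1 - z" for z :: real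
        using that by (simp add: power2_eq_square)
      ultimately show ?thesis by blast
    qed
    ultimately have c2: "(cos ?y)\<^sup>2 \<le> 5637/10000" by linarith
    have "0 \<le> (sin ?y + cos ?y)\<^sup>2" by simp
    then have "- 1/2 \<le> sin ?y * cos ?y"
      using sin_cos_squared_add[of ?y] by (simp add: power2_sum)
    moreover have "157/100 * x \<le> ?y" using pi_bounds x by simp
    ultimately have "157/100 * x - 1/2 \<le> sin ?y * cos ?y + ?y" by linarith
    then have "43/20 * (157/100 * x - 1/2) \<le> 43/20 * (sin ?y * cos ?y + ?y)" by (rule mult_left_mono) simp
    moreover have "4 * x * (cos ?y)\<^sup>2 \<le> 4 * x * (5637/10000)" using c2 x by (intro mult_left_mono) auto
    moreover have "4 * x * (5637/10000) \<le> 43/20 * (157/100 * x - 1/2)" using x by simp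
    ultimately have "4 * x * (cos ?y)\<^sup>2 \<le> 43/20 * (sin ?y * cos ?y + ?y)" by linarith
    then have "4 * x \<le> 43/20 * (sin ?y * cos ?y + ?y) / (cos ?y)\<^sup>2"
      using c by (simp add: pos_le_divide_eq)
    then show ?thesis by simp
  qed
  ultimately show "\<exists>y. ((\<lambda>x. 2 * x\<^sup>2 + 43/20 * third_fun x) has_real_derivative y) (at x) \<and> y \<le> 0" by blast
qed

text \<open>The tangent of the exponential at 2, with exp 2 \<ge> 7.29, gives cosh y \<ge> 3.645 (y
  - 1), and 3.645^2 > 13. It makes y / cosh^2 y at most 1/5 in
  \<open>first_slope_lower\<close>.\<close>

lemma cosh_squared_ge: "2 \<le> y \<Longrightarrow> 5 * y \<le> (cosh (y::real))\<^sup>2"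
proof -
  assume y: "2 \<le> y"
  have "27/10 \<le> exp (1::real)" using exp_taylor_bounds(1)[of 1] by (simp add: exp_taylor_def)
  then have "(27/10)\<^sup>2 \<le> (exp (1::real))\<^sup>2" by (intro power_mono) auto
  then have e: "729/100 \<le> exp (2::real)" by (simp add: power2_eq_square flip: exp_add)
  have "729/100 * (y - 1) \<le> exp 2 * exp (y - 2)"
    using e exp_ge_add_one_self[of "y - 2"] y by (intro mult_mono) auto
  also have "\<dots> = exp y" by (simp flip: exp_add)
  also have "\<dots> \<le> 2 * cosh y" by (simp add: cosh_field_def)
  finally have "(729/200 * (y - 1))\<^sup>2 \<le> (cosh y)\<^sup>2" using y by (intro power_mono) auto
  moreover have "5 * y \<le> 13 * (y - 1)\<^sup>2"
  proof -
    have "0 \<le> (y - 2) * (13 * y - 5)" using y by (intro mult_nonneg_nonneg) auto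
    then show ?thesis by (simp add: power2_eq_square algebra_simps)
  qed
  moreover have "13 * (y - 1)\<^sup>2 \<le> (729/200 * (y - 1))\<^sup>2"
    unfolding power_mult_distrib by (intro mult_right_mono) (auto simp: power2_eq_square)
  ultimately show ?thesis by linarith
qed

text \<open>The derivative of \<open>first_fun\<close> is tanh y + y / cosh^2 y with y = x pi/2,
  hence at most 1 + 1/5. So p^2 grows in t at rate at least 2p / (6/5), and for p \<ge> 1.38 this is
  at least 2.3, the constant in the statement.\<close>

lemma first_slope_lower:
  assumes "69/50 \<le> p" "p \<le> q"
  shows "p\<^sup>2 - 23/10 * first_fun p \<le> q\<^sup>2 - 23/10 * first_fun q"
proof (rule DERIV_nonneg_imp_nondecreasing[OF assms(2)])
  fix x assume "p \<le> x" "x \<le> q"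
  then have x: "69/50 \<le> x" using assms by auto
  let ?y = "x * (pi/2)"
  have "((\<lambda>x. x\<^sup>2 - 23/10 * first_fun x) has_real_derivative
     2 * x - 23/10 * ((sinh ?y * cosh ?y + ?y) / (cosh ?y)\<^sup>2)) (at x)"
    by (intro DERIV_diff DERIV_cmult DERIV_first_fun) (auto intro!: derivative_eq_intros)
  moreover have "0 \<le> 2 * x - 23/10 * ((sinh ?y * cosh ?y + ?y) / (cosh ?y)\<^sup>2)"
  proof -
    have "69/50 * (3/2) \<le> x * (pi/2)" using x pi_gt3 by (intro mult_mono) auto
    then have "?y \<le> (cosh ?y)\<^sup>2 / 5" using cosh_squared_ge[of ?y] by simp
    moreover have "sinh ?y * cosh ?y \<le> (cosh ?y)\<^sup>2"
      unfolding power2_eq_square using sinh_less_cosh_real[of ?y] by (intro mult_right_mono) (auto intro: less_imp_le cosh_real_pos)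
    ultimately have "sinh ?y * cosh ?y + ?y \<le> 6/5 * (cosh ?y)\<^sup>2" by simp
    then have "(sinh ?y * cosh ?y + ?y) / (cosh ?y)\<^sup>2 \<le> 6/5"
      using cosh_real_pos[of ?y] by (simp add: pos_divide_le_eq)
    moreover have "Q \<le> 6/5 \<Longrightarrow> 0 \<le> 2 * x - 23/10 * Q" for Q using x by linarith
    ultimately show ?thesis by blast
  qed
  ultimately show "\<exists>y. ((\<lambda>x. x\<^sup>2 - 23/10 * first_fun x) has_real_derivative y) (at x) \<and> 0 \<le> y" by blast
qed

text \<open>The derivative of \<open>first_fun\<close> is at least 1/2, so p^2 grows in t at rate at
  most 4p \<le> 16.\<close>

lemma first_slope_upper:
  assumes "1 \<le> p" "p \<le> q" "q \<le> 4"
  shows "q\<^sup>2 - 16 * first_fun q \<le> p\<^sup>2 - 16 * first_fun p"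
proof (rule DERIV_nonpos_imp_nonincreasing[OF assms(2)])
  fix x assume "p \<le> x" "x \<le> q"
  then have x: "1 \<le> x" "x \<le> 4" using assms by auto
  let ?y = "x * (pi/2)"
  have "((\<lambda>x. x\<^sup>2 - 16 * first_fun x) has_real_derivative
     2 * x - 16 * ((sinh ?y * cosh ?y + ?y) / (cosh ?y)\<^sup>2)) (at x)"
    by (intro DERIV_diff DERIV_cmult DERIV_first_fun) (auto intro!: derivative_eq_intros)
  moreover have "2 * x - 16 * ((sinh ?y * cosh ?y + ?y) / (cosh ?y)\<^sup>2) \<le> 0"
  proof -
    have y: "1 * 1 \<le> x * (pi/2)" using x pi_gt3 by (intro mult_mono) auto
    then have "cosh ?y / 2 * cosh ?y \<le> sinh ?y * cosh ?y"
      using cosh_le_2_sinh[of ?y] by (intro mult_right_mono) (auto intro: less_imp_le cosh_real_pos)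
    moreover have "1/2 * (cosh ?y)\<^sup>2 = cosh ?y / 2 * cosh ?y" by (simp add: power2_eq_square)
    ultimately have "1/2 * (cosh ?y)\<^sup>2 \<le> sinh ?y * cosh ?y + ?y" using y by linarith
    then have "1/2 \<le> (sinh ?y * cosh ?y + ?y) / (cosh ?y)\<^sup>2"
      using cosh_real_pos[of ?y] by (simp add: pos_le_divide_eq)
    then show ?thesis using x by linarith
  qed
  ultimately show "\<exists>y. ((\<lambda>x. x\<^sup>2 - 16 * first_fun x) has_real_derivative y) (at x) \<and> y \<le> 0" by blast
qed

text \<open>The derivative of \<open>fourth_fun\<close> is at most - 2x/3, so b^2 falls in t at rate
  at most 3.\<close>

lemma fourth_slope:
  assumes "2 < a" "a \<le> b" "b \<le> 3"
  shows "b\<^sup>2 + 3 * fourth_fun b \<le> a\<^sup>2 + 3 * fourth_fun a"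
proof (rule DERIV_nonpos_imp_nonincreasing[OF assms(2)])
  fix x assume "a \<le> x" "x \<le> b"
  then have x: "2 < x" "x \<le> 3" using assms by auto
  let ?y = "x * (pi/2)"
  have s: "sin ?y < 0" using trig_signs'[of x] x by simp
  have "((\<lambda>x. x\<^sup>2 + 3 * fourth_fun x) has_real_derivative
     2 * x + 3 * ((sin ?y * cos ?y - ?y) / (sin ?y)\<^sup>2)) (at x)"
    unfolding fourth_fun_def by (intro DERIV_add DERIV_cmult DERIV_mult_cot)
      (use s in \<open>auto intro!: derivative_eq_intros\<close>)
  moreover have "2 * x + 3 * ((sin ?y * cos ?y - ?y) / (sin ?y)\<^sup>2) \<le> 0"
  proof -
    have "\<bar>sin ?y * cos ?y\<bar> \<le> 1 * 1" unfolding abs_mult by (intro mult_mono) auto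
    moreover have "3/2 * x \<le> ?y" using x pi_gt3 by simp
    ultimately have y: "2/3 * x \<le> ?y - sin ?y * cos ?y" using x by linarith
    have "2/3 * x * (sin ?y)\<^sup>2 \<le> 2/3 * x * 1"
      using x abs_square_le_1[of "sin ?y"] by (intro mult_left_mono) auto
    with y have "2/3 * x * (sin ?y)\<^sup>2 \<le> ?y - sin ?y * cos ?y" by linarith
    then have "2/3 * x \<le> (?y - sin ?y * cos ?y) / (sin ?y)\<^sup>2" using s by (simp add: pos_le_divide_eq)
    moreover have "(sin ?y * cos ?y - ?y) / (sin ?y)\<^sup>2 = - ((?y - sin ?y * cos ?y) / (sin ?y)\<^sup>2)"
      by (simp add: minus_divide_left)
    ultimately show ?thesis by linarith
  qed
  ultimately show "\<exists>y. ((\<lambda>x. x\<^sup>2 + 3 * fourth_fun x) has_real_derivative y) (at x) \<and> y \<le> 0" by blast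
qed

text \<open>As \<open>t\<close> increases, \<open>2a\<^sup>2\<close> decreases at rate at most \<open>43/20\<close>, while \<open>p\<^sup>2\<close> increases at
  rate at least \<open>23/10\<close>, which is larger.\<close>

lemma comparison_strict_decreasing:
  assumes t: "69/50 \<le> s" "s < t"
    and s: "first_eq s p" "third_eq s a" "fourth_eq s b" and t': "first_eq t q" "third_eq t c" "fourth_eq t d"
  shows "d\<^sup>2 - q\<^sup>2 - 2 * c\<^sup>2 < b\<^sup>2 - p\<^sup>2 - 2 * a\<^sup>2"
proof -
  have "a \<le> 77/50" by (rule third_le[OF s(2) _ _ _ t(1)]) (use numeric_a_3 in simp_all)
  moreover have "c \<le> a" using third_fun_le_iff[of a c] s t t' by (simp add: third_eq_def)
  ultimately have "2 * a\<^sup>2 + 43/20 * s \<le> 2 * c\<^sup>2 + 43/20 * t"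
    using third_slope[of c a] s t' by (simp add: third_eq_def)
  moreover have "s \<le> p" using first_ge_parameter[OF s(1)] t by simp
  moreover have "p \<le> q" using first_fun_le_iff[of p q] s t t' by (simp add: first_eq_iff)
  ultimately have "p\<^sup>2 - 23/10 * s \<le> q\<^sup>2 - 23/10 * t"
    using first_slope_lower[of p q] s t t' by (simp add: first_eq_iff)
  moreover have "d \<le> b" using fourth_fun_le_iff[of b d] s t t' by (simp add: fourth_eq_def)
  then have "d\<^sup>2 \<le> b\<^sup>2" using t' by (intro power_mono) (auto simp: fourth_eq_def)
  ultimately show ?thesis using t \<open>2 * a\<^sup>2 + 43/20 * s \<le> 2 * c\<^sup>2 + 43/20 * t\<close> by linarith
qed

text \<open>A one-sided bound: the difference falls at rate at most 19 = 16 + 3, the contributions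
  of \<open>p\<close> and \<open>b\<close>, while the decrease of \<open>a\<close> acts in the
  favourable direction.\<close>

lemma comparison_Lipschitz:
  assumes t: "69/50 \<le> s" "s < t" "t \<le> 2"
    and s: "first_eq s p" "third_eq s a" "fourth_eq s b" and t': "first_eq t q" "third_eq t c" "fourth_eq t d"
  shows "b\<^sup>2 - p\<^sup>2 - 2 * a\<^sup>2 \<le> d\<^sup>2 - q\<^sup>2 - 2 * c\<^sup>2 + 19 * (t - s)"
proof -
  have "c \<le> a" using third_fun_le_iff[of a c] s t t' by (simp add: third_eq_def)
  then have "c\<^sup>2 \<le> a\<^sup>2" using t' by (intro power_mono) (auto simp: third_eq_def)
  moreover have "d \<le> b" using fourth_fun_le_iff[of b d] s t t' by (simp add: fourth_eq_def)
  then have "b\<^sup>2 + 3 * s \<le> d\<^sup>2 + 3 * t" using fourth_slope[of d b] s t' by (simp add: fourth_eq_def)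
  moreover have "q\<^sup>2 - 16 * t \<le> p\<^sup>2 - 16 * s"
  proof -
    have "1 \<le> p" using first_ge_parameter[OF s(1)] t by simp
    moreover have "p \<le> q" using first_fun_le_iff[of p q] s t t' by (simp add: first_eq_iff)
    \<comment> \<open>At 4 the value of \<open>first_fun\<close> is at least 4 times 1/2, which is
      at least \<open>t\<close>.\<close>
    moreover have "q \<le> 4"
    proof (rule first_le[OF t'(1) _ _ t(3)])
      have "1 * 1 \<le> (4::real) * (pi/2)" using pi_gt3 by simp
      then have "cosh (4 * (pi/2)) / 2 \<le> sinh (4 * (pi/2))" using cosh_le_2_sinh[of "4 * (pi/2)"] by simp
      then show "2 * cosh (4 * (pi/2)) \<le> 4 * sinh (4 * (pi/2))" by simp
    qed simp
    ultimately show ?thesis using first_slope_upper[of p q] s t' by (simp add: first_eq_iff)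
  qed
  ultimately show ?thesis unfolding right_diff_distrib by linarith
qed

text \<open>The threshold \<open>r\<close> is the supremum of the parameters in [1.38, 1.62935] with
  nonnegative difference. Above it the sign follows from the supremum and, beyond 1.62935, from
  monotonicity. At and below it, members of \<open>S\<close> close to \<open>r\<close> are compared
  by monotonicity if they lie to the right, and by the Lipschitz bound, in place of continuity, if
  they lie to the left. The numerical bounds at 1.62925 and 1.62935 enclose
  \<open>r\<close>.\<close>

theorem comparison_crossing:
  assumes ex: "\<And>t. t \<ge> 0 \<Longrightarrow> \<exists>p a b. first_eq t p \<and> third_eq t a \<and> fourth_eq t b"
    and gap: "\<And>t a b. t \<ge> 0 \<Longrightarrow> third_eq t a \<Longrightarrow> fourth_eq t b \<Longrightarrow> a + 1 \<le> b"
  shows "\<exists>r. \<bar>r - 1.6293\<bar> \<le> 0.00005 \<and> (\<forall>t p a b. t \<ge> 0 \<longrightarrow> first_eq t p \<longrightarrow> third_eq t a \<longrightarrow> fourth_eq t b \<longrightarrow>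
    (t \<le> r \<longrightarrow> 2 * a\<^sup>2 \<le> b\<^sup>2 - p\<^sup>2) \<and> (r < t \<longrightarrow> b\<^sup>2 - p\<^sup>2 < 2 * a\<^sup>2))"
proof -
  define S where "S = {t. 69/50 \<le> t \<and> t \<le> 32587/20000 \<and> (\<exists>p a b. first_eq t p \<and> third_eq t a \<and> fourth_eq t b \<and> 0 \<le> b\<^sup>2 - p\<^sup>2 - 2 * a\<^sup>2)}"
  define r where "r = Sup S"
  have upper: "b\<^sup>2 - p\<^sup>2 - 2 * a\<^sup>2 < 0" if "first_eq (32587/20000) p" "third_eq (32587/20000) a" "fourth_eq (32587/20000) b" for p a b
  proof -
    have "329569/200000 \<le> p" by (rule first_ge[OF that(1) _ numeric_p_5]) simp
    then have "(329569/200000)\<^sup>2 \<le> p\<^sup>2" by (intro power_mono) auto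
    moreover have "29331/20000 \<le> a" by (rule third_ge[OF that(2)]) (use numeric_a_5 in simp_all)
    then have "(29331/20000)\<^sup>2 \<le> a\<^sup>2" by (intro power_mono) auto
    moreover have "b \<le> 165559/62500" by (rule fourth_le[OF that(3)]) (use numeric_b_5 in simp_all)
    then have "b\<^sup>2 \<le> (165559/62500)\<^sup>2" using that(3) by (intro power_mono) (auto simp: fourth_eq_def)
    ultimately show ?thesis by (simp add: power2_eq_square)
  qed
  have lower: "0 \<le> b\<^sup>2 - p\<^sup>2 - 2 * a\<^sup>2" if "first_eq (6517/4000) p" "third_eq (6517/4000) a" "fourth_eq (6517/4000) b" for p a b
  proof -
    have "p \<le> 329553/200000" by (rule first_le[OF that(1) _ numeric_p_4]) simp_all
    then have "p\<^sup>2 \<le> (329553/200000)\<^sup>2" using that(1) by (intro power_mono) (auto simp: first_eq_def)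
    moreover have "a \<le> 293317/200000" by (rule third_le[OF that(2) _ _ _ order_refl]) (use numeric_a_4 in simp_all)
    then have "a\<^sup>2 \<le> (293317/200000)\<^sup>2" using that(2) by (intro power_mono) (auto simp: third_eq_def)
    moreover have "52979/20000 \<le> b" by (rule fourth_ge[OF that(3) _ _ _ order_refl]) (use numeric_b_4 in simp_all)
    then have "(52979/20000)\<^sup>2 \<le> b\<^sup>2" by (intro power_mono) auto
    ultimately show ?thesis by (simp add: power2_eq_square)
  qed
  have inS: "6517/4000 \<in> S"
  proof -
    obtain p a b where e: "first_eq (6517/4000) p" "third_eq (6517/4000) a" "fourth_eq (6517/4000) b"
      using ex[of "6517/4000"] by auto
    with lower[OF e] show ?thesis unfolding S_def by (intro CollectI conjI exI) simp_all
  qed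
  have bdd: "bdd_above S" by (rule bdd_aboveI[of _ "32587/20000"]) (auto simp: S_def)
  have r: "6517/4000 \<le> r" "r \<le> 32587/20000"
  proof -
    show "6517/4000 \<le> r" unfolding r_def by (rule cSup_upper[OF inS bdd])
    have "x \<le> 32587/20000" if "x \<in> S" for x using that by (simp add: S_def)
    then show "r \<le> 32587/20000" unfolding r_def using inS by (intro cSup_least) blast+
  qed
  have "(t \<le> r \<longrightarrow> 2 * a\<^sup>2 \<le> b\<^sup>2 - p\<^sup>2) \<and> (r < t \<longrightarrow> b\<^sup>2 - p\<^sup>2 < 2 * a\<^sup>2)"
    if t: "t \<ge> 0" and e: "first_eq t p" "third_eq t a" "fourth_eq t b" for t p a b
  proof (intro conjI impI)
    assume tr: "r < t"
    show "b\<^sup>2 - p\<^sup>2 < 2 * a\<^sup>2"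
    proof (cases "t \<le> 32587/20000")
      case True
      have "t \<notin> S" using cSup_upper[OF _ bdd, of t] tr by (auto simp: r_def)
      then show ?thesis using e True tr r unfolding S_def by force
    next
      case False
      obtain q c d where q: "first_eq (32587/20000) q" "third_eq (32587/20000) c" "fourth_eq (32587/20000) d"
        using ex[of "32587/20000"] by auto
      show ?thesis using comparison_strict_decreasing[OF _ _ q e] upper[OF q] False by simp
    qed
  next
    assume tr: "t \<le> r"
    show "2 * a\<^sup>2 \<le> b\<^sup>2 - p\<^sup>2"
    proof (cases "t \<le> 69/50")
      case True
      then show ?thesis using comparison_small[OF t True e gap[OF t e(2,3)]] by simp
    next
      case False
      have "- (19 * \<epsilon>) \<le> b\<^sup>2 - p\<^sup>2 - 2 * a\<^sup>2" if "\<epsilon> > 0" for \<epsilon>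
      proof -
        have "t - \<epsilon> < Sup S" using tr that by (simp add: r_def)
        then obtain s where s: "s \<in> S" "t - \<epsilon> < s" using less_cSupD[of S] inS by blast
        then obtain q c d where q: "69/50 \<le> s" "first_eq s q" "third_eq s c" "fourth_eq s d" "0 \<le> d\<^sup>2 - q\<^sup>2 - 2 * c\<^sup>2"
          unfolding S_def by blast
        consider "s < t" | "s = t" | "t < s" by linarith
        then show ?thesis
        proof cases
          case 1
          then show ?thesis
            using comparison_Lipschitz[OF q(1) 1 _ q(2-4) e] q(5) s(2) tr r(2) by simp
        next
          case 2
          have "p = q" "a = c" "b = d"
            using 2 e q first_fun_le_iff[of p q] first_fun_le_iff[of q p] third_fun_le_iff[of a c] third_fun_le_iff[of c a]
              fourth_fun_le_iff[of b d] fourth_fun_le_iff[of d b]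
            by (auto simp: first_eq_iff third_eq_def fourth_eq_def)
          then show ?thesis using q that by simp
        next
          case 3
          then show ?thesis using comparison_strict_decreasing[OF _ 3 e q(2-4)] False q(5) that by simp
        qed
      qed
      note * = this
      have "0 \<le> b\<^sup>2 - p\<^sup>2 - 2 * a\<^sup>2 + \<epsilon>" if "\<epsilon> > 0" for \<epsilon> using *[of "\<epsilon> / 19"] that by simp
      then have "0 \<le> b\<^sup>2 - p\<^sup>2 - 2 * a\<^sup>2" by (rule field_le_epsilon)
      then show ?thesis by simp
    qed
  qed
  moreover have "\<bar>r - 1.6293\<bar> \<le> 0.00005" using r unfolding abs_le_iff by simp
  ultimately show ?thesis by blast
qed

section \<open>Nodal domains\<close>

lemma connected_nonzero_sign:
  fixes u :: "'a::topological_space \<Rightarrow> real"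
  assumes "connected C" "continuous_on C u" "\<And>x. x \<in> C \<Longrightarrow> u x \<noteq> 0" "x \<in> C" "y \<in> C" "u x > 0"
  shows "u y > 0"
proof (rule ccontr)
  assume "\<not> u y > 0"
  moreover have "connected (u ` C)" by (rule connected_continuous_image[OF assms(2,1)])
  then have "{u y..u x} \<subseteq> u ` C" using assms by (intro connected_contains_Icc) auto
  ultimately have "0 \<in> u ` C" using assms(6) by force
  then show False using assms(3) by auto
qed

lemma uminus_components:
  fixes S :: "'a::real_normed_vector set"
  assumes S: "uminus ` S = S" and C: "C \<in> components S"
  shows "uminus ` C \<in> components S"
proof -
  have inv: "uminus ` uminus ` A = A" for A :: "'a set" by (simp add: image_image)
  have conn: "connected (uminus ` A)" if "connected A" for A :: "'a set"
    by (intro connected_continuous_image continuous_intros that)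
  have C': "C \<noteq> {}" "C \<subseteq> S" "connected C" "\<And>D. D \<noteq> {} \<Longrightarrow> C \<subseteq> D \<Longrightarrow> D \<subseteq> S \<Longrightarrow> connected D \<Longrightarrow> D = C"
    using C unfolding in_components_maximal by blast+
  show ?thesis
    unfolding in_components_maximal
  proof (intro conjI allI impI)
    show "uminus ` C \<noteq> {}" "uminus ` C \<subseteq> S" "connected (uminus ` C)"
      using C' S conn by (auto intro!: image_mono[of C S uminus, unfolded S])
    fix D assume "D \<noteq> {} \<and> uminus ` C \<subseteq> D \<and> D \<subseteq> S \<and> connected D"
    then have D: "D \<noteq> {}" "uminus ` C \<subseteq> D" "D \<subseteq> S" "connected D" by auto
    have "uminus ` D = C"
    proof (rule C'(4))
      show "C \<subseteq> uminus ` D" using image_mono[OF D(2), of uminus] unfolding inv .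
      show "uminus ` D \<subseteq> S" using image_mono[OF D(3), of uminus] unfolding S .
    qed (use D conn in auto)
    then show "D = uminus ` C" using inv[of D] by metis
  qed
qed

text \<open>The central reflection exchanges the nodal domains on which \<open>u\<close> is positive with those on which it
  is negative.\<close>

lemma even_card_nodal_domains:
  assumes u: "continuous_on square u" and odd: "\<And>x. x \<in> square \<Longrightarrow> u (- x) = - u x"
    and fin: "finite (nodal_domains u)"
  shows "even (card (nodal_domains u))"
proof -
  define S where "S = square - u -` {0}"
  define P where "P = {C \<in> components S. \<forall>x\<in>C. u x > 0}"
  define N where "N = {C \<in> components S. \<forall>x\<in>C. u x < 0}"
  have sq: "- x \<in> square \<longleftrightarrow> x \<in> square" for x
    by (cases x) (auto simp: square_def)
  have SS: "- x \<in> S \<longleftrightarrow> x \<in> S" for x using odd[of x] sq[of x] by (auto simp: S_def)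
  have S: "uminus ` S = S"
  proof (intro equalityI subsetI)
    fix x assume "x \<in> S" then show "x \<in> uminus ` S" using SS[of x] by (intro image_eqI[of _ _ "- x"]) auto
  qed (use SS in auto)
  have f: "finite (components S)" using fin by (simp add: nodal_domains_def S_def)
  have sub: "C \<subseteq> S" "C \<noteq> {}" "connected C" if "C \<in> components S" for C
    using that in_components_subset in_components_nonempty in_components_connected by auto
  have cont: "continuous_on C u" if "C \<in> components S" for C
    using continuous_on_subset[OF u] sub(1)[OF that] by (auto simp: S_def)
  have "components S = P \<union> N"
  proof (intro equalityI subsetI)
    fix C assume C: "C \<in> components S"
    obtain x where x: "x \<in> C" using sub(2)[OF C] by auto
    have nz: "u y \<noteq> 0" if "y \<in> C" for y using that sub(1)[OF C] by (auto simp: S_def)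
    show "C \<in> P \<union> N"
    proof (cases "u x > 0")
      case True
      then have "\<forall>y\<in>C. u y > 0" using connected_nonzero_sign[OF sub(3)[OF C] cont[OF C] nz x] by blast
      then show ?thesis using C by (auto simp: P_def)
    next
      case False
      then have "u x < 0" using nz[OF x] by auto
      have "\<forall>y\<in>C. u y < 0"
      proof
        fix y assume y: "y \<in> C"
        have "\<not> u y > 0" using connected_nonzero_sign[OF sub(3)[OF C] cont[OF C] nz y x] \<open>u x < 0\<close> by auto
        then show "u y < 0" using nz[OF y] by auto
      qed
      then show ?thesis using C by (auto simp: N_def)
    qed
  qed (auto simp: P_def N_def)
  moreover have "P \<inter> N = {}"
  proof (rule ccontr)
    assume "P \<inter> N \<noteq> {}"
    then obtain C where "C \<in> components S" "\<forall>x\<in>C. u x > 0" "\<forall>x\<in>C. u x < 0" by (auto simp: P_def N_def)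
    moreover obtain x where "x \<in> C" using sub(2)[OF calculation(1)] by auto
    ultimately show False by force
  qed
  moreover have "card P = card N"
  proof (rule bij_betw_same_card)
    have odd': "u (- x) = - u x" if "x \<in> C" "C \<in> components S" for x C
    proof (rule odd)
      show "x \<in> square" using sub(1)[OF that(2)] that(1) by (auto simp: S_def)
    qed
    have PN: "(`) uminus ` P \<subseteq> N" and NP: "(`) uminus ` N \<subseteq> P"
      using uminus_components[OF S] odd' by (auto simp: P_def N_def)
    have inv: "uminus ` uminus ` A = A" for A :: "(real \<times> real) set" by (simp add: image_image)
    show "bij_betw ((`) uminus) P N"
      by (rule bij_betw_byWitness[where f' = "(`) uminus"]) (use PN NP inv in auto)
  qed
  ultimately have "card (components S) = 2 * card P"
    using f by (simp add: card_Un_disjoint)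
  then show ?thesis by (simp add: nodal_domains_def S_def)
qed

text \<open>The zeros of cos (ax) in the open side are exactly z and -z with z = pi / (2a): a > 1
  puts them inside, and a \<le> 2 leaves room for no others. The products of the three resulting
  intervals are open, connected and disjoint, hence the components.\<close>

lemma nine_nodal_domains:
  assumes a: "1 < a" "a \<le> 2"
  shows "finite (nodal_domains (tensor (even_mode (a\<^sup>2)) (even_mode (a\<^sup>2))))"
    and "card (nodal_domains (tensor (even_mode (a\<^sup>2)) (even_mode (a\<^sup>2)))) = 9"
proof -
  let ?u = "tensor (even_mode (a\<^sup>2)) (even_mode (a\<^sup>2))"
  define z where "z = pi / (2 * a)"
  have z: "0 < z" "z < pi/2" "a * z = pi/2" using a by (auto simp: z_def field_simps)
  have em: "even_mode (a\<^sup>2) x = cos (a * x)" for x using a by (simp add: even_mode_def)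
  have zero: "cos (a * x) = 0 \<longleftrightarrow> x = z \<or> x = - z" if "- (pi/2) < x" "x < pi/2" for x
  proof -
    have "\<bar>x\<bar> < pi/2" using that by auto
    then have "a * \<bar>x\<bar> \<le> 2 * (pi/2)" using a by (intro mult_mono) auto
    then have b: "0 \<le> a * \<bar>x\<bar>" "a * \<bar>x\<bar> \<le> pi" using a by auto
    have "cos (a * x) = cos (a * \<bar>x\<bar>)" by (cases "x \<ge> 0") auto
    moreover have "cos (a * \<bar>x\<bar>) = 0 \<longleftrightarrow> a * \<bar>x\<bar> = a * z"
    proof
      assume "cos (a * \<bar>x\<bar>) = 0"
      then show "a * \<bar>x\<bar> = a * z" using cos_inj_pi[OF b, of "pi/2"] unfolding z(3) by simp
    next
      assume "a * \<bar>x\<bar> = a * z"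
      then show "cos (a * \<bar>x\<bar>) = 0" unfolding z(3) by (simp only: cos_pi_half)
    qed
    moreover have "a * \<bar>x\<bar> = a * z \<longleftrightarrow> \<bar>x\<bar> = z" using a by simp
    moreover have "\<bar>x\<bar> = z \<longleftrightarrow> x = z \<or> x = - z" using z by auto
    ultimately show ?thesis by simp
  qed
  define I where "I = {{- (pi/2)<..<-z}, {-z<..<z}, {z<..<pi/2}}"
  have I_open: "open X" "connected X" "X \<noteq> {}" if "X \<in> I" for X
    using that z by (auto simp: I_def)
  have I_disj: "X \<inter> Y = {}" if "X \<in> I" "Y \<in> I" "X \<noteq> Y" for X Y
    using that z by (auto simp: I_def)
  have ne: "{- (pi/2)<..<-z} \<noteq> {-z<..<z}" "{- (pi/2)<..<-z} \<noteq> {z<..<pi/2}" "{-z<..<z} \<noteq> {z<..<pi/2}"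
  proof -
    have "0 \<in> {-z<..<z}" "0 \<notin> {- (pi/2)<..<-z}" "0 \<notin> {z<..<pi/2}" using z by auto
    moreover obtain x where "z < x" "x < pi/2" using dense[OF z(2)] by auto
    then have "x \<in> {z<..<pi/2}" "x \<notin> {- (pi/2)<..<-z}" using z by auto
    ultimately show "{- (pi/2)<..<-z} \<noteq> {-z<..<z}" "{- (pi/2)<..<-z} \<noteq> {z<..<pi/2}" "{-z<..<z} \<noteq> {z<..<pi/2}"
      by blast+
  qed
  have cardI: "card I = 3" "finite I" unfolding I_def using ne by auto
  have UI: "\<Union>I = {x. - (pi/2) < x \<and> x < pi/2 \<and> cos (a * x) \<noteq> 0}"
  proof (intro equalityI subsetI)
    fix x assume "x \<in> \<Union>I"
    then have "- (pi/2) < x \<and> x < pi/2 \<and> x \<noteq> z \<and> x \<noteq> - z" using z by (auto simp: I_def)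
    then show "x \<in> {x. - (pi/2) < x \<and> x < pi/2 \<and> cos (a * x) \<noteq> 0}" using zero[of x] by auto
  next
    fix x assume "x \<in> {x. - (pi/2) < x \<and> x < pi/2 \<and> cos (a * x) \<noteq> 0}"
    then have "- (pi/2) < x \<and> x < pi/2 \<and> x \<noteq> z \<and> x \<noteq> - z" using zero[of x] by auto
    then show "x \<in> \<Union>I" by (auto simp: I_def)
  qed
  define A where "A = (\<lambda>(X, Y). X \<times> Y) ` (I \<times> I)"
  have "components (square - ?u -` {0}) = A"
  proof (rule components_open_unique)
    show "pairwise disjnt A"
    proof (rule pairwiseI)
      fix B C assume "B \<in> A" "C \<in> A" "B \<noteq> C"
      then obtain X Y X' Y' where *: "B = X \<times> Y" "C = X' \<times> Y'" "X \<in> I" "Y \<in> I" "X' \<in> I" "Y' \<in> I" "X \<noteq> X' \<or> Y \<noteq> Y'"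
        by (auto simp: A_def)
      then have "X \<inter> X' = {} \<or> Y \<inter> Y' = {}" using I_disj by blast
      then show "disjnt B C" using * by (auto simp: disjnt_def)
    qed
    have "\<Union>A = \<Union>I \<times> \<Union>I" by (auto simp: A_def)
    also have "\<dots> = square - ?u -` {0}"
      unfolding UI by (auto simp: square_def tensor_def em)
    finally show "\<Union>A = square - ?u -` {0}" .
    show "open X \<and> connected X \<and> X \<noteq> {}" if "X \<in> A" for X
      using that I_open by (auto simp: A_def intro: open_Times connected_Times)
  qed
  then have nd: "nodal_domains ?u = A" by (simp add: nodal_domains_def)
  have "inj_on (\<lambda>(X, Y). X \<times> Y) (I \<times> I)"
    using I_open(3) by (auto simp: inj_on_def times_eq_iff)
  then have "card A = card (I \<times> I)" unfolding A_def by (rule card_image)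
  then show "card (nodal_domains ?u) = 9" unfolding nd using cardI by (simp add: card_cartesian_product)
  show "finite (nodal_domains ?u)" unfolding nd A_def using cardI by auto
qed

section \<open>The ninth eigenvalue\<close>

context
  fixes t p m a b :: real
  assumes t: "t \<ge> 0" and p: "first_eq t p" and p_root: "robin_root t False (- (p\<^sup>2))"
    and m: "m \<le> 1" "robin_root t True m"
    and a: "third_eq t a" and b: "fourth_eq t b"
begin

private lemma a_root: "1 < a" "a \<le> 2" "robin_root t False (a\<^sup>2)"
  using a third_root_iff[of a t] by (auto simp: third_eq_def third_fun_def)

private lemma b_root: "2 < b" "b \<le> 3" "robin_root t True (b\<^sup>2)"
  using b fourth_root_iff[of b t] by (auto simp: fourth_eq_def fourth_fun_def)

text \<open>The third inequality adds the two gaps: b \<ge> a + 1 with a > 1 gives b^2 \<ge> a^2 +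
  3, and m + p^2 < 3.\<close>

private lemma order: "- (p\<^sup>2) < m" "m < a\<^sup>2" "m + a\<^sup>2 < b\<^sup>2 - p\<^sup>2" "a\<^sup>2 < b\<^sup>2"
proof -
  have gap: "- (p\<^sup>2) < m" "m + p\<^sup>2 < 3"
    using first_second_gap[OF t _ _ m(2,1)] p by (auto simp: first_eq_def)
  show "- (p\<^sup>2) < m" by (rule gap(1))
  have "1\<^sup>2 < a\<^sup>2" using a_root by (intro power_strict_mono) auto
  then show "m < a\<^sup>2" using m by simp
  have "(a + 1)\<^sup>2 \<le> b\<^sup>2"
    using third_fourth_gap[OF t a_root b_root] a_root by (intro power_mono) auto
  then have "a\<^sup>2 + 3 \<le> b\<^sup>2" using a_root by (simp add: power2_eq_square algebra_simps)
  then show "m + a\<^sup>2 < b\<^sup>2 - p\<^sup>2" "a\<^sup>2 < b\<^sup>2" using gap by auto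
qed

private lemma roots_cases:
  assumes "x \<in> roots t"
  shows "x \<in> {(False, - (p\<^sup>2)), (True, m), (False, a\<^sup>2), (True, b\<^sup>2)} \<or> b\<^sup>2 < snd x"
proof -
  have "- (p\<^sup>2) \<le> 1" using zero_le_power2[of p] by linarith
  from root_classification[OF t p_root this m(2,1) a_root b_root, of "fst x" "snd x"]
  show ?thesis using assms by (simp add: roots_def)
qed

private lemma roots_lower:
  assumes "x \<in> roots t"
  shows "- (p\<^sup>2) \<le> snd x" and "snd x = - (p\<^sup>2) \<Longrightarrow> x = (False, - (p\<^sup>2))"
  using roots_cases[OF assms] order by auto

private definition low :: "mode_index set" where
  "low = {(False, - (p\<^sup>2)), (True, m), (False, a\<^sup>2)}"

private lemma roots_not_low:
  assumes "x \<in> roots t" "x \<notin> low"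
  shows "b\<^sup>2 \<le> snd x" and "snd x = b\<^sup>2 \<Longrightarrow> x = (True, b\<^sup>2)"
  using roots_cases[OF assms(1)] assms(2) by (auto simp: low_def)

private lemma low_roots: "low \<subseteq> roots t"
  using p_root m a_root by (auto simp: low_def roots_def)

text \<open>The eight products that precede the ninth eigenvalue for every \<open>t\<close>: their
  values are at most m + a^2, which is less than both 2a^2 and b^2 - p^2.\<close>

private abbreviation low_pairs :: "(mode_index \<times> mode_index) set" where
  "low_pairs \<equiv> low \<times> low - {((False, a\<^sup>2), (False, a\<^sup>2))}"

private lemma card_low_pairs: "card low_pairs = 8"
proof -
  have "card low = 3" using order by (auto simp: low_def)
  moreover have "finite low" by (simp add: low_def)
  moreover have "((False, a\<^sup>2), (False, a\<^sup>2)) \<in> low \<times> low" by (simp add: low_def)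
  ultimately show ?thesis by (simp add: card_Diff_singleton card_cartesian_product)
qed

private lemma low_pairs_value:
  assumes "q \<in> low_pairs"
  shows "product_value q \<le> m + a\<^sup>2"
proof -
  obtain x y where q: "q = (x, y)" by (cases q)
  have "snd x \<le> m \<or> x = (False, a\<^sup>2)" "snd y \<le> m \<or> y = (False, a\<^sup>2)"
    using assms order by (auto simp: q low_def)
  moreover have "\<not> (x = (False, a\<^sup>2) \<and> y = (False, a\<^sup>2))" using assms by (auto simp: q)
  ultimately show ?thesis using order unfolding q product_value_def by auto
qed

text \<open>A factor outside \<open>low\<close> contributes at least b^2 and the other at least -
  p^2; equality forces equality in both, which identifies the factors including their
  parity.\<close>

private lemma product_value_not_low:
  assumes "x \<in> roots t" "y \<in> roots t" "x \<notin> low \<or> y \<notin> low"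
  shows "b\<^sup>2 - p\<^sup>2 \<le> product_value (x, y)"
    and "product_value (x, y) = b\<^sup>2 - p\<^sup>2 \<Longrightarrow>
       (x, y) \<in> {((False, - (p\<^sup>2)), (True, b\<^sup>2)), ((True, b\<^sup>2), (False, - (p\<^sup>2)))}"
proof -
  have *: "b\<^sup>2 - p\<^sup>2 \<le> snd x + snd y \<and>
      (snd x + snd y = b\<^sup>2 - p\<^sup>2 \<longrightarrow> x = (True, b\<^sup>2) \<and> y = (False, - (p\<^sup>2)))"
    if "x \<in> roots t" "y \<in> roots t" "x \<notin> low" for x y
  proof -
    have le: "b\<^sup>2 \<le> snd x" "- (p\<^sup>2) \<le> snd y" using roots_not_low(1) roots_lower(1) that by auto
    moreover have "snd x = b\<^sup>2 \<and> snd y = - (p\<^sup>2)" if "snd x + snd y = b\<^sup>2 - p\<^sup>2" using le that by linarith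
    ultimately show ?thesis using roots_not_low(2)[OF that(1,3)] roots_lower(2)[OF that(2)] by auto
  qed
  show "b\<^sup>2 - p\<^sup>2 \<le> product_value (x, y)"
    using *[OF assms(1,2)] *[OF assms(2,1)] assms(3) by (auto simp: product_value_def add.commute)
  show "(x, y) \<in> {((False, - (p\<^sup>2)), (True, b\<^sup>2)), ((True, b\<^sup>2), (False, - (p\<^sup>2)))}"
    if v: "product_value (x, y) = b\<^sup>2 - p\<^sup>2"
  proof -
    have "snd x + snd y = b\<^sup>2 - p\<^sup>2" "snd y + snd x = b\<^sup>2 - p\<^sup>2"
      using v by (simp_all add: product_value_def)
    then have "x = (True, b\<^sup>2) \<and> y = (False, - (p\<^sup>2)) \<or> y = (True, b\<^sup>2) \<and> x = (False, - (p\<^sup>2))"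
      using *[OF assms(1,2)] *[OF assms(2,1)] assms(3) by blast
    then show ?thesis by blast
  qed
qed

private lemma ninth_eigenvalue: "robin_eigenvalue 9 (- t) = min (2 * a\<^sup>2) (b\<^sup>2 - p\<^sup>2)"
proof (rule robin_eigenvalue_eqI[OF t])
  let ?\<kappa> = "min (2 * a\<^sup>2) (b\<^sup>2 - p\<^sup>2)"
  have "{q \<in> roots t \<times> roots t. product_value q < ?\<kappa>} \<subseteq> low_pairs"
  proof
    fix q assume q: "q \<in> {q \<in> roots t \<times> roots t. product_value q < ?\<kappa>}"
    obtain x y where xy: "q = (x, y)" by (cases q)
    have "x \<in> low \<and> y \<in> low" using product_value_not_low(1)[of x y] q by (auto simp: xy)
    moreover have "q \<noteq> ((False, a\<^sup>2), (False, a\<^sup>2))" using q by (auto simp: product_value_def)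
    ultimately show "q \<in> low_pairs" by (simp add: xy)
  qed
  then have "card {q \<in> roots t \<times> roots t. product_value q < ?\<kappa>} \<le> card low_pairs"
    by (rule card_mono[rotated]) (simp add: low_def)
  then show "card {q \<in> roots t \<times> roots t. product_value q < ?\<kappa>} < 9" unfolding card_low_pairs by simp
  \<comment> \<open>A ninth product, which attains the minimum. In the second case its mirror image
    has the same value, but one further product is enough for the count.\<close>
  define z where "z = (if 2 * a\<^sup>2 \<le> b\<^sup>2 - p\<^sup>2 then ((False, a\<^sup>2), (False, a\<^sup>2)) else ((False, - (p\<^sup>2)), (True, b\<^sup>2)))"
  have z: "z \<in> roots t \<times> roots t" "product_value z = ?\<kappa>"
    using a_root b_root p_root by (auto simp: z_def roots_def product_value_def)
  have "(True, b\<^sup>2) \<notin> low" using order by (auto simp: low_def)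
  then have "z \<notin> low_pairs" by (auto simp: z_def)
  moreover have "finite low_pairs" by (simp add: low_def)
  ultimately have "card (insert z low_pairs) = Suc (card low_pairs)" by (intro card_insert_disjoint)
  then have "9 = card (insert z low_pairs)" unfolding card_low_pairs by simp
  also have "\<dots> \<le> card {q \<in> roots t \<times> roots t. product_value q \<le> ?\<kappa>}"
  proof (rule card_mono[OF finite_product_values_le[OF t]], rule insert_subsetI)
    show "z \<in> {q \<in> roots t \<times> roots t. product_value q \<le> ?\<kappa>}" using z by simp
    show "low_pairs \<subseteq> {q \<in> roots t \<times> roots t. product_value q \<le> ?\<kappa>}"
    proof
      fix q assume q: "q \<in> low_pairs"
      have "product_value q \<le> ?\<kappa>" using low_pairs_value[OF q] order by linarith
      then show "q \<in> {q \<in> roots t \<times> roots t. product_value q \<le> ?\<kappa>}" using q low_roots by auto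
    qed
  qed
  finally show "9 \<le> card {q \<in> roots t \<times> roots t. product_value q \<le> ?\<kappa>}" .
qed simp

lemma courant_sharp_if:
  assumes "2 * a\<^sup>2 \<le> b\<^sup>2 - p\<^sup>2"
  shows "courant_sharp 9 (- t)"
proof -
  let ?q = "((False, a\<^sup>2), (False, a\<^sup>2)) :: mode_index \<times> mode_index"
  let ?u = "product_mode ?q"
  have u: "?u = tensor (even_mode (a\<^sup>2)) (even_mode (a\<^sup>2))" by (simp add: product_mode_def mode_def)
  have "robin_solution (- t) (product_value ?q) ?u"
    by (rule product_mode_solution) (use a_root in \<open>simp add: roots_def\<close>)
  moreover have "product_value ?q = robin_eigenvalue 9 (- t)"
    using assms ninth_eigenvalue by (simp add: product_value_def)
  moreover have "\<not> (AE x in area. ?u x = 0)"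
  proof
    assume "AE x in area. ?u x = 0"
    then have "(LINT x|area. ?u x * ?u x) = 0" by (intro integral_eq_zero_AE) auto
    then show False using product_mode_norm_pos[of ?q] by simp
  qed
  ultimately show ?thesis
    unfolding courant_sharp_def robin_eigenfunction_def
    by (intro exI[of _ ?u]) (use a_root nine_nodal_domains[of a] in \<open>simp add: continuous_on_product_mode u[symmetric]\<close>)
qed

lemma not_courant_sharp_if:
  assumes less: "b\<^sup>2 - p\<^sup>2 < 2 * a\<^sup>2"
  shows "\<not> courant_sharp 9 (- t)"
proof
  assume "courant_sharp 9 (- t)"
  then obtain u where u: "robin_solution (- t) (b\<^sup>2 - p\<^sup>2) u" "continuous_on square u"
    "finite (nodal_domains u)" "card (nodal_domains u) = 9"
    using less ninth_eigenvalue by (auto simp: courant_sharp_def robin_eigenfunction_def)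
  obtain c where c: "AE x in area. u x = (\<Sum>q\<in>product_indices t (b\<^sup>2 - p\<^sup>2). c q * product_mode q x)"
    by (rule robin_solution_expansion[OF t u(1)])
  define s where "s = (\<lambda>x. \<Sum>q\<in>product_indices t (b\<^sup>2 - p\<^sup>2). c q * product_mode q x)"
  have indices: "q \<in> {((False, - (p\<^sup>2)), (True, b\<^sup>2)), ((True, b\<^sup>2), (False, - (p\<^sup>2)))}"
    if "q \<in> product_indices t (b\<^sup>2 - p\<^sup>2)" for q
  proof -
    obtain x y where q: "q = (x, y)" by (cases q)
    have xy: "x \<in> roots t" "y \<in> roots t" "product_value (x, y) = b\<^sup>2 - p\<^sup>2"
      using that by (auto simp: product_indices_def q)
    have "q \<notin> low_pairs" using low_pairs_value[of q] order(3) xy(3) unfolding q by linarith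
    moreover have "q \<noteq> ((False, a\<^sup>2), (False, a\<^sup>2))" using xy(3) less by (auto simp: product_value_def q)
    ultimately have "x \<notin> low \<or> y \<notin> low" by (auto simp: q)
    then show ?thesis unfolding q by (rule product_value_not_low(2)[OF xy(1,2) _ xy(3)])
  qed
  \<comment> \<open>Each of the two products is even in one variable and odd in the other.\<close>
  have pm_odd: "product_mode q (- x) = - product_mode q x" if "q \<in> product_indices t (b\<^sup>2 - p\<^sup>2)" for q x
  proof -
    have "q = ((False, - (p\<^sup>2)), (True, b\<^sup>2)) \<or> q = ((True, b\<^sup>2), (False, - (p\<^sup>2)))" using indices[OF that] by blast
    then show ?thesis by (elim disjE) (simp_all add: product_mode_def tensor_def mode_def mode_minus)
  qed
  have s_odd: "s (- x) = - s x" for x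
    unfolding s_def sum_negf[symmetric] by (intro sum.cong refl) (simp add: pm_odd)
  \<comment> \<open>Continuity of \<open>u\<close> upgrades the equality almost everywhere to all of
    the square, so that the symmetry applies to the nodal set of \<open>u\<close> itself.\<close>
  have us: "u x = s x" if "x \<in> square" for x
  proof -
    have "u x - s x = 0"
    proof (rule AE_zero_open_continuous[OF open_square _ _ that])
      show "continuous_on square (\<lambda>x. u x - s x)"
        unfolding s_def by (intro continuous_intros u(2) continuous_on_product_mode)
      show "AE x in area. u x - s x = 0" using c by (simp add: s_def)
    qed
    then show ?thesis by simp
  qed
  have "even (card (nodal_domains u))"
  proof (rule even_card_nodal_domains[OF u(2) _ u(3)])
    fix x assume x: "x \<in> square"
    then have "- x \<in> square" by (cases x) (auto simp: square_def)
    then show "u (- x) = - u x" using us x s_odd by simp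
  qed
  then show False using u(4) by simp
qed

end

theorem theorem1p5:
  shows "\<exists>h9::real. h9 < 0 \<and>
    (\<forall>h. h9 \<le> h \<and> h \<le> 0 \<longrightarrow> courant_sharp 9 h) \<and>
    (\<forall>h. h < h9 \<longrightarrow> \<not> courant_sharp 9 h) \<and>
    \<bar>h9 - (- 1.6293)\<bar> \<le> 0.00005"
proof -
  have ex: "\<exists>p m a b. first_eq t p \<and> robin_root t False (- (p\<^sup>2)) \<and> m \<le> 1 \<and> robin_root t True m \<and>
      third_eq t a \<and> fourth_eq t b" if t: "t \<ge> 0" for t
  proof -
    obtain p where "first_eq t p" "robin_root t False (- (p\<^sup>2))"
      using ex_lowest_even_root[OF t] by (metis first_eq_def)
    moreover obtain m where "m \<le> 1" "robin_root t True m" using ex_low_odd_root[OF t] .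
    moreover obtain a where "1 < a" "a \<le> 2" "robin_root t False (a\<^sup>2)" using ex_third_root[OF t] .
    then have "third_eq t a" by (simp add: third_root_iff third_eq_def third_fun_def)
    moreover obtain b where "2 < b" "b \<le> 3" "robin_root t True (b\<^sup>2)" using ex_fourth_root[OF t] .
    then have "fourth_eq t b" by (simp add: fourth_root_iff fourth_eq_def fourth_fun_def)
    ultimately show ?thesis by blast
  qed
  have gap: "a + 1 \<le> b" if "t \<ge> 0" "third_eq t a" "fourth_eq t b" for t a b
    using third_fourth_gap[OF that(1), of a b] that third_root_iff[of a t] fourth_root_iff[of b t]
    by (auto simp: third_eq_def third_fun_def fourth_eq_def fourth_fun_def)
  have "\<exists>r. \<bar>r - 1.6293\<bar> \<le> 0.00005 \<and> (\<forall>t p a b. t \<ge> 0 \<longrightarrow> first_eq t p \<longrightarrow> third_eq t a \<longrightarrow> fourth_eq t b \<longrightarrow>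
    (t \<le> r \<longrightarrow> 2 * a\<^sup>2 \<le> b\<^sup>2 - p\<^sup>2) \<and> (r < t \<longrightarrow> b\<^sup>2 - p\<^sup>2 < 2 * a\<^sup>2))"
  proof (rule comparison_crossing)
    show "\<exists>p a b. first_eq t p \<and> third_eq t a \<and> fourth_eq t b" if "t \<ge> 0" for t using ex[OF that] by blast
  qed (rule gap)
  then obtain r where r: "\<bar>r - 1.6293\<bar> \<le> 0.00005"
    and cross: "\<And>t p a b. t \<ge> 0 \<Longrightarrow> first_eq t p \<Longrightarrow> third_eq t a \<Longrightarrow> fourth_eq t b \<Longrightarrow>
      (t \<le> r \<longrightarrow> 2 * a\<^sup>2 \<le> b\<^sup>2 - p\<^sup>2) \<and> (r < t \<longrightarrow> b\<^sup>2 - p\<^sup>2 < 2 * a\<^sup>2)" by blast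
  have sharp: "courant_sharp 9 (- t) \<longleftrightarrow> t \<le> r" if t: "t \<ge> 0" for t
  proof -
    obtain p m a b where e: "first_eq t p" "robin_root t False (- (p\<^sup>2))" "m \<le> 1" "robin_root t True m"
      "third_eq t a" "fourth_eq t b" using ex[OF t] by blast
    show ?thesis
      using courant_sharp_if[OF t e] not_courant_sharp_if[OF t e] cross[OF t e(1,5,6)] by (cases "t \<le> r") auto
  qed
  have r0: "0 < r" using r unfolding abs_le_iff by simp
  show ?thesis
  proof (intro exI[of _ "- r"] conjI allI impI)
    show "- r < 0" using r0 by simp
    show "courant_sharp 9 h" if "- r \<le> h \<and> h \<le> 0" for h using sharp[of "- h"] that by simp
    show "\<not> courant_sharp 9 h" if "h < - r" for h using sharp[of "- h"] that r0 by simp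
    show "\<bar>- r - (- 1.6293)\<bar> \<le> 0.00005" using r unfolding abs_le_iff by simp
  qed
qed

end
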